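(* Let $\{X_n^u\}_{n\ge 1}$ be the sequence of symmetric triangular patterned matrices with link function $L$ and real input sequence. Assume: (A) the input random variables are independent with mean $0$ and variance $1$ and either (i) have uniformly bounded moments of all orders, or (ii) are identically distributed; (B) $$\Delta=\sup_n\ \sup_t\ \sup_{1\le k\le n}\#\{l: 1\le l\le n,\ k+l\le n+1,\ L(k,l)=t\}<\infty .$$ Suppose that for every $k\ge 1$ and every pair-matched word $w$ of length $2k$ the limit $$p_u(w)=\lim_{n\to\infty}\frac{\#\Pi_1^*(w)}{n^{1+k}}$$ exists. Then, almost surely, the limiting spectral distribution (LSD) of $X_n^u/\sqrt n$ exists. The LSD is universal (it does not depend on the underlying distributions of the input variables), is symmetric about $0$, and is determined by its even moments $$\beta_{2k}=\sum_{w\ \text{pair-matched of length }2k}p_u(w),\qquad k\ge 1 .$$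
   Context: Input sequence: a family of real random variables $\{x_i\}$ or $\{x_{ij}\}$, indexed by integers or by pairs of integers. Link function: a sequence of functions $L_n:\{1,\dots,n\}^2\to\mathbb Z^d$, $d\in\{1,2\}$, with $L_{n+1}(i,j)=L_n(i,j)$ for $1\le i,j\le n$; one writes $L$ for $L_n$. Here $L(i,j)=L(j,i)$. The patterned matrix is $X_n=((x_{L(i,j)}))_{1\le i,j\le n}$. Its triangular version $X_n^u$ has $(i,j)$ entry $x_{L(i,j)}$ if $i+j\le n+1$ and $0$ otherwise. LSD: the weak limit, as $n\to\infty$, of the empirical distribution of the eigenvalues; it exists almost surely if for almost every realization this weak limit exists and equals a fixed nonrandom probability distribution. A word of length $h$ is a sequence of $h$ letters $w[1]\cdots w[h]$ in which first occurrences of letters appear in alphabetical order (so words of length $h$ correspond to partitions of $\{1,\dots,h\}$). A word is pair-matched if each letter in it appears exactly twice. A circuit of length $h$ is a function $\pi:\{0,1,\dots,h\}\to\{1,\dots,n\}$ with $\pi(0)=\pi(h)$. For a word $w$ of length $2k$, $\Pi_1^*(w)$ (depending on $n$ and $L$) is the set of circuits $\pi$ of length $2k$ such that $\pi(i-1)+\pi(i)\le n+1$ for all $1\le i\le 2k$ and such that $w[i]=w[j]\Rightarrow L(\pi(i-1),\pi(i))=L(\pi(j-1),\pi(j))$. *)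

theory Defs
  imports "HOL-Probability.Probability" "Jordan_Normal_Form.Char_Poly"
begin

text \<open>
  The index set \<open>\<int>\<^sup>d\<close> is the type \<open>int ^ 'd\<close> with \<open>d = CARD('d)\<close>.
  Only the values of \<open>L n i j\<close> with \<open>1 \<le> i, j \<le> n\<close> are meaningful.
\<close>

definition link_function :: "(nat \<Rightarrow> nat \<Rightarrow> nat \<Rightarrow> int ^ 'd) \<Rightarrow> bool" where
  "link_function L \<longleftrightarrow> (\<forall>n\<ge>1. \<forall>i\<in>{1..n}. \<forall>j\<in>{1..n}. L (Suc n) i j = L n i j)"

definition symmetric_link :: "(nat \<Rightarrow> nat \<Rightarrow> nat \<Rightarrow> int ^ 'd) \<Rightarrow> bool" where
  "symmetric_link L \<longleftrightarrow> (\<forall>n\<ge>1. \<forall>i\<in>{1..n}. \<forall>j\<in>{1..n}. L n i j = L n j i)"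

definition link_Delta :: "(nat \<Rightarrow> nat \<Rightarrow> nat \<Rightarrow> int ^ 'd) \<Rightarrow> enat" where
  "link_Delta L = (SUP n\<in>{1..}. SUP t. SUP k\<in>{1..n}.
     enat (card {l. 1 \<le> l \<and> l \<le> n \<and> k + l \<le> n + 1 \<and> L n k l = t}))"

text \<open>Matrices of \<^theory>\<open>Jordan_Normal_Form.Matrix\<close> are indexed from 0, link functions from 1.\<close>

definition triangular_patterned ::
    "(nat \<Rightarrow> nat \<Rightarrow> nat \<Rightarrow> int ^ 'd) \<Rightarrow> (int ^ 'd \<Rightarrow> real) \<Rightarrow> nat \<Rightarrow> real mat" where
  "triangular_patterned L a n = Matrix.mat n n (\<lambda>(i, j).
     if Suc i + Suc j \<le> n + 1 then a (L n (Suc i) (Suc j)) else 0)"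

definition uniformly_bounded_moments :: "'a measure \<Rightarrow> ('i \<Rightarrow> 'a \<Rightarrow> real) \<Rightarrow> bool" where
  "uniformly_bounded_moments M x \<longleftrightarrow>
     (\<forall>r::nat. \<exists>C. \<forall>i. integrable M (\<lambda>\<omega>. \<bar>x i \<omega>\<bar> ^ r) \<and> (\<integral>\<omega>. \<bar>x i \<omega>\<bar> ^ r \<partial>M) \<le> C)"

definition identically_distributed :: "'a measure \<Rightarrow> ('i \<Rightarrow> 'a \<Rightarrow> real) \<Rightarrow> bool" where
  "identically_distributed M x \<longleftrightarrow> (\<forall>i j. distr M borel (x i) = distr M borel (x j))"

definition standard_input :: "'a measure \<Rightarrow> ('i \<Rightarrow> 'a \<Rightarrow> real) \<Rightarrow> bool" where
  "standard_input M x \<longleftrightarrow>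
     prob_space M \<and>
     prob_space.indep_vars M (\<lambda>_. borel) x UNIV \<and>
     (\<forall>i. integrable M (x i) \<and> integrable M (\<lambda>\<omega>. (x i \<omega>)\<^sup>2) \<and>
          prob_space.expectation M (x i) = 0 \<and> prob_space.variance M (x i) = 1) \<and>
     (uniformly_bounded_moments M x \<or> identically_distributed M x)"

text \<open>
  Eigenvalues are counted with multiplicity. The definition is used for real symmetric matrices of
  positive dimension, whose characteristic polynomial has all its roots in \<open>\<real>\<close>.
\<close>

definition empirical_spectral_distribution :: "real mat \<Rightarrow> real measure" where
  "empirical_spectral_distribution A =
     distr (measure_pmf (pmf_of_multiset (proots (char_poly A)))) borel (\<lambda>x. x)"

definition has_LSD :: "(nat \<Rightarrow> real mat) \<Rightarrow> real measure \<Rightarrow> bool" where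
  "has_LSD A \<mu> \<longleftrightarrow>
     real_distribution \<mu> \<and> weak_conv_m (\<lambda>n. empirical_spectral_distribution (A n)) \<mu>"

definition symmetric_distribution :: "real measure \<Rightarrow> bool" where
  "symmetric_distribution \<mu> \<longleftrightarrow> distr \<mu> borel uminus = \<mu>"

definition has_even_moments :: "real measure \<Rightarrow> (nat \<Rightarrow> real) \<Rightarrow> bool" where
  "has_even_moments \<mu> \<beta> \<longleftrightarrow>
     (\<forall>r. integrable \<mu> (\<lambda>x. x ^ r)) \<and>
     (\<forall>r. odd r \<longrightarrow> (\<integral>x. x ^ r \<partial>\<mu>) = 0) \<and>
     (\<forall>k\<ge>1. (\<integral>x. x ^ (2 * k) \<partial>\<mu>) = \<beta> k)"

text \<open>
  The letters are the natural numbers in their usual order. The list of the distinct letters of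
  \<open>w\<close> in order of first occurrence is \<open>rev (remdups (rev w))\<close>, since \<^const>\<open>remdups\<close> keeps last
  occurrences; it has to be an initial segment of the alphabet.
\<close>

definition is_word :: "nat list \<Rightarrow> bool" where
  "is_word w \<longleftrightarrow> rev (remdups (rev w)) = [0..<card (set w)]"

definition pair_matched :: "nat list \<Rightarrow> bool" where
  "pair_matched w \<longleftrightarrow> (\<forall>a\<in>set w. count_list w a = 2)"

definition pair_matched_words :: "nat \<Rightarrow> nat list set" where
  "pair_matched_words h = {w. is_word w \<and> length w = h \<and> pair_matched w}"

lemma finite_pair_matched_words: "finite (pair_matched_words h)"
proof (rule finite_subset)
  show "pair_matched_words h \<subseteq> {w. set w \<subseteq> {..<h} \<and> length w = h}"
  proof
    fix w assume "w \<in> pair_matched_words h"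
    then have len: "length w = h" and "rev (remdups (rev w)) = [0..<card (set w)]"
      by (auto simp: pair_matched_words_def is_word_def)
    from this(2) have "set (rev (remdups (rev w))) = set [0..<card (set w)]"
      by (rule arg_cong)
    then have "set w = {..<card (set w)}"
      by (simp add: atLeast0LessThan)
    also have "\<dots> \<subseteq> {..<h}"
      using card_length[of w] len by simp
    finally show "w \<in> {w. set w \<subseteq> {..<h} \<and> length w = h}"
      using len by simp
  qed
  show "finite {w. set w \<subseteq> {..<h} \<and> length w = h}"
    by (rule finite_lists_length_eq) simp
qed

text \<open>Functions on \<open>{0, \<dots>, h}\<close> are taken extensional, so that there are finitely many circuits.\<close>

definition circuits :: "nat \<Rightarrow> nat \<Rightarrow> (nat \<Rightarrow> nat) set" where
  "circuits n h = {\<pi> \<in> {0..h} \<rightarrow>\<^sub>E {1..n}. \<pi> 0 = \<pi> h}"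

text \<open>The set \<open>\<Pi>\<^sub>1\<^sup>*(w)\<close>. The letter \<open>w[i]\<close>, \<open>1 \<le> i \<le> h\<close>, is \<open>w ! (i - 1)\<close>.\<close>

definition Pi1_star :: "(nat \<Rightarrow> nat \<Rightarrow> nat \<Rightarrow> int ^ 'd) \<Rightarrow> nat \<Rightarrow> nat list \<Rightarrow> (nat \<Rightarrow> nat) set" where
  "Pi1_star L n w = {\<pi> \<in> circuits n (length w).
     (\<forall>i\<in>{1..length w}. \<pi> (i - 1) + \<pi> i \<le> n + 1) \<and>
     (\<forall>i\<in>{1..length w}. \<forall>j\<in>{1..length w}. w ! (i - 1) = w ! (j - 1) \<longrightarrow>
        L n (\<pi> (i - 1)) (\<pi> i) = L n (\<pi> (j - 1)) (\<pi> j))}"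

text \<open>For a word of length \<open>2k\<close> the exponent below is \<open>1 + k\<close>.\<close>

definition pu_ratio :: "(nat \<Rightarrow> nat \<Rightarrow> nat \<Rightarrow> int ^ 'd) \<Rightarrow> nat list \<Rightarrow> nat \<Rightarrow> real" where
  "pu_ratio L w n = real (card (Pi1_star L n w)) / real n ^ (1 + length w div 2)"

definition pu :: "(nat \<Rightarrow> nat \<Rightarrow> nat \<Rightarrow> int ^ 'd) \<Rightarrow> nat list \<Rightarrow> real" where
  "pu L w = lim (pu_ratio L w)"

definition beta_even :: "(nat \<Rightarrow> nat \<Rightarrow> nat \<Rightarrow> int ^ 'd) \<Rightarrow> nat \<Rightarrow> real" where
  "beta_even L k = (\<Sum>w\<in>pair_matched_words (2 * k). pu L w)"

end

theory Submission
  imports Defs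
begin

text \<open>
  The proof is the method of moments. The trace of the \<open>h\<close>-th power of the matrix is a sum over closed
  walks \<open>v\<close> with \<open>h\<close> steps that respect the triangular constraint, each walk contributing the product
  of the inputs at its labels. Condition (B) says that along a walk a label already seen leaves at most
  \<open>\<Delta>\<close> choices for the next vertex, whereas a new label leaves at most \<open>n\<close>; hence only \<open>O(n\<^sup>1\<^sup>+\<^sup>j)\<close>
  walks carry \<open>j\<close> labels (\<open>card_walks_few_new_labels\<close>). In the expectation a walk with a label that
  occurs once contributes \<open>0\<close>, so after normalization only the walks whose labels all occur exactly
  twice survive. Up to lower order these are counted by the sets \<open>\<Pi>\<^sub>1\<^sup>*(w)\<close>, summed over the
  pair-matched words (\<open>sum_card_Pi1_star_bounds\<close>), which gives the limits \<open>\<beta>\<^sub>2\<^sub>k\<close>. The same count shows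
  that \<open>\<beta>\<^sub>2\<^sub>k\<close> is at most \<open>(8\<Delta>)\<^sup>k (2k)! / k!\<close>, so that the characteristic function of a law with these
  moments is an everywhere convergent power series; the law is therefore unique, and it exists as a
  weak limit by Helly's theorem (\<open>moment_convergence\<close>).

  Almost sure convergence is first proved for bounded inputs. Two closed walks with correlated
  contributions must share a label, and this costs a factor \<open>n\<close> (\<open>card_linked_pairs\<close>). So the variance
  of the normalized trace is \<open>O(1/n)\<close>, which is summable along the squares \<open>n = m\<^sup>2\<close>. Between two
  consecutive squares the matrices, padded with zeros to the same size, differ in \<open>o(n\<^sup>2)\<close> bounded
  entries, which does not affect the limit of the spectral distribution (\<open>cdf_interpolate\<close>).

  A general input \<open>x\<close> is compared with the bounded input \<open>z\<close> obtained by truncating it at a high level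
  and standardizing again. The number of eigenvalues below a threshold changes by at most \<open>|S|\<close> if
  the rows and columns with index in \<open>S\<close> are changed (\<open>eigenvalue_count_perturb_rank\<close>), and, if the threshold
  is moved by \<open>\<epsilon>\<close>, by at most \<open>\<epsilon>\<^sup>-\<^sup>2\<close> times the sum of the squared differences of the entries
  (\<open>eigenvalue_count_perturb_square\<close>). With \<open>y = (x - z)\<^sup>2\<close> and matrix size \<open>N\<close>, the entries with \<open>y > N\<close>
  are charged to the first bound and the others to the second. One needs that there are \<open>o(N)\<close> entries
  of the first kind and that \<open>y\<close> sums to at most \<open>\<delta>N\<^sup>2\<close> over the others. Both quantities are controlled
  by their values at the next power of two, and along powers of two Borel-Cantelli applies, because
  the sums over \<open>m\<close> of \<open>2\<^sup>m P(y > 2\<^sup>m)\<close> and of \<open>2\<^sup>-\<^sup>m E[y\<^sup>2; y \<le> 2\<^sup>m]\<close> are at most \<open>2 E y\<close>. Thus, for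
  identically distributed inputs, a finite second moment suffices. The limit law is the same for all inputs because it is
  determined by its moments.

  Vertices are numbered from \<open>0\<close> below, so that \<open>i + j \<le> n + 1\<close> becomes \<open>x + y < n\<close>.
\<close>

section \<open>Orthonormal eigenbases of real symmetric matrices\<close>

text \<open>
  The matrix with entries \<open>a i j\<close>, \<open>i, j < n\<close>, equals \<open>U diag(d) U\<^sup>T\<close> with \<open>U\<close> orthogonal; column \<open>k\<close> of
  \<open>U\<close> is the vector \<open>\<lambda>i. u i k\<close>. Matrices are plain functions here: padding and deleting rows then need no
  change of type or dimension, and all computations are with finite sums.
\<close>

definition eigenbasis :: "nat \<Rightarrow> (nat \<Rightarrow> nat \<Rightarrow> real) \<Rightarrow> (nat \<Rightarrow> real) \<Rightarrow> (nat \<Rightarrow> nat \<Rightarrow> real) \<Rightarrow> bool" where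
  "eigenbasis n a d u \<longleftrightarrow>
     (\<forall>i<n. \<forall>j<n. (\<Sum>k<n. u k i * u k j) = of_bool (i = j)) \<and>
     (\<forall>i<n. \<forall>j<n. (\<Sum>k<n. u i k * u j k) = of_bool (i = j)) \<and>
     (\<forall>i<n. \<forall>j<n. a i j = (\<Sum>k<n. u i k * d k * u j k))"

lemma sum_of_bool_select:
  fixes f :: "nat \<Rightarrow> real"
  assumes "i < n" shows "(\<Sum>k<n. of_bool (i = k) * f k) = f i" "(\<Sum>k<n. of_bool (k = i) * f k) = f i"
    "(\<Sum>k<n. f k * of_bool (i = k)) = f i" "(\<Sum>k<n. f k * of_bool (k = i)) = f i"
  using assms by (simp_all add: of_bool_def if_distrib[of "\<lambda>x. x * _"] if_distrib[of "\<lambda>x. _ * x"] cong: if_cong)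

text \<open>
  A complex eigenvalue exists by the fundamental theorem of algebra. It is real because the quadratic form
  of a symmetric real matrix takes real values on complex vectors, and then the real or the imaginary
  part of an eigenvector is a real eigenvector.
\<close>

lemma symmetric_real_eigenvector:
  fixes a :: "nat \<Rightarrow> nat \<Rightarrow> real"
  assumes n: "n > 0" and sym: "\<And>i j. i < n \<Longrightarrow> j < n \<Longrightarrow> a i j = a j i"
  shows "\<exists>e v. (\<exists>i<n. v i \<noteq> 0) \<and> (\<forall>i<n. (\<Sum>j<n. a i j * v j) = e * v i)"
proof -
  define A where "A = Matrix.mat n n (\<lambda>(i, j). complex_of_real (a i j))"
  have A: "A \<in> carrier_mat n n" by (simp add: A_def)
  have "degree (char_poly A) = n" using degree_monic_char_poly[OF A] by simp
  then have "\<not> constant (poly (char_poly A))" using n by (simp add: constant_degree)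
  then obtain z where "poly (char_poly A) z = 0" using fundamental_theorem_of_algebra by blast
  then have "eigenvalue A z" using eigenvalue_root_char_poly[OF A] by simp
  then obtain w where w: "w \<in> carrier_vec n" "w \<noteq> 0\<^sub>v n" "A *\<^sub>v w = z \<cdot>\<^sub>v w"
    unfolding eigenvalue_def eigenvector_def using A by auto
  define f where "f i = vec_index w i" for i
  have ev: "(\<Sum>j<n. of_real (a i j) * f j) = z * f i" if "i < n" for i
  proof -
    have "vec_index (A *\<^sub>v w) i = (\<Sum>j<n. of_real (a i j) * f j)"
      using that w(1) by (simp add: A_def scalar_prod_def atLeast0LessThan f_def)
    then show ?thesis using w that by (simp add: f_def)
  qed
  obtain i0 where i0: "i0 < n" "f i0 \<noteq> 0"
    unfolding f_def using w(1,2) by (metis carrier_vecD dim_vec index_zero_vec(1) zero_vec_def eq_vecI)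
  define S where "S = (\<Sum>i<n. cnj (f i) * (\<Sum>j<n. of_real (a i j) * f j))"
  define N where "N = (\<Sum>i<n. (cmod (f i))\<^sup>2)"
  have S1: "S = z * of_real N"
    unfolding S_def N_def of_real_sum sum_distrib_left[of z]
    by (intro sum.cong refl) (simp add: ev complex_norm_square del: of_real_power)
  have "cnj S = S"
  proof -
    have "cnj S = (\<Sum>i<n. \<Sum>j<n. f i * (of_real (a i j) * cnj (f j)))"
      by (simp add: S_def sum_distrib_left)
    also have "\<dots> = (\<Sum>j<n. \<Sum>i<n. f i * (of_real (a i j) * cnj (f j)))" by (rule sum.swap)
    also have "\<dots> = S"
      unfolding S_def sum_distrib_left by (intro sum.cong refl) (use sym in auto)
    finally show ?thesis .
  qed
  moreover have "N > 0"
    unfolding N_def using i0 by (intro sum_pos2[of _ i0]) auto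
  ultimately have "cnj z = z" using S1 by auto
  then have zr: "z = of_real (Re z)" by (simp add: complex_eq_iff)
  have re: "(\<Sum>j<n. a i j * Re (f j)) = Re z * Re (f i)" if "i < n" for i
    using arg_cong[OF ev[OF that], of Re] by (subst (asm) zr) simp
  have im: "(\<Sum>j<n. a i j * Im (f j)) = Re z * Im (f i)" if "i < n" for i
    using arg_cong[OF ev[OF that], of Im] by (subst (asm) zr) simp
  show ?thesis
  proof (cases "Re (f i0) = 0")
    case False
    then show ?thesis using re i0 by (intro exI[of _ "Re z"] exI[of _ "\<lambda>i. Re (f i)"]) auto
  next
    case True
    then have "Im (f i0) \<noteq> 0" using i0 by (simp add: complex_eq_iff)
    then show ?thesis using im i0 by (intro exI[of _ "Re z"] exI[of _ "\<lambda>i. Im (f i)"]) auto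
  qed
qed

text \<open>
  Every unit vector is the first column of a symmetric orthogonal matrix, namely of the reflection that
  exchanges it with the first basis vector.
\<close>

lemma householder_reflection:
  fixes v :: "nat \<Rightarrow> real"
  assumes n: "n > 0" and v: "(\<Sum>i<n. (v i)\<^sup>2) = 1"
  shows "\<exists>w. (\<forall>i j. w i j = w j i) \<and> (\<forall>i<n. w i 0 = v i) \<and>
     (\<forall>i<n. \<forall>j<n. (\<Sum>k<n. w i k * w k j) = of_bool (i = j))"
proof -
  \<comment> \<open>if \<open>v\<close> is the first basis vector then \<open>s = 0\<close>, and \<open>c = 2 / 0 = 0\<close> gives the identity matrix\<close>
  define u where "u i = v i - of_bool (i = 0)" for i
  define s where "s = (\<Sum>i<n. (u i)\<^sup>2)"
  define c where "c = 2 / s"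
  define w where "w i j = of_bool (i = j) - c * u i * u j" for i j
  have s: "s = - 2 * u 0"
  proof -
    have "s = (\<Sum>i<n. (v i)\<^sup>2 - 2 * (v i * of_bool (i = 0)) + 1 * of_bool (i = 0))"
      unfolding s_def u_def by (intro sum.cong refl) (auto simp: power2_eq_square algebra_simps)
    also have "\<dots> = 1 - 2 * v 0 + 1"
      unfolding sum.distrib sum_subtractf v sum_distrib_left[symmetric]
      using n by (simp add: sum_of_bool_select)
    finally show ?thesis by (simp add: u_def)
  qed
  have z: "u i = 0" if "s = 0" "i < n" for i
    using that unfolding s_def by (subst (asm) sum_nonneg_eq_0_iff) auto
  have w0: "w i 0 = v i" if "i < n" for i
  proof (cases "s = 0")
    case True
    then show ?thesis using z[OF True that] by (simp add: w_def u_def)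
  next
    case False
    then have "c * u 0 = -1" unfolding c_def using s by (simp add: field_simps)
    have "w i 0 = of_bool (i = 0) - (c * u 0) * u i" by (simp add: w_def mult_ac)
    then show ?thesis using \<open>c * u 0 = -1\<close> by (simp add: u_def)
  qed
  have ww: "(\<Sum>k<n. w i k * w k j) = of_bool (i = j)" if "i < n" "j < n" for i j
  proof -
    have "(\<Sum>k<n. w i k * w k j) = (\<Sum>k<n. of_bool (i = k) * of_bool (k = j)
        - c * u i * (u k * of_bool (k = j)) - c * u j * (u k * of_bool (i = k))
        + c * c * u i * u j * (u k)\<^sup>2)"
      unfolding w_def by (intro sum.cong refl) (simp add: algebra_simps power2_eq_square)
    also have "\<dots> = of_bool (i = j) - c * u i * u j - c * u j * u i + c * c * u i * u j * s"
      unfolding sum.distrib sum_subtractf sum_distrib_left[symmetric]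
      using that by (simp add: sum_of_bool_select s_def)
    also have "\<dots> = of_bool (i = j) + c * u i * u j * (c * s - 2)" by (simp add: algebra_simps)
    also have "\<dots> = of_bool (i = j)"
      using z that by (cases "s = 0") (auto simp: c_def)
    finally show ?thesis .
  qed
  have "\<forall>i j. w i j = w j i" by (auto simp: w_def mult_ac)
  with w0 ww show ?thesis by blast
qed

lemma sum_rotate:
  fixes f :: "nat \<Rightarrow> nat \<Rightarrow> nat \<Rightarrow> real"
  shows "(\<Sum>l<n. \<Sum>p<n. \<Sum>q<n. f l p q) = (\<Sum>p<n. \<Sum>q<n. \<Sum>l<n. f l p q)"
proof -
  have "(\<Sum>l<n. \<Sum>p<n. \<Sum>q<n. f l p q) = (\<Sum>p<n. \<Sum>l<n. \<Sum>q<n. f l p q)" by (rule sum.swap)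
  also have "\<dots> = (\<Sum>p<n. \<Sum>q<n. \<Sum>l<n. f l p q)" by (intro sum.cong refl sum.swap)
  finally show ?thesis .
qed

text \<open>
  In matrix form: \<open>V (V\<^sup>T A W) W\<^sup>T = A\<close> for orthogonal \<open>V\<close> and \<open>W\<close>.
\<close>

lemma sum_orthogonal_sandwich:
  fixes a v w :: "nat \<Rightarrow> nat \<Rightarrow> real"
  assumes v: "\<And>i j. i < n \<Longrightarrow> j < n \<Longrightarrow> (\<Sum>k<n. v i k * v j k) = of_bool (i = j)"
    and w: "\<And>i j. i < n \<Longrightarrow> j < n \<Longrightarrow> (\<Sum>k<n. w i k * w j k) = of_bool (i = j)"
    and ij: "i < n" "j < n"
  shows "(\<Sum>k<n. \<Sum>l<n. v i k * (\<Sum>p<n. \<Sum>q<n. v p k * a p q * w q l) * w j l) = a i j"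
proof -
  have "(\<Sum>k<n. \<Sum>l<n. v i k * (\<Sum>p<n. \<Sum>q<n. v p k * a p q * w q l) * w j l)
      = (\<Sum>k<n. \<Sum>l<n. \<Sum>p<n. \<Sum>q<n. (v i k * v p k) * (a p q * (w j l * w q l)))"
    by (simp add: sum_distrib_left sum_distrib_right mult_ac)
  also have "\<dots> = (\<Sum>k<n. \<Sum>p<n. \<Sum>q<n. \<Sum>l<n. (v i k * v p k) * (a p q * (w j l * w q l)))"
    by (intro sum.cong refl sum_rotate)
  also have "\<dots> = (\<Sum>k<n. \<Sum>p<n. \<Sum>q<n. (v i k * v p k) * (a p q * of_bool (j = q)))"
    unfolding sum_distrib_left[symmetric] using ij by (intro sum.cong refl) (simp add: w)
  also have "\<dots> = (\<Sum>k<n. \<Sum>p<n. (v i k * v p k) * a p j)"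
    using ij by (simp add: sum_of_bool_select sum_distrib_left[symmetric])
  also have "\<dots> = (\<Sum>p<n. \<Sum>k<n. (v i k * v p k) * a p j)" by (rule sum.swap)
  also have "\<dots> = (\<Sum>p<n. of_bool (i = p) * a p j)"
    unfolding sum_distrib_right[symmetric] using ij by (intro sum.cong refl) (simp add: v)
  also have "\<dots> = a i j" using ij by (simp only: sum_of_bool_select)
  finally show ?thesis .
qed

lemma orthogonal_compose:
  fixes w t :: "nat \<Rightarrow> nat \<Rightarrow> real"
  assumes w: "\<And>i j. i < n \<Longrightarrow> j < n \<Longrightarrow> (\<Sum>k<n. w k i * w k j) = of_bool (i = j)"
    and t: "\<And>i j. i < n \<Longrightarrow> j < n \<Longrightarrow> (\<Sum>k<n. t k i * t k j) = of_bool (i = j)"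
    and ij: "i < n" "j < n"
  shows "(\<Sum>k<n. (\<Sum>l<n. w k l * t l i) * (\<Sum>l<n. w k l * t l j)) = of_bool (i = j)"
proof -
  have "(\<Sum>k<n. (\<Sum>l<n. w k l * t l i) * (\<Sum>l<n. w k l * t l j))
      = (\<Sum>k<n. \<Sum>p<n. \<Sum>q<n. (w k p * w k q) * (t p i * t q j))"
    unfolding sum_product by (simp add: mult_ac)
  also have "\<dots> = (\<Sum>p<n. \<Sum>q<n. \<Sum>k<n. (w k p * w k q) * (t p i * t q j))"
    by (rule sum_rotate)
  also have "\<dots> = (\<Sum>p<n. \<Sum>q<n. of_bool (p = q) * (t p i * t q j))"
    unfolding sum_distrib_right[symmetric] by (intro sum.cong refl) (simp add: w)
  also have "\<dots> = (\<Sum>p<n. t p i * t p j)"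
    by (intro sum.cong refl) (simp add: sum_of_bool_select)
  finally show ?thesis using t ij by simp
qed

text \<open>
  An eigenbasis of \<open>W\<^sup>T A W\<close> is carried by \<open>W\<close> to one of \<open>A\<close>.
\<close>

lemma eigenbasis_rotate:
  assumes w1: "\<And>i j. i < n \<Longrightarrow> j < n \<Longrightarrow> (\<Sum>k<n. w k i * w k j) = of_bool (i = j)"
    and w2: "\<And>i j. i < n \<Longrightarrow> j < n \<Longrightarrow> (\<Sum>k<n. w i k * w j k) = of_bool (i = j)"
    and b: "eigenbasis n (\<lambda>k l. \<Sum>p<n. \<Sum>q<n. w p k * a p q * w q l) d t"
  shows "eigenbasis n a d (\<lambda>i k. \<Sum>l<n. w i l * t l k)"
  unfolding eigenbasis_def
proof (intro conjI allI impI)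
  fix i j assume ij: "i < n" "j < n"
  show "(\<Sum>k<n. (\<Sum>l<n. w k l * t l i) * (\<Sum>l<n. w k l * t l j)) = of_bool (i = j)"
    using b ij unfolding eigenbasis_def by (intro orthogonal_compose w1) auto
  show "(\<Sum>k<n. (\<Sum>l<n. w i l * t l k) * (\<Sum>l<n. w j l * t l k)) = of_bool (i = j)"
    using orthogonal_compose[of n "\<lambda>l k. t k l" "\<lambda>l k. w k l" i j] w2 b ij
    unfolding eigenbasis_def by (simp add: mult.commute)
  have "(\<Sum>p<n. \<Sum>q<n. w i p * (\<Sum>r<n. \<Sum>s<n. w r p * a r s * w s q) * w j q)
      = (\<Sum>p<n. \<Sum>q<n. w i p * (\<Sum>k<n. t p k * d k * t q k) * w j q)"
    by (intro sum.cong refl) (use b in \<open>simp add: eigenbasis_def\<close>)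
  then have "a i j = (\<Sum>p<n. \<Sum>q<n. w i p * (\<Sum>k<n. t p k * d k * t q k) * w j q)"
    using sum_orthogonal_sandwich[OF w2 w2 ij, of a] by simp
  also have "\<dots> = (\<Sum>p<n. \<Sum>q<n. \<Sum>k<n. (w i p * t p k) * d k * (w j q * t q k))"
    by (simp add: sum_distrib_left sum_distrib_right mult_ac)
  also have "\<dots> = (\<Sum>p<n. \<Sum>k<n. \<Sum>q<n. (w i p * t p k) * d k * (w j q * t q k))"
    by (rule sum.cong[OF refl]) (rule sum.swap)
  also have "\<dots> = (\<Sum>k<n. \<Sum>p<n. \<Sum>q<n. (w i p * t p k) * d k * (w j q * t q k))"
    by (rule sum.swap)
  also have "\<dots> = (\<Sum>k<n. (\<Sum>l<n. w i l * t l k) * d k * (\<Sum>l<n. w j l * t l k))"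
  proof (rule sum.cong[OF refl])
    fix k
    show "(\<Sum>p<n. \<Sum>q<n. (w i p * t p k) * d k * (w j q * t q k)) = (\<Sum>l<n. w i l * t l k) * d k * (\<Sum>l<n. w j l * t l k)"
      by (subst sum_distrib_right) (rule sum_product[symmetric])
  qed
  finally show "a i j = (\<Sum>k<n. (\<Sum>l<n. w i l * t l k) * d k * (\<Sum>l<n. w j l * t l k))" .
qed

lemma eigenbasis_border:
  assumes b0: "\<And>i. i < Suc m \<Longrightarrow> b i 0 = e * of_bool (i = 0)" "\<And>i. i < Suc m \<Longrightarrow> b 0 i = e * of_bool (i = 0)"
    and ih: "eigenbasis m (\<lambda>i j. b (Suc i) (Suc j)) d u"
  shows "eigenbasis (Suc m) b (case_nat e d) (case_nat (\<lambda>k. of_bool (k = 0)) (\<lambda>i. case_nat 0 (u i)))"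
    (is "eigenbasis _ _ _ ?u")
proof -
  have "(\<Sum>k<Suc m. ?u k i * ?u k j) = of_bool (i = j) \<and> (\<Sum>k<Suc m. ?u i k * ?u j k) = of_bool (i = j) \<and>
      b i j = (\<Sum>k<Suc m. ?u i k * case_nat e d k * ?u j k)" if "i < Suc m" "j < Suc m" for i j
    using that ih b0(1)[of i] b0(2)[of j] unfolding eigenbasis_def sum.lessThan_Suc_shift
    by (cases i; cases j) auto
  then show ?thesis unfolding eigenbasis_def by blast
qed

text \<open>
  The spectral theorem, by deflation: a reflection moves an eigenvector to the first basis vector, which
  splits off the first row and column, and the remaining block is diagonalized by induction.
\<close>

lemma eigenbasis_exists:
  fixes a :: "nat \<Rightarrow> nat \<Rightarrow> real"
  assumes sym: "\<And>i j. i < n \<Longrightarrow> j < n \<Longrightarrow> a i j = a j i"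
  shows "\<exists>d u. eigenbasis n a d u"
  using sym
proof (induction n arbitrary: a)
  case 0
  then show ?case by (simp add: eigenbasis_def)
next
  case (Suc m a)
  define n where "n = Suc m"
  have npos: "0 < n" by (simp add: n_def)
  have sym: "a i j = a j i" if "i < n" "j < n" for i j using Suc.prems that n_def by auto
  obtain e v0 where v0: "\<exists>i<n. v0 i \<noteq> 0" and ev0: "\<forall>i<n. (\<Sum>j<n. a i j * v0 j) = e * v0 i"
    using symmetric_real_eigenvector[of n a] sym npos by blast
  define r where "r = sqrt (\<Sum>i<n. (v0 i)\<^sup>2)"
  have rpos: "(\<Sum>i<n. (v0 i)\<^sup>2) > 0"
  proof -
    obtain i where "i < n" "v0 i \<noteq> 0" using v0 by blast
    then show ?thesis by (intro sum_pos2[of _ i]) auto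
  qed
  define v where "v i = v0 i / r" for i
  have r2: "r\<^sup>2 = (\<Sum>i<n. (v0 i)\<^sup>2)" unfolding r_def using rpos by simp
  have "(\<Sum>i<n. (v i)\<^sup>2) = 1"
    unfolding v_def power_divide sum_divide_distrib[symmetric] r2 using rpos by simp
  then obtain w where ws: "\<And>i j. w i j = w j i" and w0: "\<And>i. i < n \<Longrightarrow> w i 0 = v i"
    and ww: "\<And>i j. i < n \<Longrightarrow> j < n \<Longrightarrow> (\<Sum>k<n. w i k * w k j) = of_bool (i = j)"
    using householder_reflection[of n v] npos by blast
  have w1: "(\<Sum>k<n. w k i * w k j) = of_bool (i = j)" if "i < n" "j < n" for i j
  proof -
    have "(\<Sum>k<n. w k i * w k j) = (\<Sum>k<n. w i k * w k j)"
      by (intro sum.cong refl arg_cong2[where f = "(*)"] ws)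
    then show ?thesis using ww[OF that] by simp
  qed
  have w2: "(\<Sum>k<n. w i k * w j k) = of_bool (i = j)" if "i < n" "j < n" for i j
  proof -
    have "(\<Sum>k<n. w i k * w j k) = (\<Sum>k<n. w i k * w k j)"
      by (intro sum.cong refl arg_cong2[where f = "(*)"] ws)
    then show ?thesis using ww[OF that] by simp
  qed
  have ev: "(\<Sum>j<n. a i j * w j 0) = e * w i 0" if "i < n" for i
  proof -
    have "(\<Sum>j<n. a i j * w j 0) = (\<Sum>j<n. a i j * v0 j) / r"
      unfolding sum_divide_distrib by (intro sum.cong refl) (simp add: w0 v_def)
    then show ?thesis using ev0 that by (simp add: w0 v_def)
  qed
  define b where "b i j = (\<Sum>k<n. \<Sum>l<n. w k i * a k l * w l j)" for i j
  have bs: "b i j = b j i" for i j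
  proof -
    have "b i j = (\<Sum>l<n. \<Sum>k<n. w k i * a k l * w l j)" unfolding b_def by (rule sum.swap)
    also have "\<dots> = b j i" unfolding b_def
      by (intro sum.cong refl) (use sym in \<open>auto simp: mult_ac\<close>)
    finally show ?thesis .
  qed
  have b0: "b i 0 = e * of_bool (i = 0)" if "i < n" for i
  proof -
    have "b i 0 = (\<Sum>k<n. w k i * (\<Sum>l<n. a k l * w l 0))"
      unfolding b_def by (simp add: sum_distrib_left mult_ac)
    also have "\<dots> = (\<Sum>k<n. e * (w k i * w k 0))"
      by (intro sum.cong refl) (simp add: ev)
    also have "\<dots> = e * of_bool (i = 0)"
      unfolding sum_distrib_left[symmetric] using that npos by (simp only: w1[of i 0])
    finally show ?thesis .
  qed
  have "\<exists>d u. eigenbasis m (\<lambda>i j. b (Suc i) (Suc j)) d u"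
    using bs by (intro Suc.IH)
  then obtain d u where "eigenbasis m (\<lambda>i j. b (Suc i) (Suc j)) d u" by blast
  from eigenbasis_border[of m b, OF b0[unfolded n_def] b0[unfolded n_def, folded bs[of 0]] this] 
  have "\<exists>d u. eigenbasis n b d u" unfolding n_def by blast
  then show ?case unfolding b_def using eigenbasis_rotate[of n w a] w1 w2 n_def by blast
qed

section \<open>Power sums of eigenvalues and empirical spectral distributions\<close>

lemma eigenbasisD:
  assumes "eigenbasis n a d u" "i < n" "j < n"
  shows "(\<Sum>k<n. u k i * u k j) = of_bool (i = j)" "(\<Sum>k<n. u i k * u j k) = of_bool (i = j)"
    "a i j = (\<Sum>k<n. u i k * d k * u j k)"
  using assms unfolding eigenbasis_def by blast+

text \<open>
  With the entries of a matrix as \<open>f\<close>, the values of \<open>f\<close> along the steps of a walk are the factors of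
  its weight; with a link function they are its labels.
\<close>

fun steps :: "('v \<Rightarrow> 'v \<Rightarrow> 'b) \<Rightarrow> 'v list \<Rightarrow> 'b list" where
  "steps f (x # y # v) = f x y # steps f (y # v)"
| "steps f _ = []"

definition walks :: "nat \<Rightarrow> nat \<Rightarrow> nat list set" where
  "walks n h = {v. length v = Suc h \<and> set v \<subseteq> {..<n}}"

lemma steps_Cons: "v \<noteq> [] \<Longrightarrow> steps f (x # v) = f x (hd v) # steps f v"
  by (cases v) auto

lemma finite_walks: "finite (walks n h)"
  unfolding walks_def using finite_lists_length_eq[of "{..<n}" "Suc h"] by (simp add: conj_commute)

text \<open>
  Both sides are the entry \<open>(i, j)\<close> of the \<open>h\<close>-th power of the matrix.
\<close>

lemma walk_sum_eigenbasis:
  assumes e: "eigenbasis n a d u" and ij: "i < n" "j < n"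
  shows "(\<Sum>v | v \<in> walks n h \<and> hd v = i \<and> last v = j. prod_list (steps a v)) = (\<Sum>k<n. u i k * d k ^ h * u j k)"
  using ij(1)
proof (induction h arbitrary: i)
  case 0
  have "{v. v \<in> walks n 0 \<and> hd v = i \<and> last v = j} = (if i = j then {[i]} else {})"
    using 0 by (auto simp: walks_def length_Suc_conv)
  then show ?case using eigenbasisD(2)[OF e 0 ij(2)] by simp
next
  case (Suc h)
  let ?S = "\<lambda>i'. {v. v \<in> walks n h \<and> hd v = i' \<and> last v = j}"
  have fin: "finite (?S i')" for i' using finite_walks[of n h] by simp
  have "(\<Sum>v | v \<in> walks n (Suc h) \<and> hd v = i \<and> last v = j. prod_list (steps a v))
      = (\<Sum>(i', v)\<in>(SIGMA i':{..<n}. ?S i'). a i i' * prod_list (steps a v))"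
    by (rule sum.reindex_bij_witness[of _ "\<lambda>(i', v). i # v" "\<lambda>v. (hd (tl v), tl v)"])
      (use Suc.prems in \<open>auto simp: walks_def length_Suc_conv\<close>)
  also have "\<dots> = (\<Sum>i'<n. a i i' * (\<Sum>v\<in>?S i'. prod_list (steps a v)))"
    by (subst sum.Sigma[symmetric]) (simp_all add: fin sum_distrib_left)
  also have "\<dots> = (\<Sum>i'<n. a i i' * (\<Sum>k<n. u i' k * d k ^ h * u j k))"
    by (intro sum.cong refl) (simp add: Suc.IH)
  also have "\<dots> = (\<Sum>i'<n. (\<Sum>m<n. u i m * d m * u i' m) * (\<Sum>k<n. u i' k * d k ^ h * u j k))"
    using Suc.prems by (intro sum.cong refl) (simp add: eigenbasisD(3)[OF e, of i])
  also have "\<dots> = (\<Sum>i'<n. \<Sum>m<n. \<Sum>k<n. (u i' m * u i' k) * (u i m * d m * (d k ^ h * u j k)))"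
    by (simp add: sum_product mult_ac)
  also have "\<dots> = (\<Sum>m<n. \<Sum>k<n. \<Sum>i'<n. (u i' m * u i' k) * (u i m * d m * (d k ^ h * u j k)))"
    by (rule sum_rotate)
  also have "\<dots> = (\<Sum>m<n. \<Sum>k<n. of_bool (m = k) * (u i m * d m * (d k ^ h * u j k)))"
    unfolding sum_distrib_right[symmetric]
    by (intro sum.cong refl) (simp add: eigenbasisD(1)[OF e])
  also have "\<dots> = (\<Sum>m<n. u i m * d m * (d m ^ h * u j m))"
    by (intro sum.cong refl) (simp add: sum_of_bool_select)
  finally show ?case by (simp add: mult_ac)
qed

lemma sum_eigenvalue_powers:
  assumes e: "eigenbasis n a d u"
  shows "(\<Sum>k<n. d k ^ h) = (\<Sum>v | v \<in> walks n h \<and> hd v = last v. prod_list (steps a v))"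
proof -
  have "(\<Sum>v | v \<in> walks n h \<and> hd v = last v. prod_list (steps a v))
      = (\<Sum>i<n. \<Sum>v | v \<in> walks n h \<and> hd v = i \<and> last v = i. prod_list (steps a v))"
  proof -
    have "(\<Sum>i<n. \<Sum>v | v \<in> walks n h \<and> hd v = i \<and> last v = i. prod_list (steps a v))
      = (\<Sum>v\<in>(\<Union>i\<in>{..<n}. {v. v \<in> walks n h \<and> hd v = i \<and> last v = i}). prod_list (steps a v))"
      by (subst sum.UNION_disjoint) (use finite_walks in auto)
    also have "(\<Union>i\<in>{..<n}. {v. v \<in> walks n h \<and> hd v = i \<and> last v = i}) = {v. v \<in> walks n h \<and> hd v = last v}"
      by (auto simp: walks_def length_Suc_conv)
    finally show ?thesis by simp
  qed
  also have "\<dots> = (\<Sum>i<n. \<Sum>k<n. u i k * d k ^ h * u i k)"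
    by (intro sum.cong refl) (simp add: walk_sum_eigenbasis[OF e])
  also have "\<dots> = (\<Sum>k<n. \<Sum>i<n. (u i k * u i k) * d k ^ h)"
    by (subst sum.swap) (simp add: mult_ac)
  also have "\<dots> = (\<Sum>k<n. d k ^ h)"
    unfolding sum_distrib_right[symmetric] by (intro sum.cong refl) (simp add: eigenbasisD(1)[OF e])
  finally show ?thesis by simp
qed

lemma char_poly_eigenbasis:
  assumes e: "eigenbasis n a d u"
  shows "char_poly (Matrix.mat n n (\<lambda>(i, j). a i j)) = (\<Prod>k<n. [:- d k, 1:])"
proof -
  let ?A = "Matrix.mat n n (\<lambda>(i, j). a i j)" and ?D = "Matrix.mat n n (\<lambda>(i, j). if i = j then d i else 0)"
  let ?U = "Matrix.mat n n (\<lambda>(i, j). u i j)" and ?V = "Matrix.mat n n (\<lambda>(i, j). u j i)"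
  have UV: "?U * ?V = 1\<^sub>m n"
    by (rule eq_matI) (simp_all add: scalar_prod_def atLeast0LessThan eigenbasisD(2)[OF e])
  have VU: "?V * ?U = 1\<^sub>m n"
    by (rule eq_matI) (simp_all add: scalar_prod_def atLeast0LessThan eigenbasisD(1)[OF e])
  have UD: "?U * ?D = Matrix.mat n n (\<lambda>(i, j). u i j * d j)"
    by (rule eq_matI) (simp_all add: scalar_prod_def atLeast0LessThan if_distrib cong: if_cong)
  have UDV: "?A = ?U * ?D * ?V"
    unfolding UD
    by (rule eq_matI) (simp_all add: scalar_prod_def atLeast0LessThan eigenbasisD(3)[OF e])
  have "similar_mat_wit ?A ?D ?U ?V"
    by (rule similar_mat_witI[OF UV VU UDV]) auto
  then have "similar_mat ?A ?D" unfolding similar_mat_def by blast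
  then have "char_poly ?A = char_poly ?D" by (rule char_poly_similar)
  also have "\<dots> = (\<Prod>x\<leftarrow>diag_mat ?D. [:- x, 1:])"
    by (rule char_poly_upper_triangular[of _ n]) (auto simp: upper_triangular_def)
  also have "diag_mat ?D = map d [0..<n]"
    by (auto simp: diag_mat_def intro!: nth_equalityI)
  also have "(\<Prod>x\<leftarrow>map d [0..<n]. [:- x, 1:]) = (\<Prod>k<n. [:- d k, 1:])"
    by (simp add: prod.list_conv_set_nth atLeast0LessThan)
  finally show ?thesis .
qed

lemma proots_eigenbasis:
  assumes e: "eigenbasis n a d u"
  shows "proots (char_poly (Matrix.mat n n (\<lambda>(i, j). a i j))) = image_mset d (mset_set {..<n})"
proof -
  have "proots (\<Prod>k\<in>K. [:- d k, 1:]) = image_mset d (mset_set K)" if "finite K" for K :: "nat set"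
    using that
  proof induction
    case (insert k K)
    have "(\<Prod>k\<in>K. [:- d k, 1:]) \<noteq> 0" using insert by simp
    then show ?case using insert by (simp add: proots_mult proots_linear_factor del: mult_pCons_left)
  qed simp
  then show ?thesis using char_poly_eigenbasis[OF e] by simp
qed

text \<open>
  The eigenvalues with multiplicity are the values of \<open>d\<close>, so the empirical spectral distribution is the
  image under \<open>d\<close> of the uniform distribution on \<open>{..<n}\<close>.
\<close>

lemma esd_eigenbasis:
  assumes e: "eigenbasis n a d u" and n: "n > 0"
  shows "empirical_spectral_distribution (Matrix.mat n n (\<lambda>(i, j). a i j))
    = distr (measure_pmf (map_pmf d (pmf_of_set {..<n}))) borel (\<lambda>x. x)"
  unfolding empirical_spectral_distribution_def proots_eigenbasis[OF e]
  using n by (subst map_pmf_of_set) auto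

lemma esd_integral:
  assumes e: "eigenbasis n a d u" and n: "n > 0" and f: "f \<in> borel_measurable borel"
  shows "integral\<^sup>L (empirical_spectral_distribution (Matrix.mat n n (\<lambda>(i, j). a i j))) f = (\<Sum>k<n. f (d k)) / real n"
    "integrable (empirical_spectral_distribution (Matrix.mat n n (\<lambda>(i, j). a i j))) f"
proof -
  have ne: "{..<n} \<noteq> {}" using n by blast
  have fin: "finite (set_pmf (pmf_of_set {..<n}))"
    unfolding set_pmf_of_set[OF ne finite_lessThan] by simp
  show "integral\<^sup>L (empirical_spectral_distribution (Matrix.mat n n (\<lambda>(i, j). a i j))) f = (\<Sum>k<n. f (d k)) / real n"
    unfolding esd_eigenbasis[OF e n] using ne f
    by (subst integral_distr) (auto simp: integral_pmf_of_set)
  show "integrable (empirical_spectral_distribution (Matrix.mat n n (\<lambda>(i, j). a i j))) f"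
    unfolding esd_eigenbasis[OF e n] using ne f
    by (subst integrable_distr_eq) (auto intro!: integrable_measure_pmf_finite fin)
qed

lemma esd_cdf:
  assumes e: "eigenbasis n a d u" and n: "n > 0"
  shows "cdf (empirical_spectral_distribution (Matrix.mat n n (\<lambda>(i, j). a i j))) x = real (card {k. k < n \<and> d k \<le> x}) / real n"
proof -
  have ne: "{..<n} \<noteq> {}" using n by blast
  have *: "{k. k < n \<and> d k \<le> x} = {..<n} \<inter> d -` {..x}" by auto
  have "measure (measure_pmf (map_pmf d (pmf_of_set {..<n}))) {..x} = real (card ({..<n} \<inter> d -` {..x})) / real (card {..<n})"
    by (subst measure_map_pmf, rule measure_pmf_of_set[OF ne finite_lessThan])
  then show ?thesis
    unfolding esd_eigenbasis[OF e n] cdf_def2 * by (simp add: measure_distr)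
qed

lemma esd_real_distribution: "real_distribution (empirical_spectral_distribution A)"
  unfolding empirical_spectral_distribution_def
  by (rule prob_space.real_distribution_distr[OF measure_pmf.prob_space_axioms]) simp

section \<open>Perturbation of eigenvalue counts\<close>

lemma parseval:
  fixes u :: "nat \<Rightarrow> nat \<Rightarrow> real"
  assumes "\<And>i j. i < n \<Longrightarrow> j < n \<Longrightarrow> (\<Sum>k<n. u i k * u j k) = of_bool (i = j)"
  shows "(\<Sum>k<n. (\<Sum>i<n. u i k * f i)\<^sup>2) = (\<Sum>i<n. (f i)\<^sup>2)"
proof -
  have "(\<Sum>k<n. (\<Sum>i<n. u i k * f i)\<^sup>2) = (\<Sum>k<n. \<Sum>i<n. \<Sum>j<n. (u i k * u j k) * (f i * f j))"
    by (simp add: power2_eq_square sum_product mult_ac)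
  also have "\<dots> = (\<Sum>i<n. \<Sum>j<n. \<Sum>k<n. (u i k * u j k) * (f i * f j))" by (rule sum_rotate)
  also have "\<dots> = (\<Sum>i<n. \<Sum>j<n. of_bool (i = j) * (f i * f j))"
    unfolding sum_distrib_right[symmetric] by (intro sum.cong refl) (simp add: assms)
  also have "\<dots> = (\<Sum>i<n. (f i)\<^sup>2)"
    by (intro sum.cong refl) (simp add: sum_of_bool_select power2_eq_square)
  finally show ?thesis .
qed

lemma eigenbasis_apply:
  assumes e: "eigenbasis n a d u" and i: "i < n" "k < n"
  shows "(\<Sum>j<n. a i j * u j k) = d k * u i k" "(\<Sum>j<n. u j k * a j i) = d k * u i k"
proof -
  have "(\<Sum>j<n. a i j * u j k) = (\<Sum>j<n. \<Sum>m<n. (u j m * u j k) * (u i m * d m))"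
    using i by (intro sum.cong refl) (simp add: eigenbasisD(3)[OF e] sum_distrib_left sum_distrib_right mult_ac)
  also have "\<dots> = (\<Sum>m<n. \<Sum>j<n. (u j m * u j k) * (u i m * d m))" by (rule sum.swap)
  also have "\<dots> = (\<Sum>m<n. of_bool (m = k) * (u i m * d m))"
    unfolding sum_distrib_right[symmetric] using i by (intro sum.cong refl) (simp add: eigenbasisD(1)[OF e])
  also have "\<dots> = d k * u i k" using i by (simp add: sum_of_bool_select)
  finally show 1: "(\<Sum>j<n. a i j * u j k) = d k * u i k" .
  have "a j i = a i j" if "j < n" for j
    using i that by (simp add: eigenbasisD(3)[OF e] mult_ac)
  then show "(\<Sum>j<n. u j k * a j i) = d k * u i k"
    unfolding 1[symmetric] by (intro sum.cong refl) simp
qed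

text \<open>
  Let \<open>P\<close> project onto the eigenvectors of \<open>a\<close> with eigenvalue at most \<open>x\<close> and \<open>Q\<close> onto those of \<open>b\<close> with
  eigenvalue above \<open>x + \<epsilon>\<close>. In the two eigenbases the entries of \<open>P (b - a) Q\<close> are \<open>(e l - d k) W k l\<close>,
  so its squared Hilbert-Schmidt norm is at least \<open>\<epsilon>\<^sup>2 tr(PQ)\<close>, and \<open>tr(PQ) \<ge> tr P + tr Q - n\<close>.
\<close>

lemma eigenvalue_count_perturb_square:
  assumes a: "eigenbasis n a d u" and b: "eigenbasis n b e v" and eps: "\<epsilon> > 0"
  shows "real (card {k. k < n \<and> d k \<le> x}) \<le>
    real (card {k. k < n \<and> e k \<le> x + \<epsilon>}) + (\<Sum>i<n. \<Sum>j<n. (b i j - a i j)\<^sup>2) / \<epsilon>\<^sup>2"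
proof -
  define W where "W k l = (\<Sum>i<n. u i k * v i l)" for k l
  define I where "I = {k. k < n \<and> d k \<le> x}"
  define J where "J = {k. k < n \<and> e k \<le> x + \<epsilon>}"
  have IJ: "I \<subseteq> {..<n}" "J \<subseteq> {..<n}" by (auto simp: I_def J_def)
  then have fin: "finite I" "finite J" by (auto intro: finite_subset)
  have W1: "(\<Sum>l<n. (W k l)\<^sup>2) = 1" if "k < n" for k
  proof -
    have "(\<Sum>l<n. (W k l)\<^sup>2) = (\<Sum>l<n. (\<Sum>i<n. v i l * u i k)\<^sup>2)" by (simp add: W_def mult.commute)
    also have "\<dots> = (\<Sum>i<n. (u i k)\<^sup>2)" by (rule parseval) (rule eigenbasisD(2)[OF b])
    also have "\<dots> = 1" using eigenbasisD(1)[OF a that that] by (simp add: power2_eq_square)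
    finally show ?thesis .
  qed
  have W2: "(\<Sum>k<n. (W k l)\<^sup>2) = 1" if "l < n" for l
  proof -
    have "(\<Sum>k<n. (W k l)\<^sup>2) = (\<Sum>i<n. (v i l)\<^sup>2)"
      unfolding W_def by (rule parseval) (rule eigenbasisD(2)[OF a])
    also have "\<dots> = 1" using eigenbasisD(1)[OF b that that] by (simp add: power2_eq_square)
    finally show ?thesis .
  qed
  have M: "(\<Sum>j<n. v j l * (\<Sum>i<n. u i k * (b i j - a i j))) = (e l - d k) * W k l" if "k < n" "l < n" for k l
  proof -
    have "(\<Sum>j<n. v j l * (\<Sum>i<n. u i k * (b i j - a i j)))
        = (\<Sum>j<n. \<Sum>i<n. u i k * (b i j * v j l)) - (\<Sum>j<n. v j l * (\<Sum>i<n. u i k * a i j))"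
      by (simp add: sum_distrib_left sum_subtractf[symmetric] algebra_simps)
    also have "(\<Sum>j<n. \<Sum>i<n. u i k * (b i j * v j l)) = (\<Sum>i<n. u i k * (\<Sum>j<n. b i j * v j l))"
      by (subst sum.swap) (simp add: sum_distrib_left)
    also have "\<dots> = e l * W k l"
      unfolding W_def sum_distrib_left[of "e l"] using that by (intro sum.cong refl) (simp add: eigenbasis_apply(1)[OF b])
    also have "(\<Sum>j<n. v j l * (\<Sum>i<n. u i k * a i j)) = d k * W k l"
      unfolding W_def sum_distrib_left[of "d k"] using that by (intro sum.cong refl) (simp add: eigenbasis_apply(2)[OF a])
    finally show ?thesis by (simp add: algebra_simps)
  qed
  have "(\<Sum>k<n. \<Sum>l<n. ((e l - d k) * W k l)\<^sup>2)
      = (\<Sum>k<n. \<Sum>l<n. (\<Sum>j<n. v j l * (\<Sum>i<n. u i k * (b i j - a i j)))\<^sup>2)"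
    by (intro sum.cong refl) (simp add: M)
  also have "\<dots> = (\<Sum>k<n. \<Sum>j<n. (\<Sum>i<n. u i k * (b i j - a i j))\<^sup>2)"
    by (intro sum.cong refl parseval) (rule eigenbasisD(2)[OF b])
  also have "\<dots> = (\<Sum>j<n. \<Sum>k<n. (\<Sum>i<n. u i k * (b i j - a i j))\<^sup>2)" by (rule sum.swap)
  also have "\<dots> = (\<Sum>j<n. \<Sum>i<n. (b i j - a i j)\<^sup>2)"
    by (intro sum.cong refl parseval) (rule eigenbasisD(2)[OF a])
  also have "\<dots> = (\<Sum>i<n. \<Sum>j<n. (b i j - a i j)\<^sup>2)" by (rule sum.swap)
  finally have HS: "(\<Sum>k<n. \<Sum>l<n. ((e l - d k) * W k l)\<^sup>2) = (\<Sum>i<n. \<Sum>j<n. (b i j - a i j)\<^sup>2)" .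
  have "\<epsilon>\<^sup>2 * (\<Sum>k\<in>I. \<Sum>l\<in>{..<n} - J. (W k l)\<^sup>2) \<le> (\<Sum>k\<in>I. \<Sum>l\<in>{..<n} - J. ((e l - d k) * W k l)\<^sup>2)"
    unfolding sum_distrib_left
  proof (intro sum_mono)
    fix k l assume "k \<in> I" "l \<in> {..<n} - J"
    then have "\<epsilon> \<le> e l - d k" by (auto simp: I_def J_def)
    then have "\<epsilon>\<^sup>2 \<le> (e l - d k)\<^sup>2" using eps by (intro power_mono) auto
    then show "\<epsilon>\<^sup>2 * (W k l)\<^sup>2 \<le> ((e l - d k) * W k l)\<^sup>2"
      by (simp add: power_mult_distrib mult_right_mono)
  qed
  also have "\<dots> \<le> (\<Sum>k<n. \<Sum>l<n. ((e l - d k) * W k l)\<^sup>2)"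
    by (intro order_trans[OF sum_mono[of I _ "\<lambda>k. \<Sum>l<n. ((e l - d k) * W k l)\<^sup>2"] sum_mono2] sum_mono2 sum_nonneg)
      (use IJ in auto)
  finally have "\<epsilon>\<^sup>2 * (\<Sum>k\<in>I. \<Sum>l\<in>{..<n} - J. (W k l)\<^sup>2) \<le> (\<Sum>i<n. \<Sum>j<n. (b i j - a i j)\<^sup>2)"
    unfolding HS .
  then have A: "(\<Sum>k\<in>I. \<Sum>l\<in>{..<n} - J. (W k l)\<^sup>2) \<le> (\<Sum>i<n. \<Sum>j<n. (b i j - a i j)\<^sup>2) / \<epsilon>\<^sup>2"
    using eps by (simp add: pos_le_divide_eq mult.commute)
  have B: "(\<Sum>k\<in>I. \<Sum>l\<in>J. (W k l)\<^sup>2) \<le> card J"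
  proof -
    have "(\<Sum>k\<in>I. \<Sum>l\<in>J. (W k l)\<^sup>2) \<le> (\<Sum>k<n. \<Sum>l\<in>J. (W k l)\<^sup>2)"
      using IJ by (intro sum_mono2 sum_nonneg) auto
    also have "\<dots> = (\<Sum>l\<in>J. \<Sum>k<n. (W k l)\<^sup>2)" by (rule sum.swap)
    also have "\<dots> = (\<Sum>l\<in>J. 1)" using IJ by (intro sum.cong refl W2) auto
    finally show ?thesis by simp
  qed
  have "real (card I) = (\<Sum>k\<in>I. \<Sum>l<n. (W k l)\<^sup>2)"
  proof -
    have "(\<Sum>k\<in>I. \<Sum>l<n. (W k l)\<^sup>2) = (\<Sum>k\<in>I. 1)" using IJ by (intro sum.cong refl W1) auto
    then show ?thesis by simp
  qed
  also have "\<dots> = (\<Sum>k\<in>I. (\<Sum>l\<in>{..<n} - J. (W k l)\<^sup>2) + (\<Sum>l\<in>J. (W k l)\<^sup>2))"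
    using IJ by (intro sum.cong refl sum.subset_diff) auto
  finally show ?thesis using A B unfolding sum.distrib I_def J_def by linarith
qed

text \<open>
  Gaussian elimination: one equation is solved for one unknown, which leaves fewer equations than unknowns.
\<close>

lemma homogeneous_system_nontrivial:
  fixes m :: "'e \<Rightarrow> 'k \<Rightarrow> real"
  assumes "finite E" "finite I" "card E < card I"
  shows "\<exists>c. (\<exists>k\<in>I. c k \<noteq> 0) \<and> (\<forall>e\<in>E. (\<Sum>k\<in>I. m e k * c k) = 0)"
  using assms
proof (induction E arbitrary: I m rule: finite_induct)
  case empty
  then have "I \<noteq> {}" by auto
  then show ?case by (intro exI[of _ "\<lambda>_. 1"]) auto
next
  case (insert f E)
  show ?case
  proof (cases "\<forall>k\<in>I. m f k = 0")
    case True
    have "card E < card I" using insert by simp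
    from insert.IH[OF insert.prems(1) this, of m] show ?thesis using True by auto
  next
    case False
    then obtain p where p: "p \<in> I" "m f p \<noteq> 0" by blast
    let ?I = "I - {p}"
    have "card E < card ?I" using insert p by simp
    from insert.IH[OF _ this, of "\<lambda>e k. m e k - m e p * m f k / m f p"] insert.prems(1)
    obtain c where c: "\<exists>k\<in>?I. c k \<noteq> 0"
      and 0: "\<And>e. e \<in> E \<Longrightarrow> (\<Sum>k\<in>?I. (m e k - m e p * m f k / m f p) * c k) = 0" by auto
    define c' where "c' = c(p := - (\<Sum>k\<in>?I. m f k * c k) / m f p)"
    have s: "(\<Sum>k\<in>I. m e k * c' k) = m e p * c' p + (\<Sum>k\<in>?I. m e k * c k)" for e
      using p insert.prems(1) by (subst sum.remove[of _ p]) (auto simp: c'_def intro!: sum.cong)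
    have "(\<Sum>k\<in>I. m e k * c' k) = 0" if "e \<in> insert f E" for e
    proof (cases "e = f")
      case True
      then show ?thesis unfolding s using p by (simp add: c'_def)
    next
      case False
      then have "0 = (\<Sum>k\<in>?I. m e k * c k - m e p / m f p * (m f k * c k))"
        using 0[of e] that by (simp add: algebra_simps)
      then show ?thesis unfolding s sum_subtractf sum_distrib_left[symmetric] by (simp add: c'_def)
    qed
    moreover have "\<exists>k\<in>I. c' k \<noteq> 0" using c by (auto simp: c'_def)
    ultimately show ?thesis by blast
  qed
qed

lemma eigenbasis_quadratic_form:
  assumes a: "eigenbasis n a d u"
  shows "(\<Sum>i<n. \<Sum>j<n. y i * a i j * y j) = (\<Sum>k<n. d k * (\<Sum>i<n. u i k * y i)\<^sup>2)"
proof -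
  have "(\<Sum>k<n. d k * (\<Sum>i<n. u i k * y i)\<^sup>2) = (\<Sum>k<n. \<Sum>i<n. \<Sum>j<n. y i * (u i k * d k * u j k) * y j)"
    by (simp add: power2_eq_square sum_product sum_distrib_left mult_ac)
  also have "\<dots> = (\<Sum>i<n. \<Sum>j<n. \<Sum>k<n. y i * (u i k * d k * u j k) * y j)" by (rule sum_rotate)
  also have "\<dots> = (\<Sum>i<n. \<Sum>j<n. y i * a i j * y j)"
    by (intro sum.cong refl) (simp add: eigenbasisD(3)[OF a] sum_distrib_left sum_distrib_right)
  finally show ?thesis by simp
qed

text \<open>
  If the count for \<open>a\<close> were larger, there would be more unknowns than equations for a nonzero vector \<open>y\<close> in the span of the
  eigenvectors of \<open>a\<close> with eigenvalue at most \<open>x\<close> that is orthogonal to those of \<open>b\<close> with eigenvalue at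
  most \<open>x\<close> and vanishes on \<open>S\<close>. On \<open>y\<close> the two quadratic forms agree, yet the first is at most
  \<open>x |y|\<^sup>2\<close> and the second is larger.
\<close>

lemma eigenvalue_count_perturb_rank:
  assumes a: "eigenbasis n a d u" and b: "eigenbasis n b e v" and S: "S \<subseteq> {..<n}"
    and eq: "\<And>i j. i < n \<Longrightarrow> j < n \<Longrightarrow> i \<notin> S \<Longrightarrow> j \<notin> S \<Longrightarrow> a i j = b i j"
  shows "card {k. k < n \<and> d k \<le> x} \<le> card {k. k < n \<and> e k \<le> x} + card S"
proof (rule ccontr)
  define I where "I = {k. k < n \<and> d k \<le> x}"
  define J where "J = {k. k < n \<and> e k \<le> x}"
  assume "\<not> ?thesis"
  then have less: "card J + card S < card I" by (simp add: I_def J_def)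
  have fin: "finite I" "finite J" "finite S" using S by (auto simp: I_def J_def intro: finite_subset)
  define E where "E = J <+> S"
  define m where "m q k = (case q of Inl l \<Rightarrow> (\<Sum>i<n. v i l * u i k) | Inr s \<Rightarrow> u s k)" for q k
  have "card E < card I" using less fin by (simp add: E_def card_Plus)
  then obtain c where c: "\<exists>k\<in>I. c k \<noteq> 0" and 0: "\<forall>q\<in>E. (\<Sum>k\<in>I. m q k * c k) = 0"
    using homogeneous_system_nontrivial[of E I m] fin by (auto simp: E_def)
  define y where "y i = (\<Sum>k\<in>I. u i k * c k)" for i
  have yS: "y s = 0" if "s \<in> S" for s
    using 0 that unfolding E_def y_def by (force simp: m_def)
  have alpha: "(\<Sum>i<n. u i k * y i) = (if k \<in> I then c k else 0)" if "k < n" for k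
  proof -
    have "(\<Sum>i<n. u i k * y i) = (\<Sum>i<n. \<Sum>l\<in>I. (u i k * u i l) * c l)"
      by (simp add: y_def sum_distrib_left mult_ac)
    also have "\<dots> = (\<Sum>l\<in>I. \<Sum>i<n. (u i k * u i l) * c l)" by (rule sum.swap)
    also have "\<dots> = (\<Sum>l\<in>I. if k = l then c l else 0)"
      unfolding sum_distrib_right[symmetric] using that
      by (intro sum.cong refl) (simp add: eigenbasisD(1)[OF a] I_def)
    also have "\<dots> = (if k \<in> I then c k else 0)" using fin by simp
    finally show ?thesis .
  qed
  have beta: "(\<Sum>i<n. v i l * y i) = 0" if "l \<in> J" for l
  proof -
    have "(\<Sum>i<n. v i l * y i) = (\<Sum>i<n. \<Sum>k\<in>I. (v i l * u i k) * c k)"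
      by (simp add: y_def sum_distrib_left mult_ac)
    also have "\<dots> = (\<Sum>k\<in>I. \<Sum>i<n. (v i l * u i k) * c k)" by (rule sum.swap)
    also have "\<dots> = (\<Sum>k\<in>I. m (Inl l) k * c k)"
      by (simp add: m_def sum_distrib_right)
    also have "\<dots> = 0" using 0 that by (auto simp: E_def)
    finally show ?thesis .
  qed
  have pa: "(\<Sum>k<n. (\<Sum>i<n. u i k * y i)\<^sup>2) = (\<Sum>i<n. (y i)\<^sup>2)"
    by (rule parseval) (rule eigenbasisD(2)[OF a])
  have pb: "(\<Sum>k<n. (\<Sum>i<n. v i k * y i)\<^sup>2) = (\<Sum>i<n. (y i)\<^sup>2)"
    by (rule parseval) (rule eigenbasisD(2)[OF b])
  have pos: "(\<Sum>k<n. (\<Sum>i<n. u i k * y i)\<^sup>2) > 0"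
  proof -
    obtain k where "k \<in> I" "c k \<noteq> 0" using c by blast
    then show ?thesis by (intro sum_pos2[of _ k]) (auto simp: alpha I_def)
  qed
  have "(\<Sum>k<n. d k * (\<Sum>i<n. u i k * y i)\<^sup>2) \<le> (\<Sum>k<n. x * (\<Sum>i<n. u i k * y i)\<^sup>2)"
    by (intro sum_mono) (auto simp: alpha I_def mult_right_mono)
  also have "\<dots> = x * (\<Sum>k<n. (\<Sum>i<n. v i k * y i)\<^sup>2)" using pa pb by (simp add: sum_distrib_left[symmetric])
  also have "\<dots> < (\<Sum>k<n. e k * (\<Sum>i<n. v i k * y i)\<^sup>2)"
  proof -
    obtain l where l: "l < n" "(\<Sum>i<n. v i l * y i) \<noteq> 0"
      using pos unfolding pa pb[symmetric] by (metis (no_types, lifting) lessThan_iff less_irrefl power_zero_numeral sum.neutral)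
    have "l \<notin> J" using l beta by auto
    show ?thesis unfolding sum_distrib_left
    proof (rule sum_strict_mono_ex1)
      show "\<forall>k\<in>{..<n}. x * (\<Sum>i<n. v i k * y i)\<^sup>2 \<le> e k * (\<Sum>i<n. v i k * y i)\<^sup>2"
      proof
        fix k assume "k \<in> {..<n}"
        then show "x * (\<Sum>i<n. v i k * y i)\<^sup>2 \<le> e k * (\<Sum>i<n. v i k * y i)\<^sup>2"
          using beta[of k] by (cases "k \<in> J") (auto simp: J_def intro!: mult_right_mono)
      qed
      show "\<exists>k\<in>{..<n}. x * (\<Sum>i<n. v i k * y i)\<^sup>2 < e k * (\<Sum>i<n. v i k * y i)\<^sup>2"
        using l \<open>l \<notin> J\<close> by (intro bexI[of _ l]) (auto simp: J_def)
    qed simp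
  qed
  finally have "(\<Sum>i<n. \<Sum>j<n. y i * a i j * y j) < (\<Sum>i<n. \<Sum>j<n. y i * b i j * y j)"
    by (simp add: eigenbasis_quadratic_form[OF a] eigenbasis_quadratic_form[OF b])
  moreover have "(\<Sum>i<n. \<Sum>j<n. y i * a i j * y j) = (\<Sum>i<n. \<Sum>j<n. y i * b i j * y j)"
  proof (intro sum.cong refl)
    fix i j assume "i \<in> {..<n}" "j \<in> {..<n}"
    then show "y i * a i j * y j = y i * b i j * y j"
      using yS[of i] yS[of j] eq[of i j] by (cases "i \<in> S"; cases "j \<in> S") auto
  qed
  ultimately show False by simp
qed

lemma eigenbasis_scale:
  assumes "eigenbasis n a d u"
  shows "eigenbasis n (\<lambda>i j. c * a i j) (\<lambda>k. c * d k) u"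
  using assms unfolding eigenbasis_def by (simp add: sum_distrib_left mult_ac)

lemma eigenbasis_pad:
  assumes e: "eigenbasis n a d u" and le: "n \<le> N"
  shows "eigenbasis N (\<lambda>i j. if i < n \<and> j < n then a i j else 0) (\<lambda>k. if k < n then d k else 0)
    (\<lambda>i k. if i < n \<and> k < n then u i k else of_bool (i = k))"
proof -
  let ?u = "\<lambda>i k. if i < n \<and> k < n then u i k else of_bool (i = k)"
  have split: "(\<Sum>k<N. f k) = (\<Sum>k<n. f k) + (\<Sum>k\<in>{n..<N}. f k)" for f :: "nat \<Rightarrow> real"
    using le by (metis atLeast0LessThan le0 sum.atLeastLessThan_concat)
  have ob: "(\<Sum>k\<in>{n..<N}. of_bool (i = k) * f k) = (if n \<le> i \<and> i < N then f i else 0)" for i and f :: "nat \<Rightarrow> real"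
    by (simp add: of_bool_def if_distrib[of "\<lambda>x. x * _"] cong: if_cong)
  have ob': "(\<Sum>k\<in>{n..<N}. of_bool (k = i) * f k) = (if n \<le> i \<and> i < N then f i else 0)" for i and f :: "nat \<Rightarrow> real"
    by (simp add: of_bool_def if_distrib[of "\<lambda>x. x * _"] cong: if_cong)
  have z: "(\<Sum>k<n. of_bool (i = k) * f k) = 0" "(\<Sum>k<n. of_bool (k = i) * f k) = 0" if "i \<ge> n" for i and f :: "nat \<Rightarrow> real"
    using that by (auto intro!: sum.neutral)
  show ?thesis unfolding eigenbasis_def
  proof (intro conjI allI impI)
    fix i j assume ij: "i < N" "j < N"
    show "(\<Sum>k<N. ?u k i * ?u k j) = of_bool (i = j)"
      unfolding split using ij eigenbasisD(1)[OF e, of i j]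
      by (cases "i < n"; cases "j < n") (auto simp: ob' z intro!: sum.neutral)
    show "(\<Sum>k<N. ?u i k * ?u j k) = of_bool (i = j)"
      unfolding split using ij eigenbasisD(2)[OF e, of i j]
      by (cases "i < n"; cases "j < n") (auto simp: ob z intro!: sum.neutral)
    show "(if i < n \<and> j < n then a i j else 0) = (\<Sum>k<N. ?u i k * (if k < n then d k else 0) * ?u j k)"
      unfolding split using ij eigenbasisD(3)[OF e, of i j]
      by (cases "i < n"; cases "j < n") (auto simp: ob z intro!: sum.neutral)
  qed
qed

section \<open>Laws determined by their moments\<close>

text \<open>
  The Taylor remainder of the characteristic function is bounded by the next even moment, and the growth
  condition turns this bound into a term of the exponential series.
\<close>

lemma (in real_distribution) char_moment_series:
  assumes int: "\<And>k. integrable M (\<lambda>x. x ^ k)"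
    and D: "\<And>k. expectation (\<lambda>x. x ^ (2 * k)) \<le> fact (2 * k) / fact k * D ^ k"
  shows "(\<lambda>n. \<Sum>k \<le> 2 * n. ((\<i> * t)^k / fact k) * expectation (\<lambda>x. x^k)) \<longlonglongrightarrow> char M t"
proof -
  let ?s = "\<lambda>n. \<Sum>k \<le> 2 * n. ((\<i> * t)^k / fact k) * expectation (\<lambda>x. x^k)"
  have bound: "cmod (?s n - char M t) \<le> 2 * ((t\<^sup>2 * D) ^ n / fact n)" for n
  proof -
    have "cmod (char M t - ?s n) \<le> (2 * \<bar>t\<bar>^(2 * n) / fact (2 * n)) * expectation (\<lambda>x. \<bar>x\<bar>^(2 * n))"
      using char_approx1[of "2 * n" t] int by simp
    also have "\<dots> = (2 * \<bar>t\<bar>^(2 * n) / fact (2 * n)) * expectation (\<lambda>x. x^(2 * n))"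
      by (simp add: power_even_abs)
    also have "\<dots> \<le> (2 * \<bar>t\<bar>^(2 * n) / fact (2 * n)) * (fact (2 * n) / fact n * D ^ n)"
      by (intro mult_left_mono D) auto
    also have "\<dots> = 2 * ((t\<^sup>2 * D) ^ n / fact n)"
      by (simp add: power_mult power_mult_distrib)
    finally show ?thesis by (simp add: norm_minus_commute)
  qed
  have "(\<lambda>n. (t\<^sup>2 * D) ^ n / fact n) \<longlonglongrightarrow> 0"
    using summable_LIMSEQ_zero[OF summable_exp, of "t\<^sup>2 * D"] by (simp add: inverse_eq_divide)
  then have "(\<lambda>n. 2 * ((t\<^sup>2 * D) ^ n / fact n)) \<longlonglongrightarrow> 0" by (rule tendsto_mult_right_zero)
  then have "(\<lambda>n. ?s n - char M t) \<longlonglongrightarrow> 0"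
    by (rule Lim_null_comparison[rotated]) (use bound in auto)
  then show ?thesis by (simp only: LIM_zero_iff)
qed

lemma moments_determine_distribution:
  assumes \<mu>: "real_distribution \<mu>" and \<nu>: "real_distribution \<nu>"
    and int: "\<And>k::nat. integrable \<mu> (\<lambda>x. x ^ k)" "\<And>k::nat. integrable \<nu> (\<lambda>x. x ^ k)"
    and eq: "\<And>k::nat. (\<integral>x. x ^ k \<partial>\<mu>) = (\<integral>x. x ^ k \<partial>\<nu>)"
    and D: "\<And>k. (\<integral>x. x ^ (2 * k) \<partial>\<mu>) \<le> fact (2 * k) / fact k * D ^ k"
  shows "\<mu> = \<nu>"
proof (rule Levy_uniqueness[OF \<mu> \<nu>], rule ext)
  fix t
  have "(\<lambda>n. \<Sum>k \<le> 2 * n. ((\<i> * t)^k / fact k) * (\<integral>x. x ^ k \<partial>\<mu>)) \<longlonglongrightarrow> char \<mu> t"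
    by (rule real_distribution.char_moment_series[OF \<mu> int(1) D])
  moreover have "(\<lambda>n. \<Sum>k \<le> 2 * n. ((\<i> * t)^k / fact k) * (\<integral>x. x ^ k \<partial>\<nu>)) \<longlonglongrightarrow> char \<nu> t"
    by (rule real_distribution.char_moment_series[OF \<nu> int(2), of D]) (use D eq in simp)
  ultimately show "char \<mu> t = char \<nu> t" unfolding eq by (rule LIMSEQ_unique)
qed

lemma abs_diff_clamp_le:
  fixes y c :: real
  assumes "c > 0"
  shows "\<bar>y - max (- c) (min c y)\<bar> \<le> y\<^sup>2 / c"
proof (cases "\<bar>y\<bar> \<le> c")
  case True
  then show ?thesis using assms by (auto simp: max_def min_def)
next
  case False
  then have "c * \<bar>y\<bar> \<le> \<bar>y\<bar> * \<bar>y\<bar>" by (intro mult_right_mono) auto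
  then have "\<bar>y\<bar> \<le> y\<^sup>2 / c" using assms by (simp add: pos_le_divide_eq power2_eq_square mult.commute)
  moreover have "\<bar>y - max (- c) (min c y)\<bar> \<le> \<bar>y\<bar>" using assms by (auto simp: max_def min_def)
  ultimately show ?thesis by linarith
qed

text \<open>
  The powers are unbounded, so they are clamped at level \<open>c\<close>; the error is at most the moment of twice the
  order divided by \<open>c\<close>, uniformly along the sequence.
\<close>

lemma moments_of_weak_limit:
  assumes \<mu>s: "\<And>n. real_distribution (\<mu>s n)" and \<mu>: "real_distribution \<mu>"
    and w: "weak_conv_m \<mu>s \<mu>"
    and int: "\<And>n r. integrable (\<mu>s n) (\<lambda>x. x ^ r)"
    and lim: "\<And>r. (\<lambda>n. \<integral>x. x ^ r \<partial>\<mu>s n) \<longlonglongrightarrow> \<beta> r"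
  shows "integrable \<mu> (\<lambda>x. x ^ r)" "(\<integral>x. x ^ r \<partial>\<mu>) = \<beta> r"
proof -
  interpret \<mu>: real_distribution \<mu> by fact
  interpret \<mu>s: real_distribution "\<mu>s n" for n by (rule \<mu>s)
  have clamp_conv: "(\<lambda>n. \<integral>x. max (- c) (min c (x ^ k)) \<partial>\<mu>s n) \<longlonglongrightarrow> (\<integral>x. max (- c) (min c (x ^ k)) \<partial>\<mu>)" if "c > 0" for c k
    by (rule weak_conv_imp_integral_bdd_continuous_conv[OF \<mu>s \<mu> w, of _ c])
      (use that in \<open>auto intro!: continuous_intros\<close>)
  have int_clamp: "integrable \<mu> (\<lambda>x. max (- c) (min c (x ^ k)))" "integrable (\<mu>s n) (\<lambda>x. max (- c) (min c (x ^ k)))" if "c > 0" for c k n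
    using that by (auto intro!: \<mu>.integrable_const_bound[of _ c] \<mu>s.integrable_const_bound[of _ c] simp: abs_le_iff)
  obtain B where B: "\<And>n. (\<integral>x. x ^ (2 * r) \<partial>\<mu>s n) \<le> B"
    using convergent_imp_Bseq[OF convergentI[OF lim[of "2 * r"]]] unfolding Bseq_def real_norm_def
    by (meson abs_le_D1)
  have int2: "integrable \<mu> (\<lambda>x. x ^ (2 * r))"
  proof -
    let ?f = "\<lambda>N x. max (- real (Suc N)) (min (real (Suc N)) (x ^ (2 * r)))"
    have f_eq: "?f N x = min (real (Suc N)) (x ^ (2 * r))" for N x
    proof -
      have "0 \<le> x ^ (2 * r)" by simp
      then have "- real (Suc N) \<le> x ^ (2 * r)" by (rule order_trans[rotated]) simp
      then show ?thesis by (intro max_absorb2 min.boundedI) auto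
    qed
    have int_min: "integrable \<mu> (\<lambda>x. min (real (Suc N)) (x ^ (2 * r)))" for N
      using int_clamp(1)[of "real (Suc N)" "2 * r"] unfolding f_eq by simp
    have inc: "incseq (\<lambda>N. \<integral>x. ?f N x \<partial>\<mu>)"
      by (unfold f_eq, intro incseq_SucI integral_mono int_min) (simp add: min_def)
    have bnd: "(\<integral>x. ?f N x \<partial>\<mu>) \<le> B" for N
    proof (rule LIMSEQ_le_const2[OF clamp_conv])
      show "\<exists>M. \<forall>n\<ge>M. (\<integral>x. ?f N x \<partial>\<mu>s n) \<le> B"
      proof (intro exI allI impI)
        fix n
        have "(\<integral>x. ?f N x \<partial>\<mu>s n) \<le> (\<integral>x. x ^ (2 * r) \<partial>\<mu>s n)"
          by (intro integral_mono int_clamp int) (simp_all add: f_eq del: of_nat_Suc)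
        then show "(\<integral>x. ?f N x \<partial>\<mu>s n) \<le> B" using B[of n] by simp
      qed
    qed simp
    obtain l where l: "(\<lambda>N. \<integral>x. ?f N x \<partial>\<mu>) \<longlonglongrightarrow> l"
      using incseq_convergent[OF inc] bnd by blast
    show ?thesis
    proof (rule integrable_monotone_convergence[OF _ _ _ l])
      show "integrable \<mu> (?f N)" for N by (intro int_clamp) simp
      show "AE x in \<mu>. mono (\<lambda>N. ?f N x)"
        unfolding f_eq by (intro AE_I2 incseq_SucI) (simp add: min_def)
      show "AE x in \<mu>. (\<lambda>N. ?f N x) \<longlonglongrightarrow> x ^ (2 * r)"
      proof (intro AE_I2 tendsto_eventually)
        fix x :: real
        obtain N0 where "\<bar>x ^ (2 * r)\<bar> \<le> real N0" using real_arch_simple by blast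
        then show "\<forall>\<^sub>F N in sequentially. ?f N x = x ^ (2 * r)"
          unfolding f_eq by (intro eventually_sequentiallyI[of N0]) (auto simp: min_def)
      qed
    qed simp
  qed
  show int1: "integrable \<mu> (\<lambda>x. x ^ r)"
  proof (rule Bochner_Integration.integrable_bound[OF Bochner_Integration.integrable_add[OF _ int2]])
    show "integrable \<mu> (\<lambda>x. 1::real)" by simp
    have y: "\<bar>y\<bar> \<le> \<bar>1 + y\<^sup>2\<bar>" for y :: real
      using zero_le_power2[of "\<bar>y\<bar> - 1"] zero_le_power2[of y] unfolding power2_diff power2_abs by simp
    show "AE x in \<mu>. norm (x ^ r) \<le> norm (1 + x ^ (2 * r))"
      by (intro AE_I2) (use y in \<open>simp add: power_even_eq\<close>)
  qed simp
  define C where "C = B + (\<integral>x. x ^ (2 * r) \<partial>\<mu>)"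
  have clamp_err: "\<bar>(\<integral>x. x ^ r \<partial>\<nu>) - (\<integral>x. max (- c) (min c (x ^ r)) \<partial>\<nu>)\<bar> \<le> (\<integral>x. x ^ (2 * r) \<partial>\<nu>) / c"
    if "real_distribution \<nu>" "c > 0" "integrable \<nu> (\<lambda>x. x ^ r)" "integrable \<nu> (\<lambda>x. x ^ (2 * r))"
      "integrable \<nu> (\<lambda>x. max (- c) (min c (x ^ r)))" for c \<nu>
  proof -
    have "\<bar>(\<integral>x. x ^ r \<partial>\<nu>) - (\<integral>x. max (- c) (min c (x ^ r)) \<partial>\<nu>)\<bar> = \<bar>\<integral>x. x ^ r - max (- c) (min c (x ^ r)) \<partial>\<nu>\<bar>"
      using that by simp
    also have "\<dots> \<le> (\<integral>x. \<bar>x ^ r - max (- c) (min c (x ^ r))\<bar> \<partial>\<nu>)" by (rule integral_abs_bound)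
    also have "\<dots> \<le> (\<integral>x. x ^ (2 * r) / c \<partial>\<nu>)"
      using that abs_diff_clamp_le[of c] by (intro integral_mono integrable_abs) (auto simp: power_even_eq)
    finally show ?thesis by simp
  qed
  have close: "\<bar>(\<integral>x. x ^ r \<partial>\<mu>) - \<beta> r\<bar> \<le> C / c" if c: "c > 0" for c
  proof -
    have "(\<lambda>n. \<bar>(\<integral>x. x ^ r \<partial>\<mu>s n) - (\<integral>x. max (- c) (min c (x ^ r)) \<partial>\<mu>s n)\<bar>)
       \<longlonglongrightarrow> \<bar>\<beta> r - (\<integral>x. max (- c) (min c (x ^ r)) \<partial>\<mu>)\<bar>"
      by (intro tendsto_intros lim clamp_conv c)
    moreover have "\<bar>(\<integral>x. x ^ r \<partial>\<mu>s n) - (\<integral>x. max (- c) (min c (x ^ r)) \<partial>\<mu>s n)\<bar> \<le> B / c" for n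
      by (rule order_trans[OF clamp_err[OF \<mu>s c int int int_clamp(2)[OF c]] divide_right_mono[OF B]]) (use c in simp)
    ultimately have "\<bar>\<beta> r - (\<integral>x. max (- c) (min c (x ^ r)) \<partial>\<mu>)\<bar> \<le> B / c"
      by (intro LIMSEQ_le_const2) auto
    with clamp_err[OF \<mu> c int1 int2 int_clamp(1)[OF c]] show ?thesis
      unfolding C_def add_divide_distrib by linarith
  qed
  have "(\<lambda>m. C / real (Suc m)) \<longlonglongrightarrow> 0" by (rule lim_const_over_n[THEN LIMSEQ_Suc])
  then have "\<bar>(\<integral>x. x ^ r \<partial>\<mu>) - \<beta> r\<bar> \<le> 0"
    by (rule LIMSEQ_le_const) (use close in auto)
  then show "(\<integral>x. x ^ r \<partial>\<mu>) = \<beta> r" by simp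
qed

lemma tight_of_bounded_second_moment:
  assumes \<mu>s: "\<And>n. real_distribution (\<mu>s n)" and int: "\<And>n. integrable (\<mu>s n) (\<lambda>x. x\<^sup>2)"
    and B: "\<And>n. (\<integral>x. x\<^sup>2 \<partial>\<mu>s n) \<le> B"
  shows "tight \<mu>s"
  unfolding tight_def
proof (intro conjI allI impI \<mu>s)
  fix \<epsilon> :: real assume eps: "\<epsilon> > 0"
  have B0: "B \<ge> 0" using B[of 0] by (rule order_trans[rotated]) simp
  define a where "a = (B + 1) / \<epsilon> + 1"
  have a: "a \<ge> 1" using eps B0 by (simp add: a_def)
  have "measure (\<mu>s n) {- a<..a} > 1 - \<epsilon>" for n
  proof -
    interpret real_distribution "\<mu>s n" by (rule \<mu>s)
    have "measure (\<mu>s n) {x. a\<^sup>2 \<le> x\<^sup>2} \<le> (\<integral>x. x\<^sup>2 \<partial>\<mu>s n) / a\<^sup>2"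
      using integral_Markov_inequality_measure[OF int[of n], of "UNIV" "a\<^sup>2"] a by simp
    also have "\<dots> \<le> B / a\<^sup>2" using B by (intro divide_right_mono) auto
    also have "\<dots> \<le> B / a"
      using a B0 by (intro divide_left_mono) (auto simp: power2_eq_square)
    also have "\<dots> < \<epsilon>"
      using eps B0 a unfolding a_def by (simp add: field_simps add_pos_pos)
    finally have "prob {x. a\<^sup>2 \<le> x\<^sup>2} < \<epsilon>" .
    moreover have "1 - prob {- a<..a} = prob (UNIV - {- a<..a})"
      using prob_compl[of "{- a<..a}"] by simp
    moreover have "prob (UNIV - {- a<..a}) \<le> prob {x. a\<^sup>2 \<le> x\<^sup>2}"
      using a by (intro finite_measure_mono) (auto simp: abs_le_square_iff[symmetric])
    ultimately show ?thesis by linarith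
  qed
  then show "\<exists>a b. a < b \<and> (\<forall>n. 1 - \<epsilon> < measure (\<mu>s n) {a<..b})"
    using a by (intro exI[of _ "- a"] exI[of _ a]) auto
qed

text \<open>
  Bounded second moments give tightness, so subsequences converge weakly; every such limit has the
  moments \<open>\<beta>\<close>, and there is only one law with these moments.
\<close>

theorem moment_convergence:
  assumes \<mu>s: "\<And>n. real_distribution (\<mu>s n)"
    and int: "\<And>n r. integrable (\<mu>s n) (\<lambda>x. x ^ r)"
    and lim: "\<And>r. (\<lambda>n. \<integral>x. x ^ r \<partial>\<mu>s n) \<longlonglongrightarrow> \<beta> r"
    and D: "\<And>k. \<beta> (2 * k) \<le> fact (2 * k) / fact k * D ^ k"
  shows "\<exists>\<mu>. real_distribution \<mu> \<and> (\<forall>r. integrable \<mu> (\<lambda>x. x ^ r) \<and> (\<integral>x. x ^ r \<partial>\<mu>) = \<beta> r) \<and> weak_conv_m \<mu>s \<mu>"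
proof -
  obtain B where B: "\<And>n. (\<integral>x. x\<^sup>2 \<partial>\<mu>s n) \<le> B"
    using convergent_imp_Bseq[OF convergentI[OF lim[of 2]]] unfolding Bseq_def real_norm_def
    by (meson abs_le_D1)
  have tight: "tight \<mu>s" using tight_of_bounded_second_moment[OF \<mu>s int B] .
  have sub: "integrable \<nu> (\<lambda>x. x ^ r)" "(\<integral>x. x ^ r \<partial>\<nu>) = \<beta> r"
    if "strict_mono s" "real_distribution \<nu>" "weak_conv_m (\<mu>s \<circ> s) \<nu>" for s \<nu> r
    using moments_of_weak_limit[of "\<mu>s \<circ> s" \<nu> \<beta> r] that \<mu>s int LIMSEQ_subseq_LIMSEQ[OF lim that(1)]
    by (auto simp: o_def)
  obtain s \<mu> where s: "strict_mono s" "real_distribution \<mu>" "weak_conv_m (\<mu>s \<circ> s) \<mu>"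
    using tight_imp_convergent_subsubsequence[OF tight strict_mono_id] by auto
  have "weak_conv_m \<mu>s \<mu>"
  proof (rule tight_subseq_weak_converge[OF \<mu>s s(2) tight])
    fix t \<nu> assume t: "strict_mono t" "real_distribution \<nu>" "weak_conv_m (\<mu>s \<circ> t) \<nu>"
    have "\<nu> = \<mu>"
      by (rule moments_determine_distribution[where D = D]) (use s t sub D in auto)
    then show "weak_conv_m (\<mu>s \<circ> t) \<mu>" using t by simp
  qed
  then show ?thesis using s sub by blast
qed

section \<open>Counting walks by the number of their labels\<close>

lemma set_steps_Cons: "v \<noteq> [] \<Longrightarrow> set (steps f (x # v)) = insert (f x (hd v)) (set (steps f v))"
  by (simp add: steps_Cons)

lemma length_steps [simp]: "length (steps f v) = length v - 1"
  by (induction f v rule: steps.induct) auto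

lemma nth_steps: "Suc i < length v \<Longrightarrow> steps f v ! i = f (v ! i) (v ! Suc i)"
proof (induction f v arbitrary: i rule: steps.induct)
  case (1 f x y v)
  then show ?case by (cases i) auto
qed auto

definition tri_walks :: "nat \<Rightarrow> nat \<Rightarrow> nat list set" where
  "tri_walks n h = {v. length v = Suc h \<and> set v \<subseteq> {..<n} \<and> successively (\<lambda>x y. x + y < n) v}"

lemma finite_tri_walks: "finite (tri_walks n h)"
  by (rule finite_subset[OF _ finite_walks[of n h]]) (auto simp: tri_walks_def walks_def)

lemma tri_walks_0: "tri_walks n 0 = (\<lambda>x. [x]) ` {..<n}"
  by (auto simp: tri_walks_def length_Suc_conv)

text \<open>
  The link function of size \<open>n\<close> on the triangle \<open>x + y < n\<close>, with the bound of condition (B). By symmetry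
  it bounds the number of ways to extend a walk at its front.
\<close>

definition thin_link :: "nat \<Rightarrow> (nat \<Rightarrow> nat \<Rightarrow> 't) \<Rightarrow> nat \<Rightarrow> bool" where
  "thin_link n l D \<longleftrightarrow> (\<forall>x y. x + y < n \<longrightarrow> l x y = l y x) \<and> (\<forall>y<n. \<forall>t. card {x. x + y < n \<and> l x y = t} \<le> D)"

text \<open>
  A walk is built by adding vertices at its front. A step whose label is in \<open>T\<close> or has been seen before
  has at most \<open>(h + m) D\<close> continuations, one with a new label has at most \<open>n\<close>; the factor \<open>2\<^sup>h\<close> accounts for
  the choice, at each step, between the two. The set \<open>T\<close> of labels that are known in advance makes it
  possible to count pairs of walks one after the other. The explicit constant is what later bounds
  the growth of the limit moments.
\<close>

lemma card_walks_new_labels: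
  assumes l: "thin_link n l D" and T: "finite T" "card T \<le> m"
  shows "j \<le> h \<Longrightarrow> card {v \<in> tri_walks n h. card (set (steps l v) - T) = j} \<le> 2 ^ h * ((h + m) * D) ^ (h - j) * n ^ Suc j"
proof (induction h arbitrary: j)
  case 0
  have "card {v \<in> tri_walks n 0. card (set (steps l v) - T) = j} \<le> card (tri_walks n 0)"
    by (rule card_mono[OF finite_tri_walks]) auto
  also have "\<dots> \<le> n" unfolding tri_walks_0 using card_image_le[of "{..<n}" "\<lambda>x. [x]"] by simp
  finally show ?case using 0 by simp
next
  case (Suc h)
  define P where "P i = {v \<in> tri_walks n h. card (set (steps l v) - T) = i}" for i
  define Old where "Old v = {x. x + hd v < n \<and> l x (hd v) \<in> set (steps l v) \<union> T}" for v
  have finP: "finite (P i)" for i by (simp add: P_def finite_tri_walks)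
  have fin: "finite {x. x + y < n \<and> Q x}" for y and Q :: "nat \<Rightarrow> bool"
    by (rule finite_subset[of _ "{..<n}"]) auto
  have old: "card (Old v) \<le> (h + m) * D" if "v \<in> tri_walks n h" for v
  proof -
    have y: "hd v < n" using that by (auto simp: tri_walks_def length_Suc_conv)
    have fS: "finite (set (steps l v) \<union> T)" using T by simp
    have "Old v = (\<Union>t\<in>set (steps l v) \<union> T. {x. x + hd v < n \<and> l x (hd v) = t})"
      by (auto simp: Old_def)
    also have "card \<dots> \<le> (\<Sum>t\<in>set (steps l v) \<union> T. card {x. x + hd v < n \<and> l x (hd v) = t})"
      using fS by (rule card_UN_le)
    also have "\<dots> \<le> (\<Sum>t\<in>set (steps l v) \<union> T. D)"
      using l y by (intro sum_mono) (auto simp: thin_link_def)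
    also have "\<dots> = card (set (steps l v) \<union> T) * D" by simp
    also have "\<dots> \<le> (h + m) * D"
    proof (rule mult_right_mono)
      have "card (set (steps l v) \<union> T) \<le> card (set (steps l v)) + card T" by (rule card_Un_le)
      also have "card (set (steps l v)) \<le> h"
        using card_length[of "steps l v"] that by (simp add: tri_walks_def)
      finally show "card (set (steps l v) \<union> T) \<le> h + m" using T by simp
    qed simp
    finally show ?thesis .
  qed
  let ?Q = "{v \<in> tri_walks n (Suc h). card (set (steps l v) - T) = j}"
  have sub: "?Q \<subseteq> (\<lambda>(v, x). x # v) ` ((SIGMA v:P j. Old v) \<union> (if j = 0 then {} else P (j - 1) \<times> {..<n}))"
  proof
    fix w assume w: "w \<in> ?Q"
    then obtain x v where xv: "w = x # v" "v \<noteq> []" by (auto simp: tri_walks_def length_Suc_conv)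
    have v: "v \<in> tri_walks n h" and x: "x < n" "x + hd v < n"
      using w xv by (auto simp: tri_walks_def successively_Cons)
    have s: "set (steps l w) = insert (l x (hd v)) (set (steps l v))" using xv by (simp add: set_steps_Cons)
    have "(v, x) \<in> (SIGMA v:P j. Old v) \<union> (if j = 0 then {} else P (j - 1) \<times> {..<n})"
    proof (cases "l x (hd v) \<in> set (steps l v) \<union> T")
      case True
      then have "set (steps l w) - T = set (steps l v) - T" unfolding s by auto
      then show ?thesis using w v x True by (auto simp: P_def Old_def)
    next
      case False
      then have "set (steps l w) - T = insert (l x (hd v)) (set (steps l v) - T)" unfolding s by auto
      then have "card (set (steps l w) - T) = Suc (card (set (steps l v) - T))" using False by simp
      then show ?thesis using w v x by (auto simp: P_def)
    qed
    then show "w \<in> (\<lambda>(v, x). x # v) ` ((SIGMA v:P j. Old v) \<union> (if j = 0 then {} else P (j - 1) \<times> {..<n}))"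
      using xv by force
  qed
  have "card ?Q \<le> card ((SIGMA v:P j. Old v) \<union> (if j = 0 then {} else P (j - 1) \<times> {..<n}))"
  proof (rule surj_card_le[OF _ sub])
    show "finite ((SIGMA v:P j. Old v) \<union> (if j = 0 then {} else P (j - 1) \<times> {..<n}))"
      using finP fin by (auto simp: Old_def)
  qed
  also have "\<dots> \<le> card (SIGMA v:P j. Old v) + card (if j = 0 then {} else P (j - 1) \<times> {..<n})" by (rule card_Un_le)
  also have "card (SIGMA v:P j. Old v) \<le> 2 ^ h * ((Suc h + m) * D) ^ (Suc h - j) * n ^ Suc j"
  proof (cases "j \<le> h")
    case True
    have "card (SIGMA v:P j. Old v) = (\<Sum>v\<in>P j. card (Old v))"
      using finP fin by (intro card_SigmaI) (auto simp: Old_def)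
    also have "\<dots> \<le> (\<Sum>v\<in>P j. (h + m) * D)"
      by (intro sum_mono old) (auto simp: P_def)
    also have "\<dots> = card (P j) * ((h + m) * D)" by simp
    also have "\<dots> \<le> (2 ^ h * ((h + m) * D) ^ (h - j) * n ^ Suc j) * ((h + m) * D)"
      using Suc.IH[OF True] unfolding P_def by (rule mult_right_mono) simp
    also have "\<dots> = 2 ^ h * ((h + m) * D) ^ (Suc h - j) * n ^ Suc j"
      using True by (simp add: Suc_diff_le)
    also have "\<dots> \<le> 2 ^ h * ((Suc h + m) * D) ^ (Suc h - j) * n ^ Suc j"
      by (intro mult_mono power_mono) auto
    finally show ?thesis .
  next
    case False
    have "P j = {}"
    proof -
      have "card (set (steps l v) - T) \<le> h" if "v \<in> tri_walks n h" for v
      proof -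
        have "card (set (steps l v) - T) \<le> card (set (steps l v))" by (intro card_mono) auto
        also have "\<dots> \<le> h" using card_length[of "steps l v"] that by (simp add: tri_walks_def)
        finally show ?thesis .
      qed
      then show ?thesis using False by (force simp: P_def)
    qed
    then show ?thesis by simp
  qed
  also have "card (if j = 0 then {} else P (j - 1) \<times> {..<n}) \<le> 2 ^ h * ((Suc h + m) * D) ^ (Suc h - j) * n ^ Suc j"
  proof (cases "j = 0")
    case False
    then have "card (if j = 0 then {} else P (j - 1) \<times> {..<n}) = card (P (j - 1)) * n" by (simp add: card_cartesian_product)
    also have "\<dots> \<le> (2 ^ h * ((h + m) * D) ^ (h - (j - 1)) * n ^ Suc (j - 1)) * n"
      using Suc.IH[of "j - 1"] Suc.prems unfolding P_def by (intro mult_right_mono) auto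
    also have "\<dots> = 2 ^ h * ((h + m) * D) ^ (Suc h - j) * n ^ Suc j"
      using False Suc.prems by (cases j) auto
    also have "\<dots> \<le> 2 ^ h * ((Suc h + m) * D) ^ (Suc h - j) * n ^ Suc j"
      by (intro mult_mono power_mono) auto
    finally show ?thesis .
  qed simp
  finally show ?case by simp
qed

definition walk_const :: "nat \<Rightarrow> nat \<Rightarrow> nat \<Rightarrow> nat" where
  "walk_const h m D = Suc h * (2 ^ h * Suc ((h + m) * D) ^ h)"

lemma card_walks_few_new_labels:
  assumes l: "thin_link n l D" and T: "finite T" "card T \<le> m" and n: "n > 0"
  shows "card {v \<in> tri_walks n h. card (set (steps l v) - T) \<le> j} \<le> walk_const h m D * n ^ Suc j"
proof -
  define P where "P i = {v \<in> tri_walks n h. card (set (steps l v) - T) = i}" for i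
  have "card (set (steps l v) - T) \<le> h" if "v \<in> tri_walks n h" for v
  proof -
    have "card (set (steps l v) - T) \<le> card (set (steps l v))" by (intro card_mono) auto
    also have "\<dots> \<le> h" using card_length[of "steps l v"] that by (simp add: tri_walks_def)
    finally show ?thesis .
  qed
  then have "{v \<in> tri_walks n h. card (set (steps l v) - T) \<le> j} = (\<Union>i\<in>{..min h j}. P i)"
    by (auto simp: P_def)
  also have "card \<dots> \<le> (\<Sum>i\<in>{..min h j}. card (P i))" by (rule card_UN_le) simp
  also have "\<dots> \<le> (\<Sum>i\<in>{..min h j}. 2 ^ h * Suc ((h + m) * D) ^ h * n ^ Suc j)"
  proof (rule sum_mono)
    fix i assume i: "i \<in> {..min h j}"
    have "card (P i) \<le> 2 ^ h * ((h + m) * D) ^ (h - i) * n ^ Suc i"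
      unfolding P_def using i by (intro card_walks_new_labels[OF l T]) auto
    also have "\<dots> \<le> 2 ^ h * Suc ((h + m) * D) ^ h * n ^ Suc j"
    proof (intro mult_mono)
      have "((h + m) * D) ^ (h - i) \<le> Suc ((h + m) * D) ^ (h - i)" by (intro power_mono) auto
      also have "\<dots> \<le> Suc ((h + m) * D) ^ h" by (intro power_increasing) auto
      finally show "((h + m) * D) ^ (h - i) \<le> Suc ((h + m) * D) ^ h" .
      show "n ^ Suc i \<le> n ^ Suc j" using i n by (intro power_increasing) auto
    qed auto
    finally show "card (P i) \<le> 2 ^ h * Suc ((h + m) * D) ^ h * n ^ Suc j" .
  qed
  also have "\<dots> = Suc (min h j) * (2 ^ h * Suc ((h + m) * D) ^ h) * n ^ Suc j" by (simp add: algebra_simps)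
  also have "\<dots> \<le> walk_const h m D * n ^ Suc j"
    unfolding walk_const_def by (intro mult_right_mono) auto
  finally show ?thesis .
qed

section \<open>Pair-matched words and pair-labelled walks\<close>

lemma remdups_map_inj_on: "inj_on f (set xs) \<Longrightarrow> remdups (map f xs) = map f (remdups xs)"
  by (induction xs) (auto simp: inj_on_def)

lemma first_occurrences:
  "distinct (rev (remdups (rev xs)))" "set (rev (remdups (rev xs))) = set xs"
  "length (rev (remdups (rev xs))) = card (set xs)"
  by (simp_all add: length_remdups_card_conv)

text \<open>
  The canonical word of a list is obtained by numbering its entries in order of first occurrence.
\<close>

lemma is_word_relabelling:
  "\<exists>f. inj_on f (set xs) \<and> is_word (map f xs)"
proof -
  let ?r = "rev (remdups (rev xs))"
  have bij: "bij_betw (\<lambda>i. ?r ! i) {..<card (set xs)} (set xs)"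
    using first_occurrences[of xs] by (intro bij_betw_nth) auto
  define f where "f = the_inv_into {..<card (set xs)} (\<lambda>i. ?r ! i)"
  have bijf: "bij_betw f (set xs) {..<card (set xs)}"
    unfolding f_def by (rule bij_betw_the_inv_into[OF bij])
  then have inj: "inj_on f (set xs)" by (rule bij_betw_imp_inj_on)
  have "rev (remdups (rev (map f xs))) = map f ?r"
    using inj by (simp add: rev_map remdups_map_inj_on)
  also have "\<dots> = [0..<card (set xs)]"
  proof (rule nth_equalityI)
    fix i assume "i < length (map f ?r)"
    then have i: "i < card (set xs)" using first_occurrences(3)[of xs] by simp
    have "f (?r ! i) = i"
      unfolding f_def using bij i by (intro the_inv_into_f_f) (auto simp: bij_betw_def)
    then show "map f ?r ! i = [0..<card (set xs)] ! i" using i first_occurrences(3)[of xs] by simp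
  qed (use first_occurrences(3)[of xs] in simp)
  also have "card (set xs) = card (set (map f xs))" using inj by (simp add: card_image)
  finally show ?thesis using inj unfolding is_word_def by blast
qed

lemma is_word_unique:
  assumes w: "is_word w" "is_word (map f w)" and inj: "inj_on f (set w)"
  shows "map f w = w"
proof -
  have "rev (remdups (rev (map f w))) = map f (rev (remdups (rev w)))"
    using inj by (simp add: rev_map remdups_map_inj_on)
  then have "[0..<card (set w)] = map f [0..<card (set w)]"
    using w inj unfolding is_word_def by (simp add: card_image)
  moreover have "set w = {..<card (set w)}"
    using arg_cong[OF w(1)[unfolded is_word_def], of set] by (auto simp: atLeast0LessThan)
  ultimately have "f x = x" if "x \<in> set w" for x
    using that by (metis atLeast0LessThan map_eq_conv map_ident set_upt)
  then show ?thesis by (simp add: map_idI)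
qed

lemma map_factor:
  assumes len: "length xs = length ys"
    and eq: "\<And>i j. i < length xs \<Longrightarrow> j < length xs \<Longrightarrow> xs ! i = xs ! j \<longleftrightarrow> ys ! i = ys ! j"
  shows "\<exists>f. inj_on f (set xs) \<and> ys = map f xs"
proof -
  define f where "f x = ys ! (SOME i. i < length xs \<and> xs ! i = x)" for x
  have f: "f (xs ! i) = ys ! i" if "i < length xs" for i
  proof -
    let ?j = "SOME j. j < length xs \<and> xs ! j = xs ! i"
    have "?j < length xs \<and> xs ! ?j = xs ! i" by (rule someI[of _ i]) (use that in simp)
    then show ?thesis unfolding f_def using eq that by blast
  qed
  have "ys = map f xs" using f len by (intro nth_equalityI) auto
  moreover have "inj_on f (set xs)"
    by (auto simp: inj_on_def in_set_conv_nth f) (use eq in blast)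
  ultimately show ?thesis by blast
qed

definition closed_tri_walks :: "nat \<Rightarrow> nat \<Rightarrow> nat list set" where
  "closed_tri_walks n h = {v \<in> tri_walks n h. hd v = last v}"

definition pair_labelled :: "'b list \<Rightarrow> bool" where
  "pair_labelled xs \<longleftrightarrow> (\<forall>t\<in>set xs. count_list xs t = 2)"

text \<open>
  The condition that defines \<open>\<Pi>\<^sub>1\<^sup>*(w)\<close>: equal letters force equal labels, but distinct letters may share a
  label.
\<close>

definition obeys :: "nat list \<Rightarrow> 'b list \<Rightarrow> bool" where
  "obeys w xs \<longleftrightarrow> length xs = length w \<and>
     (\<forall>i<length w. \<forall>j<length w. w ! i = w ! j \<longrightarrow> xs ! i = xs ! j)"

abbreviation link0 :: "(nat \<Rightarrow> nat \<Rightarrow> nat \<Rightarrow> 't) \<Rightarrow> nat \<Rightarrow> nat \<Rightarrow> nat \<Rightarrow> 't" where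
  "link0 L n x y \<equiv> L n (Suc x) (Suc y)"

text \<open>
  The circuit \<open>\<pi>\<close> corresponds to the list of the vertices \<open>\<pi> 0 - 1, \<dots>, \<pi> h - 1\<close>.
\<close>

lemma card_Pi1_star_eq:
  fixes L :: "nat \<Rightarrow> nat \<Rightarrow> nat \<Rightarrow> int ^ 'd"
  shows "card (Pi1_star L n w) = card {v \<in> closed_tri_walks n (length w). obeys w (steps (link0 L n) v)}"
proof -
  let ?h = "length w"
  let ?B = "{v \<in> closed_tri_walks n ?h. obeys w (steps (link0 L n) v)}"
  let ?f = "\<lambda>\<pi>. map (\<lambda>i. \<pi> i - 1) [0..<Suc ?h]"
  let ?g = "\<lambda>v. restrict (\<lambda>i. Suc (v ! i)) {0..?h}"
  have "bij_betw ?f (Pi1_star L n w) ?B"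
  proof (rule bij_betw_byWitness[where f' = ?g])
    show "\<forall>\<pi>\<in>Pi1_star L n w. ?g (?f \<pi>) = \<pi>"
    proof
      fix \<pi> assume p: "\<pi> \<in> Pi1_star L n w"
      then have "\<pi> \<in> {0..?h} \<rightarrow>\<^sub>E {1..n}" by (simp add: Pi1_star_def circuits_def)
      then show "?g (?f \<pi>) = \<pi>"
        by (intro ext) (auto simp: PiE_def extensional_def Pi_def restrict_def simp del: upt_Suc)
    qed
    show "\<forall>v\<in>?B. ?f (?g v) = v"
      by (auto simp: closed_tri_walks_def tri_walks_def intro!: nth_equalityI simp del: upt_Suc)
    show "?f ` Pi1_star L n w \<subseteq> ?B"
    proof safe
      fix \<pi> assume p: "\<pi> \<in> Pi1_star L n w"
      then have c: "\<And>i. i \<le> ?h \<Longrightarrow> 1 \<le> \<pi> i \<and> \<pi> i \<le> n" "\<pi> 0 = \<pi> ?h"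
        by (auto simp: Pi1_star_def circuits_def PiE_def Pi_def)
      have t: "\<pi> i + \<pi> (Suc i) \<le> n + 1" if "i < ?h" for i
        using p that unfolding Pi1_star_def by (auto dest!: bspec[of _ _ "Suc i"])
      have w: "L n (\<pi> i) (\<pi> (Suc i)) = L n (\<pi> j) (\<pi> (Suc j))" if "i < ?h" "j < ?h" "w ! i = w ! j" for i j
      proof -
        have "\<forall>i\<in>{1..?h}. \<forall>j\<in>{1..?h}. w ! (i - 1) = w ! (j - 1) \<longrightarrow>
            L n (\<pi> (i - 1)) (\<pi> i) = L n (\<pi> (j - 1)) (\<pi> j)"
          using p unfolding Pi1_star_def by blast
        from this[rule_format, of "Suc i" "Suc j"] that show ?thesis by simp
      qed
      have nz: "Suc (\<pi> i - Suc 0) = \<pi> i" if "i \<le> ?h" for i using c(1)[OF that] by simp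
      have "successively (\<lambda>x y. x + y < n) (?f \<pi>)"
        unfolding successively_conv_nth
      proof (intro allI impI)
        fix i assume "Suc i < length (?f \<pi>)"
        then have "i < ?h" by simp
        then show "?f \<pi> ! i + ?f \<pi> ! Suc i < n"
          using t[of i] c(1)[of i] c(1)[of "Suc i"] by (simp del: upt_Suc)
      qed
      moreover have "set (?f \<pi>) \<subseteq> {..<n}"
      proof
        fix x assume "x \<in> set (?f \<pi>)"
        then obtain i where "i \<le> ?h" "x = \<pi> i - 1" by (auto simp: less_Suc_eq_le simp del: upt_Suc)
        then show "x \<in> {..<n}" using c(1)[of i] by auto
      qed
      moreover have "hd (?f \<pi>) = \<pi> 0 - 1" by (simp add: upt_conv_Cons del: upt_Suc)
      moreover have "last (?f \<pi>) = \<pi> ?h - 1" by simp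
      ultimately show "?f \<pi> \<in> closed_tri_walks n ?h"
        using c(2) by (simp add: closed_tri_walks_def tri_walks_def del: upt_Suc)
      show "obeys w (steps (link0 L n) (?f \<pi>))"
        unfolding obeys_def
      proof (intro conjI allI impI)
        fix i j assume ij: "i < ?h" "j < ?h" "w ! i = w ! j"
        then show "steps (link0 L n) (?f \<pi>) ! i = steps (link0 L n) (?f \<pi>) ! j"
          using w[OF ij] nz[of i] nz[of "Suc i"] nz[of j] nz[of "Suc j"] by (simp add: nth_steps del: upt_Suc)
      qed simp
    qed
    show "?g ` ?B \<subseteq> Pi1_star L n w"
    proof safe
      fix v assume v: "v \<in> closed_tri_walks n ?h" and o: "obeys w (steps (link0 L n) v)"
      have len: "length v = Suc ?h" and S: "set v \<subseteq> {..<n}" and hl: "hd v = last v"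
        and s: "\<And>i. i < ?h \<Longrightarrow> v ! i + v ! Suc i < n"
        using v by (auto simp: closed_tri_walks_def tri_walks_def successively_conv_nth)
      have lt: "v ! i < n" if "i \<le> ?h" for i using S len that by (auto simp: subset_iff)
      have eq: "v ! 0 = v ! ?h" using hl len
        by (metis Zero_not_Suc diff_Suc_1 hd_conv_nth last_conv_nth list.size(3))
      show "?g v \<in> Pi1_star L n w"
        unfolding Pi1_star_def circuits_def mem_Collect_eq
      proof (intro conjI ballI impI)
        show "?g v \<in> {0..?h} \<rightarrow>\<^sub>E {1..n}" using lt by (auto simp: PiE_def Pi_def Suc_le_eq)
        show "?g v 0 = ?g v ?h" using eq by simp
        fix i assume i: "i \<in> {1..?h}"
        then obtain i' where i': "i = Suc i'" "i' < ?h" by (cases i) auto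
        show "?g v (i - 1) + ?g v i \<le> n + 1" using s[of i'] i' by simp
        fix j assume j: "j \<in> {1..?h}" and e: "w ! (i - 1) = w ! (j - 1)"
        then obtain j' where j': "j = Suc j'" "j' < ?h" by (cases j) auto
        show "L n (?g v (i - 1)) (?g v i) = L n (?g v (j - 1)) (?g v j)"
        proof -
          have "steps (link0 L n) v ! i' = steps (link0 L n) v ! j'"
          proof -
            have "\<forall>i<?h. \<forall>j<?h. w ! i = w ! j \<longrightarrow> steps (link0 L n) v ! i = steps (link0 L n) v ! j"
              using o unfolding obeys_def by blast
            moreover have "w ! i' = w ! j'" using e i' j' by simp
            ultimately show ?thesis using i' j' by blast
          qed
          then show ?thesis using i' j' len by (simp add: nth_steps)
        qed
      qed
    qed
  qed
  then show ?thesis by (rule bij_betw_same_card)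
qed

lemma count_list_eq_card: "count_list xs t = card {i. i < length xs \<and> xs ! i = t}"
proof -
  have "count_list xs t = length (filter (\<lambda>x. x = t) xs)"
    by (induction xs) auto
  then show ?thesis by (simp add: length_filter_conv_card)
qed

lemma count_list_map_inj_on:
  "inj_on f (insert x (set xs)) \<Longrightarrow> count_list (map f xs) (f x) = count_list xs x"
  by (induction xs) (auto simp: inj_on_def)

lemma obeysD: "obeys w xs \<Longrightarrow> i < length w \<Longrightarrow> j < length w \<Longrightarrow> w ! i = w ! j \<Longrightarrow> xs ! i = xs ! j"
  unfolding obeys_def by blast

lemma pair_labelledD: "pair_labelled xs \<Longrightarrow> i < length xs \<Longrightarrow> card {j. j < length xs \<and> xs ! j = xs ! i} = 2"
  unfolding pair_labelled_def count_list_eq_card using nth_mem by blast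

lemma length_eq_sum_count: "length xs = (\<Sum>t\<in>set xs. count_list xs t)"
  by (simp add: sum_count_set)

lemma length_pair_labelled: "pair_labelled xs \<Longrightarrow> length xs = 2 * card (set xs)"
  unfolding length_eq_sum_count by (simp add: pair_labelled_def)

text \<open>
  A word is determined by the partition of the positions into classes of equal letters.
\<close>

lemma pair_labelled_obeys_unique_word:
  assumes p: "pair_labelled xs" and len: "length xs = 2 * k"
  shows "\<exists>!w. w \<in> pair_matched_words (2 * k) \<and> obeys w xs"
proof -
  obtain f where f: "inj_on f (set xs)" "is_word (map f xs)" using is_word_relabelling by blast
  let ?w = "map f xs"
  have pm: "?w \<in> pair_matched_words (2 * k)"
    using f p len by (auto simp: pair_matched_words_def pair_matched_def pair_labelled_def count_list_map_inj_on insert_absorb)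
  have ow: "obeys ?w xs"
    unfolding obeys_def using f(1) by (auto simp: inj_on_def)
  show ?thesis
  proof (rule ex1I[of _ ?w])
    fix w assume w: "w \<in> pair_matched_words (2 * k) \<and> obeys w xs"
    then have lw: "length w = 2 * k" and wp: "pair_labelled w" and ww: "is_word w"
      by (auto simp: pair_matched_words_def pair_matched_def pair_labelled_def)
    have sub: "w ! i = w ! j \<Longrightarrow> xs ! i = xs ! j" if "i < 2 * k" "j < 2 * k" for i j
      using obeysD[of w xs i j] w that lw by simp
    \<comment> \<open>both equivalence relations have classes of size two, so the finer one is not strictly finer\<close>
    have eq: "xs ! i = xs ! j \<longleftrightarrow> w ! i = w ! j" if ij: "i < length xs" "j < length xs" for i j
    proof -
      have ij': "i < 2 * k" "j < 2 * k" using ij len by simp_all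
      have "card {j. j < 2 * k \<and> w ! j = w ! i} = 2" "card {j. j < 2 * k \<and> xs ! j = xs ! i} = 2"
        using pair_labelledD[OF wp, of i] pair_labelledD[OF p, of i] ij' lw len by simp_all
      moreover have "{j. j < 2 * k \<and> w ! j = w ! i} \<subseteq> {j. j < 2 * k \<and> xs ! j = xs ! i}"
        by (rule Collect_mono) (use sub ij' in blast)
      ultimately have "{j. j < 2 * k \<and> w ! j = w ! i} = {j. j < 2 * k \<and> xs ! j = xs ! i}"
        by (intro card_subset_eq) simp_all
      then have "w ! j = w ! i \<longleftrightarrow> xs ! j = xs ! i" using ij' by blast
      then show ?thesis by metis
    qed
    have eq': "?w ! i = ?w ! j \<longleftrightarrow> w ! i = w ! j" if ij: "i < length ?w" "j < length ?w" for i j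
      using eq[of i j] ij f(1) by (simp add: inj_on_eq_iff)
    have "length ?w = length w" using lw len by simp
    from map_factor[OF this eq'] obtain g' where g': "inj_on g' (set ?w)" "w = map g' ?w" by blast
    then show "w = ?w" using is_word_unique[of ?w g'] f(2) ww by simp
  qed (use pm ow in simp)
qed

text \<open>
  Each label occurs at least twice, and one of them occurs more often, so there are fewer than \<open>k\<close> labels on
  \<open>2k\<close> positions.
\<close>

lemma obeys_card_labels:
  assumes w: "w \<in> pair_matched_words (2 * k)" and o: "obeys w xs" and np: "\<not> pair_labelled xs"
  shows "card (set xs) < k"
proof -
  have lw: "length w = 2 * k" and wp: "pair_labelled w"
    using w by (auto simp: pair_matched_words_def pair_matched_def pair_labelled_def)
  have lx: "length xs = 2 * k" using o lw unfolding obeys_def by metis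
  have "count_list xs t \<ge> 2" if "t \<in> set xs" for t
  proof -
    from in_set_conv_nth[THEN iffD1, OF that] obtain i where i: "i < 2 * k" "xs ! i = t"
      unfolding lx by blast
    have "card {j. j < 2 * k \<and> w ! j = w ! i} = 2"
      using pair_labelledD[OF wp, of i] lw i by simp
    moreover have "{j. j < 2 * k \<and> w ! j = w ! i} \<subseteq> {j. j < 2 * k \<and> xs ! j = t}"
      by (rule Collect_mono) (use obeysD[OF o] i lw in metis)
    then have "card {j. j < 2 * k \<and> w ! j = w ! i} \<le> card {j. j < 2 * k \<and> xs ! j = t}"
      by (intro card_mono) auto
    ultimately show ?thesis unfolding count_list_eq_card lx by simp
  qed
  moreover obtain t where "t \<in> set xs" "count_list xs t \<noteq> 2" using np by (auto simp: pair_labelled_def)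
  ultimately have "(\<Sum>t\<in>set xs. 2) < (\<Sum>t\<in>set xs. count_list xs t)"
    by (intro sum_strict_mono_ex1) (auto intro!: bexI[of _ t] simp: le_neq_implies_less)
  then show ?thesis unfolding length_eq_sum_count[symmetric] lx by simp
qed

definition pair_walks :: "nat \<Rightarrow> (nat \<Rightarrow> nat \<Rightarrow> 't) \<Rightarrow> nat \<Rightarrow> nat list set" where
  "pair_walks n l h = {v \<in> closed_tri_walks n h. pair_labelled (steps l v)}"

lemma finite_closed_tri_walks: "finite (closed_tri_walks n h)"
  by (simp add: closed_tri_walks_def finite_tri_walks)

lemma length_closed: "v \<in> closed_tri_walks n h \<Longrightarrow> length v = Suc h"
  by (simp add: closed_tri_walks_def tri_walks_def)

lemma steps_length_closed: "v \<in> closed_tri_walks n h \<Longrightarrow> length (steps l v) = h"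
  by (simp add: closed_tri_walks_def tri_walks_def)

text \<open>
  Each pair-labelled walk obeys exactly one pair-matched word. Conversely, a walk that obeys a word but is
  not pair-labelled has fewer than \<open>k\<close> labels, and there are only \<open>O(n\<^sup>k)\<close> such walks.
\<close>

lemma sum_card_Pi1_star_bounds:
  fixes L :: "nat \<Rightarrow> nat \<Rightarrow> nat \<Rightarrow> int ^ 'd"
  assumes l: "thin_link n (link0 L n) D" and n: "n > 0" and k: "k \<ge> 1"
  shows "card (pair_walks n (link0 L n) (2 * k)) \<le> (\<Sum>w\<in>pair_matched_words (2 * k). card (Pi1_star L n w))"
    "(\<Sum>w\<in>pair_matched_words (2 * k). card (Pi1_star L n w)) \<le> card (pair_walks n (link0 L n) (2 * k))
       + card (pair_matched_words (2 * k)) * (walk_const (2 * k) 0 D * n ^ k)"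
proof -
  let ?W = "pair_matched_words (2 * k)" and ?lab = "steps (link0 L n)"
  let ?P = "pair_walks n (link0 L n) (2 * k)"
  let ?O = "\<lambda>w. {v \<in> closed_tri_walks n (2 * k). obeys w (?lab v)}"
  let ?A = "\<lambda>w. {v \<in> ?P. obeys w (?lab v)}"
  have card_Pi: "card (Pi1_star L n w) = card (?O w)" if "w \<in> ?W" for w
    using that card_Pi1_star_eq[of L n w] by (simp add: pair_matched_words_def)
  have lenP: "length (?lab v) = 2 * k" if "v \<in> ?P" for v
    using that by (simp add: pair_walks_def closed_tri_walks_def tri_walks_def)
  have finP: "finite ?P" by (simp add: pair_walks_def finite_closed_tri_walks)
  have un: "\<exists>!w. w \<in> ?W \<and> obeys w (?lab v)" if "v \<in> ?P" for v
    by (rule pair_labelled_obeys_unique_word) (use that lenP in \<open>auto simp: pair_walks_def\<close>)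
  have "?P = (\<Union>w\<in>?W. ?A w)" using un by blast
  then have "card ?P = card (\<Union>w\<in>?W. ?A w)" by (rule arg_cong)
  moreover have "card (\<Union>w\<in>?W. ?A w) = (\<Sum>w\<in>?W. card (?A w))"
    by (rule card_UN_disjoint) (use finite_pair_matched_words finP un in auto)
  ultimately have cP: "card ?P = (\<Sum>w\<in>?W. card (?A w))" by (rule trans)
  show "card ?P \<le> (\<Sum>w\<in>?W. card (Pi1_star L n w))"
  proof (subst cP, rule sum_mono)
    fix w assume "w \<in> ?W"
    then show "card (?A w) \<le> card (Pi1_star L n w)"
      unfolding card_Pi[OF \<open>w \<in> ?W\<close>]
      by (intro card_mono) (auto simp: pair_walks_def finite_closed_tri_walks)
  qed
  have "(\<Sum>w\<in>?W. card (Pi1_star L n w)) \<le> (\<Sum>w\<in>?W. card (?A w) + walk_const (2 * k) 0 D * n ^ k)"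
  proof (rule sum_mono)
    fix w assume w: "w \<in> ?W"
    let ?F = "{v \<in> tri_walks n (2 * k). card (set (?lab v) - {}) \<le> k - 1}"
    have "?O w \<subseteq> ?A w \<union> ?F"
      using obeys_card_labels[OF w] by (force simp: pair_walks_def closed_tri_walks_def)
    then have "card (?O w) \<le> card (?A w \<union> ?F)"
      by (intro card_mono) (use finP finite_tri_walks in auto)
    also have "\<dots> \<le> card (?A w) + card ?F" by (rule card_Un_le)
    also have "card ?F \<le> walk_const (2 * k) 0 D * n ^ Suc (k - 1)"
      by (rule card_walks_few_new_labels[OF l _ _ n]) auto
    finally show "card (Pi1_star L n w) \<le> card (?A w) + walk_const (2 * k) 0 D * n ^ k"
      unfolding card_Pi[OF w] using k by simp
  qed
  then show "(\<Sum>w\<in>?W. card (Pi1_star L n w)) \<le> card ?P + card ?W * (walk_const (2 * k) 0 D * n ^ k)"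
    unfolding sum.distrib cP[symmetric] by simp
qed

section \<open>Pairs of closed walks with a common label\<close>

lemma prod_list_map_eq_prod_count:
  fixes f :: "'t \<Rightarrow> 'b::comm_monoid_mult"
  shows "(\<Prod>t\<leftarrow>xs. f t) = (\<Prod>t\<in>set xs. f t ^ count_list xs t)"
proof (induction xs)
  case (Cons x xs)
  have *: "(\<Prod>t\<in>set xs - {x}. f t ^ count_list (x # xs) t) = (\<Prod>t\<in>set xs - {x}. f t ^ count_list xs t)"
    by (rule prod.cong) auto
  have "(\<Prod>t\<in>set (x # xs). f t ^ count_list (x # xs) t)
      = f x ^ count_list (x # xs) x * (\<Prod>t\<in>set (x # xs) - {x}. f t ^ count_list (x # xs) t)"
    by (rule prod.remove) auto
  also have "set (x # xs) - {x} = set xs - {x}" by auto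
  also have "f x ^ count_list (x # xs) x * (\<Prod>t\<in>set xs - {x}. f t ^ count_list (x # xs) t)
     = f x * (f x ^ count_list xs x * (\<Prod>t\<in>set xs - {x}. f t ^ count_list xs t))"
    unfolding * by (simp add: mult.assoc)
  also have "f x ^ count_list xs x * (\<Prod>t\<in>set xs - {x}. f t ^ count_list xs t) = (\<Prod>t\<in>set xs. f t ^ count_list xs t)"
  proof (cases "x \<in> set xs")
    case True
    then show ?thesis by (subst (2) prod.remove[of _ x]) auto
  next
    case False
    then have "set xs - {x} = set xs" by auto
    then show ?thesis using False by (simp add: count_list_0_iff)
  qed
  finally show ?case using Cons.IH by simp
qed simp

lemma steps_append: "v \<noteq> [] \<Longrightarrow> w \<noteq> [] \<Longrightarrow> steps f (v @ w) = steps f v @ f (last v) (hd w) # steps f w"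
proof (induction v)
  case (Cons x v)
  then show ?case by (cases v) (auto simp: steps_Cons)
qed simp

lemma steps_append_overlap: "v \<noteq> [] \<Longrightarrow> steps f (v @ w) = steps f v @ steps f (last v # w)"
proof (cases "w = []")
  case False
  assume "v \<noteq> []"
  then show ?thesis using False by (simp add: steps_append steps_Cons)
qed simp

text \<open>
  A closed walk can be opened at any of its steps: rotate it so that this step closes the walk, and drop the
  step. The dropped step is determined by the remaining open walk.
\<close>

lemma open_closed_walk:
  assumes v: "v \<in> closed_tri_walks n h" and i: "i < h"
  defines "u \<equiv> drop (Suc i) v @ tl (take (Suc i) v)"
  shows "u \<in> tri_walks n (h - 1)" "v = (last (take (h - i) u) # drop (h - i) u) @ take (h - i) u"
    "mset (steps l v) = add_mset (steps l v ! i) (mset (steps l u))"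
proof -
  define p where "p = take (Suc i) v"
  define q where "q = drop (Suc i) v"
  have len: "length v = Suc h" and S: "set v \<subseteq> {..<n}" and hl: "hd v = last v"
    and tri: "successively (\<lambda>x y. x + y < n) v"
    using v by (auto simp: closed_tri_walks_def tri_walks_def)
  have v_pq: "v = p @ q" by (simp add: p_def q_def)
  have lp: "length p = Suc i" and lq: "length q = h - i" using len i by (auto simp: p_def q_def)
  have q: "q \<noteq> []" using lq i by auto
  obtain a r where p: "p = a # r" using lp by (cases p) auto
  have a: "a = last q" using hl q unfolding v_pq p by simp
  have u: "u = q @ r" unfolding u_def p_def[symmetric] q_def[symmetric] p by simp
  have tri': "successively (\<lambda>x y. x + y < n) (a # r)" "successively (\<lambda>x y. x + y < n) q"
    using tri unfolding v_pq p successively_append_iff by auto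
  have "successively (\<lambda>x y. x + y < n) u"
    unfolding u successively_append_iff using tri' a by (auto simp: successively_Cons)
  moreover have "length u = Suc (h - 1)" using lp lq i unfolding u p by simp
  moreover have "set u \<subseteq> {..<n}" using S unfolding u v_pq p by auto
  ultimately show "u \<in> tri_walks n (h - 1)" by (simp add: tri_walks_def)
  show "v = (last (take (h - i) u) # drop (h - i) u) @ take (h - i) u"
    unfolding u v_pq p using lq a by simp
  have su: "steps l u = steps l q @ steps l p"
    unfolding u using steps_append_overlap[OF q, of l r] by (simp add: p a)
  have sv: "steps l v = steps l p @ l (last p) (hd q) # steps l q"
    unfolding v_pq using q p by (intro steps_append) auto
  have "steps l v ! i = l (last p) (hd q)" unfolding sv using lp by (simp add: nth_append)
  then show "mset (steps l v) = add_mset (steps l v ! i) (mset (steps l u))"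
    unfolding su by (simp add: sv)
qed

lemma count_list_mset: "count_list xs t = count (mset xs) t"
  by (induction xs) auto

text \<open>
  Opening the walk at a step whose label occurs only there leaves an open walk with one label less. So the
  exponent is \<open>j\<close> instead of the \<open>Suc j\<close> that holds for walks with \<open>j\<close> labels in general.
\<close>

lemma card_closed_walks_single_label:
  assumes l: "thin_link n l D" and n: "n > 0" and j: "j \<ge> 1"
  shows "card {v \<in> closed_tri_walks n h. card (set (steps l v)) = j \<and> (\<exists>t\<in>set (steps l v). count_list (steps l v) t = 1)}
    \<le> h * (walk_const (h - 1) 0 D * n ^ j)"
proof -
  define B where "B i = {v \<in> closed_tri_walks n h. card (set (steps l v)) = j \<and> count_list (steps l v) (steps l v ! i) = 1}" for i
  let ?Q = "{v \<in> tri_walks n (h - 1). card (set (steps l v) - {}) \<le> j - 1}"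
  have card_B: "card (B i) \<le> walk_const (h - 1) 0 D * n ^ j" if i: "i < h" for i
  proof -
    let ?f = "\<lambda>v. drop (Suc i) v @ tl (take (Suc i) v)"
    let ?g = "\<lambda>u. (last (take (h - i) u) # drop (h - i) u) @ take (h - i) u"
    have inj: "inj_on ?f (B i)"
    proof (rule inj_on_inverseI[of _ ?g])
      fix v assume "v \<in> B i"
      then have "v \<in> closed_tri_walks n h" by (simp add: B_def)
      from open_closed_walk(2)[OF this i] show "?g (?f v) = v" by (rule sym)
    qed
    have "?f ` B i \<subseteq> ?Q"
    proof
      fix u assume "u \<in> ?f ` B i"
      then obtain v where v: "v \<in> B i" and u: "u = ?f v" by blast
      have vc: "v \<in> closed_tri_walks n h" using v by (simp add: B_def)
      note o = open_closed_walk[OF vc i, folded u]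
      let ?t = "steps l v ! i"
      have "?t \<notin> set (steps l u)"
      proof
        assume "?t \<in> set (steps l u)"
        then have "count (mset (steps l u)) ?t > 0" by (simp add: count_mset_0_iff neq0_conv[symmetric] del: neq0_conv)
        then have "count (mset (steps l v)) ?t > 1" unfolding o(3)[of l] by simp
        then show False using v by (simp add: B_def count_list_mset)
      qed
      moreover have "set (steps l v) = insert ?t (set (steps l u))"
        using arg_cong[OF o(3)[of l], of set_mset] by simp
      ultimately have "card (set (steps l u)) = j - 1" using v by (auto simp: B_def)
      then show "u \<in> ?Q" using o(1) by simp
    qed
    then have "card (B i) \<le> card ?Q" using inj by (intro card_inj_on_le[of ?f]) (auto simp: finite_tri_walks)
    also have "\<dots> \<le> walk_const (h - 1) 0 D * n ^ Suc (j - 1)"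
      by (rule card_walks_few_new_labels[OF l _ _ n]) auto
    finally show ?thesis using j by simp
  qed
  have "{v \<in> closed_tri_walks n h. card (set (steps l v)) = j \<and> (\<exists>t\<in>set (steps l v). count_list (steps l v) t = 1)}
      \<subseteq> (\<Union>i<h. B i)"
  proof
    fix v assume v: "v \<in> {v \<in> closed_tri_walks n h. card (set (steps l v)) = j \<and> (\<exists>t\<in>set (steps l v). count_list (steps l v) t = 1)}"
    then obtain t where t: "t \<in> set (steps l v)" "count_list (steps l v) t = 1" by blast
    have "length (steps l v) = h" using v by (simp add: closed_tri_walks_def tri_walks_def)
    with t obtain i where "i < h" "steps l v ! i = t" unfolding in_set_conv_nth by auto
    then show "v \<in> (\<Union>i<h. B i)" using v t by (auto simp: B_def)
  qed
  then have "card {v \<in> closed_tri_walks n h. card (set (steps l v)) = j \<and> (\<exists>t\<in>set (steps l v). count_list (steps l v) t = 1)}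
      \<le> card (\<Union>i<h. B i)"
    by (rule card_mono[rotated]) (auto simp: B_def finite_closed_tri_walks)
  also have "\<dots> \<le> (\<Sum>i<h. card (B i))" by (rule card_UN_le) simp
  also have "\<dots> \<le> (\<Sum>i<h. walk_const (h - 1) 0 D * n ^ j)" by (intro sum_mono card_B) simp
  finally show ?thesis by simp
qed

text \<open>
  The pairs of walks whose contributions can be correlated.
\<close>

definition linked_pairs :: "nat \<Rightarrow> (nat \<Rightarrow> nat \<Rightarrow> 't) \<Rightarrow> nat \<Rightarrow> (nat list \<times> nat list) set" where
  "linked_pairs n l h = {(v, w) \<in> closed_tri_walks n h \<times> closed_tri_walks n h.
     set (steps l v) \<inter> set (steps l w) \<noteq> {} \<and>
     (\<forall>t\<in>set (steps l v @ steps l w). count_list (steps l v @ steps l w) t \<ge> 2)}"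

definition pair_const :: "nat \<Rightarrow> nat \<Rightarrow> nat" where
  "pair_const h D = 2 * (h * (h * walk_const (h - 1) 0 D * walk_const h h D)) + Suc h * (walk_const h 0 D * walk_const h h D)"

text \<open>
  Two unrelated walks with \<open>h\<close> labels in all could be chosen in about \<open>n\<^sup>h\<^sup>+\<^sup>2\<close> ways; a common label saves one
  factor \<open>n\<close>. If one of the walks has a label that it uses once, it is chosen first and opened at that
  step; otherwise the common label occurs at least four times in the two walks together, so that
  there are at most \<open>h - 1\<close> labels in all.
\<close>

lemma card_linked_pairs:
  fixes l :: "nat \<Rightarrow> nat \<Rightarrow> 't"
  assumes l: "thin_link n l D" and n: "n > 0"
  shows "card (linked_pairs n l h) \<le> pair_const h D * n ^ Suc h"
proof -
  let ?s = "steps l"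
  define single where "single v \<longleftrightarrow> (\<exists>t\<in>set (?s v). count_list (?s v) t = 1)" for v
  define new where "new v w = card (set (?s w) - set (?s v))" for v w
  define V where "V j = {v \<in> closed_tri_walks n h. card (set (?s v)) = j \<and> single v}" for j
  define U where "U j = {v \<in> tri_walks n h. card (set (?s v) - {}) \<le> j}" for j
  \<comment> \<open>the first walk has a label used once; the image of \<open>A\<close> under \<open>prod.swap\<close> covers the case that the second one has\<close>
  define A where "A = (\<Union>j\<in>{1..h}. SIGMA v:V j. {w \<in> tri_walks n h. new v w \<le> h - j})"
  \<comment> \<open>neither walk has a label used once\<close>
  define C where "C = (\<Union>j\<in>{..h-1}. SIGMA v:{v \<in> U j. card (set (?s v)) = j}. {w \<in> tri_walks n h. new v w \<le> h - 1 - j})"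
  have len: "length (?s v) = h" if "v \<in> closed_tri_walks n h" for v
    using that by (simp add: closed_tri_walks_def tri_walks_def)
  have cT: "closed_tri_walks n h \<subseteq> tri_walks n h" by (auto simp: closed_tri_walks_def)
  have finA: "finite A" and finC: "finite C"
    unfolding A_def C_def V_def U_def
    by (auto intro!: finite_SigmaI simp: finite_closed_tri_walks finite_tri_walks)
  have card_new: "card {w \<in> tri_walks n h. new v w \<le> i} \<le> walk_const h h D * n ^ Suc i" if "v \<in> tri_walks n h" for v i
    unfolding new_def
  proof (rule card_walks_few_new_labels[OF l _ _ n])
    show "card (set (?s v)) \<le> h" using card_length[of "?s v"] that by (simp add: tri_walks_def)
  qed simp
  have card_A: "card A \<le> h * (h * walk_const (h - 1) 0 D * walk_const h h D) * n ^ Suc h"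
  proof -
    have "card A \<le> (\<Sum>j\<in>{1..h}. card (SIGMA v:V j. {w \<in> tri_walks n h. new v w \<le> h - j}))"
      unfolding A_def by (rule card_UN_le) simp
    also have "\<dots> \<le> (\<Sum>j\<in>{1..h}. h * walk_const (h - 1) 0 D * walk_const h h D * n ^ Suc h)"
    proof (rule sum_mono)
      fix j assume j: "j \<in> {1..h}"
      have "card (SIGMA v:V j. {w \<in> tri_walks n h. new v w \<le> h - j}) = (\<Sum>v\<in>V j. card {w \<in> tri_walks n h. new v w \<le> h - j})"
        by (intro card_SigmaI) (auto simp: V_def finite_closed_tri_walks finite_tri_walks)
      also have "\<dots> \<le> (\<Sum>v\<in>V j. walk_const h h D * n ^ Suc (h - j))"
        by (intro sum_mono card_new) (use cT in \<open>auto simp: V_def\<close>)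
      also have "\<dots> = card (V j) * (walk_const h h D * n ^ Suc (h - j))" by simp
      also have "\<dots> \<le> (h * (walk_const (h - 1) 0 D * n ^ j)) * (walk_const h h D * n ^ Suc (h - j))"
        unfolding V_def single_def using j by (intro mult_right_mono card_closed_walks_single_label[OF l n]) auto
      also have "\<dots> = h * walk_const (h - 1) 0 D * walk_const h h D * (n ^ j * n ^ Suc (h - j))"
        by (simp only: mult_ac)
      also have "n ^ j * n ^ Suc (h - j) = n ^ Suc h"
        using j by (simp add: power_add[symmetric])
      finally show "card (SIGMA v:V j. {w \<in> tri_walks n h. new v w \<le> h - j})
        \<le> h * walk_const (h - 1) 0 D * walk_const h h D * n ^ Suc h" .
    qed
    finally show ?thesis by (simp add: mult_ac)
  qed
  have card_C: "card C \<le> Suc h * (walk_const h 0 D * walk_const h h D) * n ^ Suc h" if h: "h \<ge> 1"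
  proof -
    have "card C \<le> (\<Sum>j\<in>{..h-1}. card (SIGMA v:{v \<in> U j. card (set (?s v)) = j}. {w \<in> tri_walks n h. new v w \<le> h - 1 - j}))"
      unfolding C_def by (rule card_UN_le) simp
    also have "\<dots> \<le> (\<Sum>j\<in>{..h-1}. walk_const h 0 D * walk_const h h D * n ^ Suc h)"
    proof (rule sum_mono)
      fix j assume j: "j \<in> {..h-1}"
      let ?V = "{v \<in> U j. card (set (?s v)) = j}"
      have "card (SIGMA v:?V. {w \<in> tri_walks n h. new v w \<le> h - 1 - j}) = (\<Sum>v\<in>?V. card {w \<in> tri_walks n h. new v w \<le> h - 1 - j})"
        by (intro card_SigmaI) (auto simp: U_def finite_tri_walks)
      also have "\<dots> \<le> (\<Sum>v\<in>?V. walk_const h h D * n ^ Suc (h - 1 - j))"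
        by (intro sum_mono card_new) (auto simp: U_def)
      also have "\<dots> = card ?V * (walk_const h h D * n ^ Suc (h - 1 - j))" by simp
      also have "\<dots> \<le> card (U j) * (walk_const h h D * n ^ Suc (h - 1 - j))"
        by (intro mult_right_mono card_mono) (auto simp: U_def finite_tri_walks)
      also have "\<dots> \<le> (walk_const h 0 D * n ^ Suc j) * (walk_const h h D * n ^ Suc (h - 1 - j))"
        unfolding U_def by (intro mult_right_mono card_walks_few_new_labels[OF l _ _ n]) auto
      also have "\<dots> = walk_const h 0 D * walk_const h h D * (n ^ Suc j * n ^ Suc (h - 1 - j))"
        by (simp only: mult_ac)
      also have "n ^ Suc j * n ^ Suc (h - 1 - j) = n ^ (Suc j + Suc (h - 1 - j))"
        by (simp only: power_add)
      also have "Suc j + Suc (h - 1 - j) = Suc h" using j h by auto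
      finally show "card (SIGMA v:?V. {w \<in> tri_walks n h. new v w \<le> h - 1 - j})
        \<le> walk_const h 0 D * walk_const h h D * n ^ Suc h" .
    qed
    also have "\<dots> = h * (walk_const h 0 D * walk_const h h D) * n ^ Suc h" using h by (simp add: mult_ac)
    also have "\<dots> \<le> Suc h * (walk_const h 0 D * walk_const h h D) * n ^ Suc h" by (intro mult_right_mono) auto
    finally show ?thesis .
  qed
  have sub: "linked_pairs n l h \<subseteq> A \<union> prod.swap ` A \<union> C"
  proof safe
    fix v w assume vw: "(v, w) \<in> linked_pairs n l h" and nC: "(v, w) \<notin> C" and nA: "(v, w) \<notin> prod.swap ` A"
    have v: "v \<in> closed_tri_walks n h" and w: "w \<in> closed_tri_walks n h"
      and ne: "set (?s v) \<inter> set (?s w) \<noteq> {}"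
      and two: "\<And>t. t \<in> set (?s v) \<union> set (?s w) \<Longrightarrow> count_list (?s v @ ?s w) t \<ge> 2"
      using vw by (auto simp: linked_pairs_def)
    let ?T = "set (?s v) \<union> set (?s w)"
    have sumc: "(\<Sum>t\<in>?T. count_list (?s v @ ?s w) t) = 2 * h"
      using length_eq_sum_count[of "?s v @ ?s w"] len[OF v] len[OF w] by simp
    have "(\<Sum>t\<in>?T. 2) \<le> (\<Sum>t\<in>?T. count_list (?s v @ ?s w) t)" by (intro sum_mono two)
    then have cT': "card ?T \<le> h" unfolding sumc by simp
    have T1: "card ?T = card (set (?s v)) + new v w"
    proof -
      have "?T = set (?s v) \<union> (set (?s w) - set (?s v))" by auto
      then show ?thesis unfolding new_def by (metis Diff_disjoint card_Un_disjoint finite_Diff finite_set)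
    qed
    have T2: "card ?T = card (set (?s w)) + new w v"
    proof -
      have "?T = set (?s w) \<union> (set (?s v) - set (?s w))" by auto
      then show ?thesis unfolding new_def by (metis Diff_disjoint card_Un_disjoint finite_Diff finite_set)
    qed
    have pos: "card (set (?s v)) \<ge> 1" "card (set (?s w)) \<ge> 1"
      using ne by (auto simp: Suc_le_eq card_gt_0_iff)
    show "(v, w) \<in> A"
    proof (cases "single v")
      case True
      have "card (set (?s v)) \<in> {1..h}" using pos cT' T1 by auto
      moreover have "v \<in> V (card (set (?s v)))" using True v by (simp add: V_def)
      moreover have "w \<in> {w \<in> tri_walks n h. new v w \<le> h - card (set (?s v))}" using cT w cT' T1 by auto
      ultimately show ?thesis unfolding A_def by blast
    next
      case nv: False
      show ?thesis
      proof (cases "single w")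
        case True
        have "card (set (?s w)) \<in> {1..h}" using pos cT' T2 by auto
        moreover have "w \<in> V (card (set (?s w)))" using True w by (simp add: V_def)
        moreover have "v \<in> {v \<in> tri_walks n h. new w v \<le> h - card (set (?s w))}" using cT v cT' T2 by auto
        ultimately have "(w, v) \<in> A" unfolding A_def by blast
        then show ?thesis using nA by force
      next
        case nw: False
        obtain t where t: "t \<in> set (?s v)" "t \<in> set (?s w)" using ne by blast
        have "count_list (?s v) t \<ge> 2" "count_list (?s w) t \<ge> 2"
          using nv nw t count_list_0_iff[of "?s v" t] count_list_0_iff[of "?s w" t]
          unfolding single_def by (metis One_nat_def Suc_leI le_neq_implies_less neq0_conv numeral_2_eq_2)+
        then have c4: "count_list (?s v @ ?s w) t \<ge> 2 + 2" by simp
        have "(\<Sum>s\<in>?T. 2 + (if s = t then 2 else 0)) \<le> (\<Sum>t\<in>?T. count_list (?s v @ ?s w) t)"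
        proof (rule sum_mono)
          fix s assume "s \<in> ?T"
          then show "2 + (if s = t then 2 else 0) \<le> count_list (?s v @ ?s w) s"
            using two[of s] c4 by (cases "s = t") auto
        qed
        moreover have "(\<Sum>s\<in>?T. 2 + (if s = t then 2 else 0)) = 2 * card ?T + (2::nat)"
          using t unfolding sum.distrib by simp
        ultimately have "2 * card ?T + 2 \<le> 2 * h" unfolding sumc by simp
        then have "card (set (?s v)) + new v w + 1 \<le> h" unfolding T1 by simp
        then have "card (set (?s v)) \<in> {..h-1}" "new v w \<le> h - 1 - card (set (?s v))" by auto
        moreover have "v \<in> {v' \<in> U (card (set (?s v))). card (set (?s v')) = card (set (?s v))}" using v cT by (auto simp: U_def)
        moreover have "w \<in> tri_walks n h" using w cT by auto
        ultimately have "(v, w) \<in> C" unfolding C_def by blast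
        then show ?thesis using nC by blast
      qed
    qed
  qed
  show ?thesis
  proof (cases "h = 0")
    case True
    have "linked_pairs n l h = {}"
    proof -
      have "?s v = []" if "v \<in> closed_tri_walks n h" for v
        using len[OF that] unfolding True by (simp only: length_0_conv)
      then show ?thesis by (auto simp: linked_pairs_def)
    qed
    then show ?thesis by simp
  next
    case False
    have "card (linked_pairs n l h) \<le> card (A \<union> prod.swap ` A \<union> C)"
      using sub finA finC by (intro card_mono) auto
    also have "\<dots> \<le> card (A \<union> prod.swap ` A) + card C" by (rule card_Un_le)
    also have "card (A \<union> prod.swap ` A) \<le> card A + card (prod.swap ` A)" by (rule card_Un_le)
    also have "card (prod.swap ` A) \<le> card A" using finA by (rule card_image_le)
    finally have "card (linked_pairs n l h) \<le> 2 * card A + card C" by simp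
    also have "\<dots> \<le> 2 * (h * (h * walk_const (h - 1) 0 D * walk_const h h D) * n ^ Suc h)
       + Suc h * (walk_const h 0 D * walk_const h h D) * n ^ Suc h"
      using card_A card_C False by (intro add_mono mult_left_mono) auto
    also have "\<dots> = pair_const h D * n ^ Suc h"
      unfolding pair_const_def distrib_right by (simp only: mult.assoc)
    finally show ?thesis .
  qed
qed

section \<open>Mean and variance of the traces for bounded inputs\<close>

locale bounded_input = prob_space M for M :: "'a measure" +
  fixes z :: "'t \<Rightarrow> 'a \<Rightarrow> real" and K :: real
  assumes indep: "indep_vars (\<lambda>_. borel) z UNIV"
    and bounded: "\<And>t \<omega>. \<omega> \<in> space M \<Longrightarrow> \<bar>z t \<omega>\<bar> \<le> K"
    and mean: "\<And>t. expectation (z t) = 0"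
    and second: "\<And>t. expectation (\<lambda>\<omega>. (z t \<omega>)\<^sup>2) = 1"
begin

lemma rv [measurable]: "random_variable borel (z t)"
  using indep unfolding indep_vars_def by auto

lemma K_ge_1: "1 \<le> K"
proof -
  obtain \<omega> where "\<omega> \<in> space M" using not_empty by blast
  then have K0: "0 \<le> K" using bounded[of \<omega>] abs_ge_zero order_trans by blast
  have "expectation (\<lambda>\<omega>. (z t \<omega>)\<^sup>2) \<le> K\<^sup>2" for t
  proof (rule integral_le_const)
    show "AE \<omega> in M. (z t \<omega>)\<^sup>2 \<le> K\<^sup>2"
      using bounded K0 by (intro AE_I2) (simp add: abs_le_square_iff[symmetric])
    show "integrable M (\<lambda>\<omega>. (z t \<omega>)\<^sup>2)"
      by (rule integrable_const_bound[of _ "K\<^sup>2"])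
        (use bounded K0 in \<open>auto simp: abs_le_square_iff[symmetric]\<close>)
  qed
  then have "1\<^sup>2 \<le> K\<^sup>2" using second by simp
  then show ?thesis using K0 power2_le_imp_le by blast
qed

lemma integrable_power: "integrable M (\<lambda>\<omega>. z t \<omega> ^ r)"
  by (rule integrable_const_bound[of _ "K ^ r"])
    (use bounded in \<open>auto simp: power_abs intro!: power_mono\<close>)

definition word_prod :: "'t list \<Rightarrow> 'a \<Rightarrow> real" where
  "word_prod xs \<omega> = (\<Prod>t\<leftarrow>xs. z t \<omega>)"

lemma word_prod_append: "word_prod (xs @ ys) \<omega> = word_prod xs \<omega> * word_prod ys \<omega>"
  by (simp add: word_prod_def)

lemma word_prod_bound: "\<omega> \<in> space M \<Longrightarrow> \<bar>word_prod xs \<omega>\<bar> \<le> K ^ length xs"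
proof (induction xs)
  case (Cons t xs)
  then have "\<bar>z t \<omega>\<bar> * \<bar>word_prod xs \<omega>\<bar> \<le> K * K ^ length xs"
    using bounded K_ge_1 by (intro mult_mono) auto
  then show ?case by (simp add: word_prod_def abs_mult)
qed (simp add: word_prod_def)

lemma word_prod_measurable [measurable]: "random_variable borel (word_prod xs)"
  unfolding word_prod_def[abs_def] prod_list_map_eq_prod_count by measurable

lemma integrable_word_prod: "integrable M (word_prod xs)"
  by (rule integrable_const_bound[of _ "K ^ length xs"]) (use word_prod_bound in auto)

lemma expectation_word_prod:
  "expectation (word_prod xs) = (\<Prod>t\<in>set xs. expectation (\<lambda>\<omega>. z t \<omega> ^ count_list xs t))"
proof -
  have "indep_vars (\<lambda>_. borel) z (set xs)" using indep by (rule indep_vars_subset) auto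
  from indep_vars_compose2[OF this, of "\<lambda>t y. y ^ count_list xs t" "\<lambda>_. borel"]
  have "indep_vars (\<lambda>_. borel) (\<lambda>t \<omega>. z t \<omega> ^ count_list xs t) (set xs)" by simp
  then show ?thesis
    unfolding word_prod_def[abs_def] prod_list_map_eq_prod_count
    by (intro indep_vars_lebesgue_integral integrable_power) auto
qed

lemma abs_expectation_word_prod: "\<bar>expectation (word_prod xs)\<bar> \<le> K ^ length xs"
proof -
  have "\<bar>expectation (word_prod xs)\<bar> \<le> expectation (\<lambda>\<omega>. \<bar>word_prod xs \<omega>\<bar>)" by (rule integral_abs_bound)
  also have "\<dots> \<le> K ^ length xs"
    by (rule integral_le_const) (use integrable_word_prod word_prod_bound in \<open>auto intro: AE_I2\<close>)
  finally show ?thesis .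
qed

lemma expectation_word_prod_single:
  assumes "t \<in> set xs" "count_list xs t = 1"
  shows "expectation (word_prod xs) = 0"
  unfolding expectation_word_prod using assms mean by (intro prod_zero bexI[of _ t]) auto

lemma expectation_word_prod_pair:
  assumes "pair_labelled xs"
  shows "expectation (word_prod xs) = 1"
  unfolding expectation_word_prod using assms second by (intro prod.neutral) (auto simp: pair_labelled_def)

text \<open>
  Without a common label the two products are independent; a label that occurs once in the two lists together
  makes both sides vanish.
\<close>

lemma covariance_word_prod_zero:
  assumes "set xs \<inter> set ys = {} \<or> (\<exists>t\<in>set (xs @ ys). count_list (xs @ ys) t < 2)"
  shows "expectation (word_prod (xs @ ys)) = expectation (word_prod xs) * expectation (word_prod ys)"
proof (cases "set xs \<inter> set ys = {}")
  case True
  have zx: "count_list ys x = 0" if "x \<in> set xs" for x using True that by (auto simp: count_list_0_iff)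
  have zy: "count_list xs x = 0" if "x \<in> set ys" for x using True that by (auto simp: count_list_0_iff)
  have "expectation (word_prod (xs @ ys))
      = (\<Prod>t\<in>set xs. expectation (\<lambda>\<omega>. z t \<omega> ^ count_list (xs @ ys) t)) * (\<Prod>t\<in>set ys. expectation (\<lambda>\<omega>. z t \<omega> ^ count_list (xs @ ys) t))"
    unfolding expectation_word_prod set_append using True by (intro prod.union_disjoint) auto
  also have "(\<Prod>t\<in>set xs. expectation (\<lambda>\<omega>. z t \<omega> ^ count_list (xs @ ys) t)) = expectation (word_prod xs)"
    unfolding expectation_word_prod by (intro prod.cong) (auto simp: zx)
  also have "(\<Prod>t\<in>set ys. expectation (\<lambda>\<omega>. z t \<omega> ^ count_list (xs @ ys) t)) = expectation (word_prod ys)"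
    unfolding expectation_word_prod by (intro prod.cong) (auto simp: zy)
  finally show ?thesis .
next
  case False
  then obtain t where t: "t \<in> set (xs @ ys)" "count_list (xs @ ys) t < 2" using assms by blast
  have "count_list (xs @ ys) t \<noteq> 0" using t by (simp only: count_list_0_iff not_not)
  then have c: "count_list (xs @ ys) t = 1" using t(2) by linarith
  then have "count_list xs t = 1 \<and> t \<in> set xs \<or> count_list ys t = 1 \<and> t \<in> set ys"
    using count_list_0_iff[of xs t] count_list_0_iff[of ys t] by (cases "count_list xs t") auto
  then show ?thesis
    using expectation_word_prod_single[OF t(1) c] expectation_word_prod_single[of t xs] expectation_word_prod_single[of t ys]
    by auto
qed

definition trace_sum :: "(nat \<Rightarrow> nat \<Rightarrow> 't) \<Rightarrow> nat \<Rightarrow> nat \<Rightarrow> 'a \<Rightarrow> real" where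
  "trace_sum l n h \<omega> = (\<Sum>v\<in>closed_tri_walks n h. word_prod (steps l v) \<omega>)"

lemma trace_sum_measurable [measurable]: "random_variable borel (trace_sum l n h)"
  unfolding trace_sum_def[abs_def] by measurable

text \<open>
  A walk that is not pair-labelled contributes only if each label occurs at least twice and one at least
  three times; it then has at most \<open>(h - 1) div 2\<close> labels.
\<close>

lemma expectation_trace_sum:
  assumes l: "thin_link n l D" and n: "n > 0" and h: "h > 0"
  shows "\<bar>expectation (trace_sum l n h) - card (pair_walks n l h)\<bar>
    \<le> K ^ h * (walk_const h 0 D * n ^ Suc ((h - 1) div 2))"
proof -
  let ?C = "closed_tri_walks n h"
  let ?E = "\<lambda>v. expectation (word_prod (steps l v))"
  let ?F = "{v \<in> tri_walks n h. card (set (steps l v) - {}) \<le> (h - 1) div 2}"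
  have "expectation (trace_sum l n h) = (\<Sum>v\<in>?C. ?E v)"
    unfolding trace_sum_def[abs_def] using integrable_word_prod by (intro Bochner_Integration.integral_sum) auto
  also have "\<dots> = (\<Sum>v\<in>pair_walks n l h. ?E v) + (\<Sum>v\<in>?C - pair_walks n l h. ?E v)"
    by (subst sum.subset_diff[of "pair_walks n l h"]) (auto simp: pair_walks_def finite_closed_tri_walks)
  also have "(\<Sum>v\<in>pair_walks n l h. ?E v) = card (pair_walks n l h)"
    by (simp add: expectation_word_prod_pair pair_walks_def)
  finally have "\<bar>expectation (trace_sum l n h) - card (pair_walks n l h)\<bar> = \<bar>\<Sum>v\<in>?C - pair_walks n l h. ?E v\<bar>" by simp
  also have "\<dots> = \<bar>\<Sum>v\<in>(?C - pair_walks n l h) \<inter> ?F. ?E v\<bar>"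
  proof (intro arg_cong[where f = abs] sum.mono_neutral_right)
    show "\<forall>v\<in>?C - pair_walks n l h - (?C - pair_walks n l h) \<inter> ?F. ?E v = 0"
    proof
      fix v assume v: "v \<in> ?C - pair_walks n l h - (?C - pair_walks n l h) \<inter> ?F"
      let ?xs = "steps l v"
      have vC: "v \<in> ?C" and np: "\<not> pair_labelled ?xs" and big: "card (set ?xs) > (h - 1) div 2"
        using v by (auto simp: pair_walks_def closed_tri_walks_def)
      have "\<exists>t\<in>set ?xs. count_list ?xs t = 1"
      proof (rule ccontr)
        assume no: "\<not> ?thesis"
        have ge: "2 \<le> count_list ?xs t" if "t \<in> set ?xs" for t
        proof -
          have "count_list ?xs t \<noteq> 0" using that by (simp only: count_list_0_iff not_not)
          moreover have "count_list ?xs t \<noteq> 1" using no that by blast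
          ultimately show ?thesis by linarith
        qed
        obtain t where t: "t \<in> set ?xs" "count_list ?xs t \<noteq> 2" using np by (auto simp: pair_labelled_def)
        have "(\<Sum>t\<in>set ?xs. 2) < (\<Sum>t\<in>set ?xs. count_list ?xs t)"
          using ge t by (intro sum_strict_mono_ex1) (auto intro!: bexI[of _ t] simp: le_neq_implies_less)
        then have "card (set ?xs) * 2 < h"
          unfolding length_eq_sum_count[symmetric] steps_length_closed[OF vC] by simp
        then show False using big by linarith
      qed
      then show "?E v = 0" using expectation_word_prod_single by blast
    qed
  qed (auto simp: finite_closed_tri_walks)
  also have "\<dots> \<le> (\<Sum>v\<in>(?C - pair_walks n l h) \<inter> ?F. \<bar>?E v\<bar>)" by (rule sum_abs)
  also have "\<dots> \<le> (\<Sum>v\<in>(?C - pair_walks n l h) \<inter> ?F. K ^ h)"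
  proof (rule sum_mono)
    fix v assume "v \<in> (?C - pair_walks n l h) \<inter> ?F"
    then show "\<bar>?E v\<bar> \<le> K ^ h"
      using abs_expectation_word_prod[of "steps l v"] steps_length_closed[of v n h l] by auto
  qed
  also have "\<dots> = K ^ h * card ((?C - pair_walks n l h) \<inter> ?F)" by simp
  also have "\<dots> \<le> K ^ h * real (walk_const h 0 D * n ^ Suc ((h - 1) div 2))"
  proof (intro mult_left_mono of_nat_mono)
    have "card ((?C - pair_walks n l h) \<inter> ?F) \<le> card ?F" by (intro card_mono) (auto simp: finite_tri_walks)
    also have "\<dots> \<le> walk_const h 0 D * n ^ Suc ((h - 1) div 2)"
      by (rule card_walks_few_new_labels[OF l _ _ n]) auto
    finally show "card ((?C - pair_walks n l h) \<inter> ?F) \<le> walk_const h 0 D * n ^ Suc ((h - 1) div 2)" .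
    show "0 \<le> K ^ h" using K_ge_1 by simp
  qed
  finally show ?thesis by simp
qed

lemma integrable_trace_sum_power2: "integrable M (\<lambda>\<omega>. (trace_sum l n h \<omega>)\<^sup>2)" "integrable M (trace_sum l n h)"
proof -
  let ?B = "\<Sum>v\<in>closed_tri_walks n h. K ^ h"
  have b: "\<bar>trace_sum l n h \<omega>\<bar> \<le> ?B" if "\<omega> \<in> space M" for \<omega>
    unfolding trace_sum_def
  proof (rule order_trans[OF sum_abs sum_mono])
    fix v assume "v \<in> closed_tri_walks n h"
    then show "\<bar>word_prod (steps l v) \<omega>\<bar> \<le> K ^ h"
      using word_prod_bound[OF that, of "steps l v"] by (simp add: length_closed)
  qed
  have b2: "(trace_sum l n h \<omega>)\<^sup>2 \<le> ?B\<^sup>2" if "\<omega> \<in> space M" for \<omega>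
    by (rule abs_le_square_iff[THEN iffD1, OF order_trans[OF b[OF that] abs_ge_self]])
  show "integrable M (trace_sum l n h)"
    by (rule integrable_const_bound[of _ ?B]) (use b in \<open>auto simp del: sum_constant intro!: AE_I2\<close>)
  show "integrable M (\<lambda>\<omega>. (trace_sum l n h \<omega>)\<^sup>2)"
    by (rule integrable_const_bound[of _ "?B\<^sup>2"]) (use b2 in \<open>auto simp del: sum_constant intro!: AE_I2\<close>)
qed

lemma variance_trace_sum:
  assumes l: "thin_link n l D" and n: "n > 0"
  shows "variance (trace_sum l n h) \<le> 2 * K ^ (2 * h) * (pair_const h D * n ^ Suc h)"
proof -
  let ?C = "closed_tri_walks n h"
  let ?m = "\<lambda>v. word_prod (steps l v)" and ?E = "\<lambda>v. expectation (word_prod (steps l v))"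
  let ?EE = "\<lambda>v w. expectation (word_prod (steps l v @ steps l w))"
  have 1: "expectation (\<lambda>\<omega>. (trace_sum l n h \<omega>)\<^sup>2) = (\<Sum>v\<in>?C. \<Sum>w\<in>?C. ?EE v w)"
  proof -
    have "expectation (\<lambda>\<omega>. (trace_sum l n h \<omega>)\<^sup>2) = expectation (\<lambda>\<omega>. \<Sum>v\<in>?C. \<Sum>w\<in>?C. word_prod (steps l v @ steps l w) \<omega>)"
      by (simp add: trace_sum_def power2_eq_square sum_product word_prod_append)
    also have "\<dots> = (\<Sum>v\<in>?C. expectation (\<lambda>\<omega>. \<Sum>w\<in>?C. word_prod (steps l v @ steps l w) \<omega>))"
      using integrable_word_prod by (intro Bochner_Integration.integral_sum Bochner_Integration.integrable_sum) auto
    also have "\<dots> = (\<Sum>v\<in>?C. \<Sum>w\<in>?C. ?EE v w)"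
      using integrable_word_prod by (intro sum.cong refl Bochner_Integration.integral_sum) auto
    finally show ?thesis .
  qed
  have 2: "expectation (trace_sum l n h) = (\<Sum>v\<in>?C. ?E v)"
    unfolding trace_sum_def[abs_def] using integrable_word_prod by (intro Bochner_Integration.integral_sum) auto
  have "variance (trace_sum l n h) = expectation (\<lambda>\<omega>. (trace_sum l n h \<omega>)\<^sup>2) - (expectation (trace_sum l n h))\<^sup>2"
    by (rule variance_eq) (rule integrable_trace_sum_power2)+
  also have "\<dots> = (\<Sum>v\<in>?C. \<Sum>w\<in>?C. ?EE v w - ?E v * ?E w)"
    unfolding 1 2 by (simp add: power2_eq_square sum_product sum_subtractf)
  also have "\<dots> = (\<Sum>(v, w)\<in>?C \<times> ?C. ?EE v w - ?E v * ?E w)" by (rule sum.cartesian_product)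
  also have "\<dots> = (\<Sum>(v, w)\<in>linked_pairs n l h. ?EE v w - ?E v * ?E w)"
  proof (rule sum.mono_neutral_right)
    show "\<forall>p\<in>?C \<times> ?C - linked_pairs n l h. (case p of (v, w) \<Rightarrow> ?EE v w - ?E v * ?E w) = 0"
    proof safe
      fix v w assume "v \<in> ?C" "w \<in> ?C" "(v, w) \<notin> linked_pairs n l h"
      then have "set (steps l v) \<inter> set (steps l w) = {} \<or> (\<exists>t\<in>set (steps l v @ steps l w). count_list (steps l v @ steps l w) t < 2)"
        unfolding linked_pairs_def by (auto simp: not_le)
      from covariance_word_prod_zero[OF this] show "?EE v w - ?E v * ?E w = 0" by simp
    qed
  qed (auto simp: linked_pairs_def finite_closed_tri_walks)
  also have "\<dots> \<le> (\<Sum>(v, w)\<in>linked_pairs n l h. 2 * K ^ (2 * h))"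
  proof (rule sum_mono, safe)
    fix v w assume "(v, w) \<in> linked_pairs n l h"
    then have vw: "v \<in> ?C" "w \<in> ?C" by (auto simp: linked_pairs_def)
    have "\<bar>?EE v w\<bar> \<le> K ^ (2 * h)"
      using abs_expectation_word_prod[of "steps l v @ steps l w"] vw by (simp add: length_closed mult_2)
    moreover have "\<bar>?E v * ?E w\<bar> \<le> K ^ h * K ^ h"
      unfolding abs_mult using abs_expectation_word_prod[of "steps l v"] abs_expectation_word_prod[of "steps l w"] vw K_ge_1
      by (intro mult_mono) (auto simp: length_closed)
    then have "\<bar>?E v * ?E w\<bar> \<le> K ^ (2 * h)" by (simp add: mult_2 power_add)
    ultimately show "?EE v w - ?E v * ?E w \<le> 2 * K ^ (2 * h)" by (simp add: abs_le_iff)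
  qed
  also have "\<dots> = 2 * K ^ (2 * h) * card (linked_pairs n l h)" by (simp add: case_prod_beta)
  also have "\<dots> \<le> 2 * K ^ (2 * h) * real (pair_const h D * n ^ Suc h)"
    using card_linked_pairs[OF l n, of h] K_ge_1 by (intro mult_left_mono of_nat_mono) auto
  finally show ?thesis by simp
qed

end

section \<open>Almost sure convergence of the moments along the squares\<close>

lemma (in prob_space) AE_tendsto_0_of_summable_expectation:
  fixes Y :: "nat \<Rightarrow> 'a \<Rightarrow> real"
  assumes int: "\<And>m. integrable M (Y m)" and nn: "\<And>m \<omega>. 0 \<le> Y m \<omega>"
    and sum: "summable (\<lambda>m. expectation (Y m))"
  shows "AE \<omega> in M. (\<lambda>m. Y m \<omega>) \<longlonglongrightarrow> 0"
proof -
  have [measurable]: "random_variable borel (Y m)" for m using int by auto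
  have "(\<integral>\<^sup>+\<omega>. (\<Sum>m. ennreal (Y m \<omega>)) \<partial>M) = (\<Sum>m. \<integral>\<^sup>+\<omega>. ennreal (Y m \<omega>) \<partial>M)"
    by (rule nn_integral_suminf) measurable
  also have "\<dots> = (\<Sum>m. ennreal (expectation (Y m)))"
    using int nn by (intro suminf_cong nn_integral_eq_integral) auto
  also have "\<dots> = ennreal (\<Sum>m. expectation (Y m))"
    using nn sum by (intro suminf_ennreal2) (auto intro: integral_nonneg_AE)
  also have "\<dots> < \<infinity>" by simp
  finally have "AE \<omega> in M. (\<Sum>m. ennreal (Y m \<omega>)) \<noteq> \<infinity>"
    by (intro nn_integral_PInf_AE) auto
  then show ?thesis
  proof eventually_elim
    case (elim \<omega>)
    then have "summable (\<lambda>m. Y m \<omega>)"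
      using nn by (intro summable_suminf_not_top) (auto simp: top_ennreal_def)
    then show ?case by (rule summable_LIMSEQ_zero)
  qed
qed

definition tri_entry :: "(nat \<Rightarrow> nat \<Rightarrow> 't) \<Rightarrow> nat \<Rightarrow> ('t \<Rightarrow> real) \<Rightarrow> nat \<Rightarrow> nat \<Rightarrow> real" where
  "tri_entry l n a x y = (if x + y < n then a (l x y) else 0)"

lemma prod_steps_tri_entry:
  "prod_list (steps (tri_entry l n a) v) = (if successively (\<lambda>x y. x + y < n) v then (\<Prod>t\<leftarrow>steps l v. a t) else 0)"
  by (induction v rule: induct_list012) (auto simp: tri_entry_def)

lemma sum_eigenvalue_powers_tri:
  assumes e: "eigenbasis n (tri_entry l n a) d u"
  shows "(\<Sum>k<n. d k ^ h) = (\<Sum>v\<in>closed_tri_walks n h. \<Prod>t\<leftarrow>steps l v. a t)"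
proof -
  have "(\<Sum>k<n. d k ^ h) = (\<Sum>v | v \<in> walks n h \<and> hd v = last v. prod_list (steps (tri_entry l n a) v))"
    by (rule sum_eigenvalue_powers[OF e])
  also have "\<dots> = (\<Sum>v\<in>closed_tri_walks n h. prod_list (steps (tri_entry l n a) v))"
    by (rule sum.mono_neutral_right)
      (auto simp: closed_tri_walks_def tri_walks_def walks_def prod_steps_tri_entry intro: finite_subset[OF _ finite_walks[of n h]])
  also have "\<dots> = (\<Sum>v\<in>closed_tri_walks n h. \<Prod>t\<leftarrow>steps l v. a t)"
    by (intro sum.cong refl) (auto simp: prod_steps_tri_entry closed_tri_walks_def tri_walks_def)
  finally show ?thesis .
qed

lemma tri_entry_sym: "thin_link n l D \<Longrightarrow> tri_entry l n a x y = tri_entry l n a y x"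
  by (auto simp: tri_entry_def thin_link_def add.commute)

text \<open>
  The full moment sequence of the limit law; \<^const>\<open>beta_even\<close> gives only its even moments of positive
  order.
\<close>

definition limit_moment :: "(nat \<Rightarrow> nat \<Rightarrow> nat \<Rightarrow> int ^ 'd) \<Rightarrow> nat \<Rightarrow> real" where
  "limit_moment L r = (if odd r then 0 else if r = 0 then 1 else beta_even L (r div 2))"

locale convergent_link =
  fixes L :: "nat \<Rightarrow> nat \<Rightarrow> nat \<Rightarrow> int ^ 'd" and D :: nat
  assumes thin: "\<And>n. n > 0 \<Longrightarrow> thin_link n (link0 L n) D"
    and compat: "\<And>n N x y. x < n \<Longrightarrow> y < n \<Longrightarrow> n \<le> N \<Longrightarrow> link0 L N x y = link0 L n x y"
    and conv: "\<And>k w. k \<ge> 1 \<Longrightarrow> w \<in> pair_matched_words (2 * k) \<Longrightarrow> convergent (pu_ratio L w)"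
begin

lemma pair_walks_limit:
  assumes k: "k \<ge> 1"
  shows "(\<lambda>n. card (pair_walks n (link0 L n) (2 * k)) / real n ^ Suc k) \<longlonglongrightarrow> beta_even L k"
proof -
  let ?W = "pair_matched_words (2 * k)"
  let ?c = "real (card ?W) * real (walk_const (2 * k) 0 D)"
  let ?S = "\<lambda>n. \<Sum>w\<in>?W. pu_ratio L w n"
  let ?P = "\<lambda>n. card (pair_walks n (link0 L n) (2 * k)) / real n ^ Suc k"
  have S: "?S \<longlonglongrightarrow> beta_even L k"
    unfolding beta_even_def pu_def using conv[OF k] by (intro tendsto_sum) (simp add: convergent_LIMSEQ_iff)
  have S_eq: "?S n = real (\<Sum>w\<in>?W. card (Pi1_star L n w)) / real n ^ Suc k" for n
    unfolding pu_ratio_def of_nat_sum sum_divide_distrib by (intro sum.cong refl) (simp add: pair_matched_words_def)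
  have upper: "?P n \<le> ?S n" if "n > 0" for n
    unfolding S_eq using sum_card_Pi1_star_bounds(1)[of n L D k] thin[OF that] that k
    by (intro divide_right_mono of_nat_mono) auto
  have lower: "?S n - ?c / real n \<le> ?P n" if "n > 0" for n
  proof -
    have "real (\<Sum>w\<in>?W. card (Pi1_star L n w)) \<le> real (card (pair_walks n (link0 L n) (2 * k)) + card ?W * (walk_const (2 * k) 0 D * n ^ k))"
      by (rule of_nat_mono, rule sum_card_Pi1_star_bounds(2)) (use thin that k in auto)
    then have "?S n \<le> (real (card (pair_walks n (link0 L n) (2 * k))) + ?c * real n ^ k) / real n ^ Suc k"
      unfolding S_eq by (intro divide_right_mono) (simp_all add: mult_ac)
    also have "\<dots> = ?P n + ?c / real n" using that by (simp add: add_divide_distrib)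
    finally show ?thesis by simp
  qed
  have "(\<lambda>n. ?S n - ?c / real n) \<longlonglongrightarrow> beta_even L k - 0"
    by (intro tendsto_diff S lim_const_over_n)
  then have "(\<lambda>n. ?S n - ?c / real n) \<longlonglongrightarrow> beta_even L k" by simp
  then show ?thesis
    by (rule tendsto_sandwich[rotated 2, OF _ S])
      (use upper lower in \<open>auto intro!: eventually_sequentiallyI[of 1]\<close>)
qed

text \<open>
  The pair-labelled walks are among all walks with \<open>k\<close> labels, and \<open>k\<^sup>k k! \<le> (2k)!\<close>.
\<close>

lemma beta_even_bound:
  assumes k: "k \<ge> 1"
  shows "beta_even L k \<le> fact (2 * k) / fact k * real (8 * D) ^ k"
proof (rule LIMSEQ_le_const2[OF pair_walks_limit[OF k]], intro exI allI impI)
  fix n :: nat assume n: "1 \<le> n"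
  then have n0: "n > 0" by simp
  have "card (pair_walks n (link0 L n) (2 * k)) \<le> card {v \<in> tri_walks n (2 * k). card (set (steps (link0 L n) v) - {}) = k}"
  proof (rule card_mono)
    show "pair_walks n (link0 L n) (2 * k) \<subseteq> {v \<in> tri_walks n (2 * k). card (set (steps (link0 L n) v) - {}) = k}"
    proof
      fix v assume v: "v \<in> pair_walks n (link0 L n) (2 * k)"
      then have "length (steps (link0 L n) v) = 2 * card (set (steps (link0 L n) v))"
        by (intro length_pair_labelled) (simp add: pair_walks_def)
      then show "v \<in> {v \<in> tri_walks n (2 * k). card (set (steps (link0 L n) v) - {}) = k}"
        using v by (simp add: pair_walks_def closed_tri_walks_def tri_walks_def)
    qed
  qed (simp add: finite_tri_walks)
  also have "\<dots> \<le> 2 ^ (2 * k) * ((2 * k + 0) * D) ^ (2 * k - k) * n ^ Suc k"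
    by (rule card_walks_new_labels[OF thin[OF n0]]) auto
  also have "\<dots> = (8 * D) ^ k * k ^ k * n ^ Suc k"
  proof -
    have "(2::nat) ^ (2 * k) = 4 ^ k" by (simp add: power_mult)
    moreover have "(8::nat) ^ k = 4 ^ k * 2 ^ k" by (simp add: power_mult_distrib[symmetric])
    ultimately show ?thesis by (simp add: power_mult_distrib mult_ac)
  qed
  finally have "real (card (pair_walks n (link0 L n) (2 * k))) \<le> real ((8 * D) ^ k * k ^ k * n ^ Suc k)" by (rule of_nat_mono)
  then have "card (pair_walks n (link0 L n) (2 * k)) / real n ^ Suc k \<le> (8 * real D) ^ k * real k ^ k"
    using n by (simp add: pos_divide_le_eq)
  also have "\<dots> \<le> (8 * real D) ^ k * (fact (2 * k) / fact k)"
  proof (rule mult_left_mono)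
    have "(\<Prod>i\<in>{k..<2 * k}. k) \<le> (\<Prod>i\<in>{k..<2 * k}. Suc i)" by (intro prod_mono) auto
    then have "k ^ k * fact k \<le> (\<Prod>i\<in>{k..<2 * k}. Suc i) * fact k" by (intro mult_right_mono) auto
    then have "k ^ k * fact k \<le> (fact (2 * k) :: nat)" using fact_split[of k "2 * k", where 'a = nat] by simp
    then have "real (k ^ k * fact k) \<le> real (fact (2 * k))" by (rule of_nat_mono)
    then show "real k ^ k \<le> fact (2 * k) / fact k" by (simp add: pos_le_divide_eq)
  qed simp
  finally show "card (pair_walks n (link0 L n) (2 * k)) / real n ^ Suc k \<le> fact (2 * k) / fact k * real (8 * D) ^ k"
    by (simp add: mult.commute)
qed

end

lemma sqrt_power_even: "sqrt (real n) ^ (2 * k) = real n ^ k"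
  by (simp add: power_mult)

locale patterned_input = convergent_link L D + bounded_input M z K
  for L :: "nat \<Rightarrow> nat \<Rightarrow> nat \<Rightarrow> int ^ 'd" and D and M :: "'a measure" and z :: "int ^ 'd \<Rightarrow> 'a \<Rightarrow> real" and K
begin

definition scaled_trace :: "nat \<Rightarrow> nat \<Rightarrow> 'a \<Rightarrow> real" where
  "scaled_trace n h \<omega> = trace_sum (link0 L n) n h \<omega> / (real n * sqrt (real n) ^ h)"

lemma scaled_trace_0: "n > 0 \<Longrightarrow> scaled_trace n 0 \<omega> = 1"
proof -
  assume n: "n > 0"
  have "closed_tri_walks n 0 = (\<lambda>x. [x]) ` {..<n}"
    unfolding closed_tri_walks_def tri_walks_0 by auto
  then have "trace_sum (link0 L n) n 0 \<omega> = (\<Sum>v\<in>(\<lambda>x. [x]) ` {..<n}. 1)"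
    unfolding trace_sum_def by (intro sum.cong) (auto simp: word_prod_def)
  also have "\<dots> = real n" by (simp add: card_image inj_on_def)
  finally show ?thesis using n by (simp add: scaled_trace_def)
qed

lemma expectation_scaled_trace:
  "(\<lambda>n. expectation (scaled_trace n h)) \<longlonglongrightarrow> limit_moment L h"
proof (cases "h = 0")
  case True
  have "eventually (\<lambda>n. expectation (scaled_trace n h) = 1) sequentially"
  proof (rule eventually_sequentiallyI[of 1])
    fix n :: nat assume "1 \<le> n"
    then have "scaled_trace n 0 = (\<lambda>_. 1)" by (intro ext scaled_trace_0) simp
    then show "expectation (scaled_trace n h) = 1" by (simp add: True prob_space)
  qed
  then show ?thesis using True by (simp add: limit_moment_def tendsto_eventually)
next
  case False
  define c where "c = K ^ h * walk_const h 0 D"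
  define P where "P n = card (pair_walks n (link0 L n) h) / (real n * sqrt (real n) ^ h)" for n
  have E: "expectation (scaled_trace n h) = expectation (trace_sum (link0 L n) n h) / (real n * sqrt (real n) ^ h)" for n
    unfolding scaled_trace_def[abs_def] by simp
  have close: "\<bar>expectation (scaled_trace n h) - P n\<bar> \<le> c / sqrt (real n)" if n: "n > 0" for n
  proof -
    have "\<bar>expectation (scaled_trace n h) - P n\<bar>
       = \<bar>expectation (trace_sum (link0 L n) n h) - card (pair_walks n (link0 L n) h)\<bar> / (real n * sqrt (real n) ^ h)"
      unfolding E P_def diff_divide_distrib[symmetric] by (simp add: abs_divide)
    also have "\<dots> \<le> (K ^ h * (walk_const h 0 D * n ^ Suc ((h - 1) div 2))) / (real n * sqrt (real n) ^ h)"
      using expectation_trace_sum[OF thin[OF n] n, of h] False by (intro divide_right_mono) auto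
    also have "\<dots> = c * (real n ^ Suc ((h - 1) div 2) / (real n * sqrt (real n) ^ h))" by (simp add: c_def)
    also have "\<dots> \<le> c * (1 / sqrt (real n))"
    proof (rule mult_left_mono)
      have "real n ^ ((h - 1) div 2) * sqrt (real n) = sqrt (real n) ^ (2 * ((h - 1) div 2) + 1)"
        by (simp only: sqrt_power_even power_add power_one_right)
      also have "\<dots> \<le> sqrt (real n) ^ h" using n False by (intro power_increasing) auto
      finally have le: "real n ^ ((h - 1) div 2) * sqrt (real n) \<le> sqrt (real n) ^ h" .
      have "real n ^ Suc ((h - 1) div 2) / (real n * sqrt (real n) ^ h) = real n ^ ((h - 1) div 2) / sqrt (real n) ^ h"
        using n by simp
      also have "\<dots> \<le> 1 / sqrt (real n)"
        using le n by (simp add: pos_divide_le_eq pos_le_divide_eq)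
      finally show "real n ^ Suc ((h - 1) div 2) / (real n * sqrt (real n) ^ h) \<le> 1 / sqrt (real n)" .
      show "0 \<le> c" using K_ge_1 by (simp add: c_def)
    qed
    finally show ?thesis by simp
  qed
  have "(\<lambda>n. c / sqrt (real n)) \<longlonglongrightarrow> 0"
    by (intro tendsto_divide_0[OF tendsto_const] filterlim_at_top_imp_at_infinity filterlim_compose[OF sqrt_at_top] filterlim_real_sequentially)
  then have d: "(\<lambda>n. expectation (scaled_trace n h) - P n) \<longlonglongrightarrow> 0"
    by (rule Lim_null_comparison[rotated]) (use close in \<open>auto intro!: eventually_sequentiallyI[of 1]\<close>)
  have "P \<longlonglongrightarrow> limit_moment L h"
  proof (cases "even h")
    case True
    then obtain k where k: "h = 2 * k" by blast
    then have k1: "k \<ge> 1" using False by simp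
    have "P = (\<lambda>n. card (pair_walks n (link0 L n) (2 * k)) / real n ^ Suc k)"
      unfolding P_def k sqrt_power_even by simp
    then show ?thesis using pair_walks_limit[OF k1] k k1 by (simp add: limit_moment_def)
  next
    case odd: False
    have "pair_walks n (link0 L n) h = {}" for n
    proof -
      have "\<not> pair_labelled (steps (link0 L n) v)" if "v \<in> closed_tri_walks n h" for v
        using length_pair_labelled[of "steps (link0 L n) v"] length_closed[OF that] odd by auto
      then show ?thesis by (auto simp: pair_walks_def)
    qed
    then have "P = (\<lambda>n. 0)" by (simp add: P_def fun_eq_iff)
    then show ?thesis using odd by (simp add: limit_moment_def)
  qed
  from tendsto_add[OF d this] show ?thesis by simp
qed

text \<open>
  The variance is \<open>O(1/n)\<close>, which is summable along \<open>n = (m + 1)\<^sup>2\<close>.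
\<close>

lemma AE_scaled_trace_squares:
  "AE \<omega> in M. (\<lambda>m. scaled_trace ((Suc m)\<^sup>2) h \<omega>) \<longlonglongrightarrow> limit_moment L h"
proof -
  let ?N = "\<lambda>m. (Suc m)\<^sup>2"
  define Y where "Y m \<omega> = (scaled_trace (?N m) h \<omega> - expectation (scaled_trace (?N m) h))\<^sup>2" for m \<omega>
  let ?c = "2 * K ^ (2 * h) * pair_const h D"
  have Y: "Y m \<omega> = (trace_sum (link0 L (?N m)) (?N m) h \<omega> - expectation (trace_sum (link0 L (?N m)) (?N m) h))\<^sup>2 / (real (?N m) * sqrt (real (?N m)) ^ h)\<^sup>2" for m \<omega>
    unfolding Y_def scaled_trace_def[abs_def] by (simp add: diff_divide_distrib[symmetric] power_divide del: of_nat_power)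
  have bnd: "expectation (Y m) \<le> ?c * (1 / real (Suc m) ^ 2)" for m
  proof -
    let ?n = "?N m"
    have n: "?n > 0" by simp
    have "expectation (Y m) = variance (trace_sum (link0 L ?n) ?n h) / (real ?n * sqrt (real ?n) ^ h)\<^sup>2"
      unfolding Y[abs_def] by (simp del: of_nat_power)
    also have "\<dots> \<le> (2 * K ^ (2 * h) * (pair_const h D * ?n ^ Suc h)) / (real ?n * sqrt (real ?n) ^ h)\<^sup>2"
      by (intro divide_right_mono variance_trace_sum thin n) simp
    also have "(real ?n * sqrt (real ?n) ^ h)\<^sup>2 = real ?n * real ?n ^ Suc h"
    proof -
      have "(sqrt (real ?n) ^ h)\<^sup>2 = real ?n ^ h"
        using sqrt_power_even[of ?n h] by (simp only: power_mult[symmetric] mult.commute)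
      then show ?thesis by (simp add: power_mult_distrib power2_eq_square del: of_nat_power)
    qed
    also have "(2 * K ^ (2 * h) * (pair_const h D * ?n ^ Suc h)) / (real ?n * real ?n ^ Suc h) = ?c * (1 / real ?n)"
    proof -
      have *: "real ?n ^ Suc h \<noteq> 0" using n by (metis of_nat_0_less_iff less_irrefl zero_less_power)
      have "(2 * K ^ (2 * h) * (pair_const h D * ?n ^ Suc h)) / (real ?n * real ?n ^ Suc h)
         = (?c * real ?n ^ Suc h) / (real ?n * real ?n ^ Suc h)"
        by (simp only: of_nat_mult of_nat_power mult.assoc)
      also have "\<dots> = ?c / real ?n" using * by (rule nonzero_mult_divide_mult_cancel_right)
      finally show ?thesis by simp
    qed
    finally show ?thesis by simp
  qed
  have intY: "integrable M (Y m)" for m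
  proof -
    have "integrable M (\<lambda>\<omega>. (trace_sum (link0 L (?N m)) (?N m) h \<omega> - c)\<^sup>2)" for c
      unfolding power2_diff using integrable_trace_sum_power2[of "link0 L (?N m)" "?N m" h] by simp
    then show ?thesis unfolding Y[abs_def] by simp
  qed
  have "summable (\<lambda>m. 1 / real (Suc m) ^ 2)"
    using inverse_power_summable[of 2, where 'a = real] by (subst summable_Suc_iff) (simp add: inverse_eq_divide)
  then have s: "summable (\<lambda>m. ?c * (1 / real (Suc m) ^ 2))" by (rule summable_mult)
  have nnY: "0 \<le> Y m \<omega>" for m \<omega> by (simp add: Y_def)
  have "AE \<omega> in M. (\<lambda>m. Y m \<omega>) \<longlonglongrightarrow> 0"
  proof (rule AE_tendsto_0_of_summable_expectation[OF intY nnY])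
    show "summable (\<lambda>m. expectation (Y m))"
    proof (rule summable_comparison_test'[OF s])
      fix m :: nat
      have "0 \<le> expectation (Y m)" using nnY by (intro Bochner_Integration.integral_nonneg) auto
      then show "norm (expectation (Y m)) \<le> ?c * (1 / real (Suc m) ^ 2)" using bnd[of m] by simp
    qed
  qed
  then show ?thesis
  proof eventually_elim
    case (elim \<omega>)
    have "(\<lambda>m. sqrt (Y m \<omega>)) \<longlonglongrightarrow> sqrt 0" by (rule tendsto_real_sqrt[OF elim])
    then have "(\<lambda>m. \<bar>scaled_trace (?N m) h \<omega> - expectation (scaled_trace (?N m) h)\<bar>) \<longlonglongrightarrow> 0"
      by (simp add: Y_def)
    then have 1: "(\<lambda>m. scaled_trace (?N m) h \<omega> - expectation (scaled_trace (?N m) h)) \<longlonglongrightarrow> 0"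
      by (rule tendsto_rabs_zero_cancel)
    have "filterlim ?N at_top sequentially"
      by (rule filterlim_subseq) (auto simp: strict_mono_def intro: power_strict_mono)
    from filterlim_compose[OF expectation_scaled_trace this]
    have "(\<lambda>m. expectation (scaled_trace (?N m) h)) \<longlonglongrightarrow> limit_moment L h" .
    from tendsto_add[OF 1 this] show ?case by simp
  qed
qed

end

section \<open>From squares to all matrix sizes\<close>

text \<open>
  An arbitrary choice; the counts below do not depend on it by \<open>eig_count_eq\<close>.
\<close>

definition eigvals :: "nat \<Rightarrow> (nat \<Rightarrow> nat \<Rightarrow> real) \<Rightarrow> nat \<Rightarrow> real" where
  "eigvals n a = (SOME d. \<exists>u. eigenbasis n a d u)"

definition eig_count :: "nat \<Rightarrow> (nat \<Rightarrow> nat \<Rightarrow> real) \<Rightarrow> real \<Rightarrow> nat" where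
  "eig_count n a x = card {k. k < n \<and> eigvals n a k \<le> x}"

lemma eig_count_eq:
  assumes e: "eigenbasis n a d u"
  shows "eig_count n a x = card {k. k < n \<and> d k \<le> x}"
proof -
  have "\<exists>d u. eigenbasis n a d u" using e by blast
  then have "\<exists>u. eigenbasis n a (eigvals n a) u" unfolding eigvals_def by (rule someI_ex)
  then obtain u' where u': "eigenbasis n a (eigvals n a) u'" by blast
  show ?thesis
    unfolding eig_count_def
    using eigenvalue_count_perturb_rank[OF e u', of "{}" x] eigenvalue_count_perturb_rank[OF u' e, of "{}" x]
    by auto
qed

lemma eig_count_mono: "x \<le> y \<Longrightarrow> eig_count n a x \<le> eig_count n a y"
  unfolding eig_count_def by (intro card_mono) auto

lemma eig_count_square_perturb:
  assumes "\<And>i j. a i j = a j i" "\<And>i j. b i j = b j i" "\<epsilon> > 0"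
  shows "real (eig_count n a x) \<le> real (eig_count n b (x + \<epsilon>)) + (\<Sum>i<n. \<Sum>j<n. (b i j - a i j)\<^sup>2) / \<epsilon>\<^sup>2"
proof -
  obtain d u e v where "eigenbasis n a d u" "eigenbasis n b e v"
    using eigenbasis_exists[of n a] eigenbasis_exists[of n b] assms by blast
  then show ?thesis using eigenvalue_count_perturb_square[of n a d u b e v \<epsilon> x] assms(3) by (simp add: eig_count_eq)
qed

lemma eig_count_rank_perturb:
  assumes "\<And>i j. a i j = a j i" "\<And>i j. b i j = b j i" "S \<subseteq> {..<n}"
    and "\<And>i j. i < n \<Longrightarrow> j < n \<Longrightarrow> i \<notin> S \<Longrightarrow> j \<notin> S \<Longrightarrow> a i j = b i j"
  shows "eig_count n a x \<le> eig_count n b x + card S"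
proof -
  obtain d u e v where "eigenbasis n a d u" "eigenbasis n b e v"
    using eigenbasis_exists[of n a] eigenbasis_exists[of n b] assms by blast
  then show ?thesis using eigenvalue_count_perturb_rank[of n a d u b e v S x] assms(3,4) by (simp add: eig_count_eq)
qed

lemma eig_count_pad:
  assumes sym: "\<And>i j. a i j = a j i" and le: "n \<le> N"
  shows "eig_count n a x \<le> eig_count N (\<lambda>i j. if i < n \<and> j < n then a i j else 0) x"
    "eig_count N (\<lambda>i j. if i < n \<and> j < n then a i j else 0) x \<le> eig_count n a x + (N - n)"
proof -
  obtain d u where e: "eigenbasis n a d u" using eigenbasis_exists[of n a] sym by blast
  note c = eig_count_eq[OF e] eig_count_eq[OF eigenbasis_pad[OF e le]]
  show "eig_count n a x \<le> eig_count N (\<lambda>i j. if i < n \<and> j < n then a i j else 0) x"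
    unfolding c using le by (intro card_mono) auto
  have "card {k. k < N \<and> (if k < n then d k else 0) \<le> x} \<le> card ({k. k < n \<and> d k \<le> x} \<union> {n..<N})"
    by (intro card_mono) auto
  also have "\<dots> \<le> card {k. k < n \<and> d k \<le> x} + card {n..<N}" by (rule card_Un_le)
  finally show "eig_count N (\<lambda>i j. if i < n \<and> j < n then a i j else 0) x \<le> eig_count n a x + (N - n)"
    unfolding c by simp
qed

abbreviation pat_esd :: "(nat \<Rightarrow> nat \<Rightarrow> nat \<Rightarrow> int ^ 'd) \<Rightarrow> (int ^ 'd \<Rightarrow> real) \<Rightarrow> nat \<Rightarrow> real measure" where
  "pat_esd L a n \<equiv> empirical_spectral_distribution ((1 / sqrt (real n)) \<cdot>\<^sub>m triangular_patterned L a n)"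

lemma scaled_triangular_patterned:
  "c \<cdot>\<^sub>m triangular_patterned L a n = Matrix.mat n n (\<lambda>(i, j). c * tri_entry (link0 L n) n a i j)"
  by (rule eq_matI) (auto simp: triangular_patterned_def tri_entry_def)

context convergent_link
begin

lemma tri_entry_link_sym: "n > 0 \<Longrightarrow> tri_entry (link0 L n) n a i j = tri_entry (link0 L n) n a j i"
  by (rule tri_entry_sym[OF thin])

lemma cdf_pat_esd:
  assumes n: "n > 0"
  shows "cdf (pat_esd L a n) x = real (eig_count n (tri_entry (link0 L n) n a) (x * sqrt (real n))) / real n"
proof -
  obtain d u where e: "eigenbasis n (tri_entry (link0 L n) n a) d u"
    using eigenbasis_exists tri_entry_link_sym[OF n] by blast
  show ?thesis
    unfolding scaled_triangular_patterned esd_cdf[OF eigenbasis_scale[OF e] n] eig_count_eq[OF e]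
    using n by (simp add: pos_divide_le_eq)
qed

lemma moments_pat_esd:
  assumes n: "n > 0"
  shows "(\<integral>x. x ^ h \<partial>pat_esd L a n) = (\<Sum>v\<in>closed_tri_walks n h. \<Prod>t\<leftarrow>steps (link0 L n) v. a t) / (real n * sqrt (real n) ^ h)"
    "integrable (pat_esd L a n) (\<lambda>x. x ^ h)"
proof -
  obtain d u where e: "eigenbasis n (tri_entry (link0 L n) n a) d u"
    using eigenbasis_exists tri_entry_link_sym[OF n] by blast
  have "(\<integral>x. x ^ h \<partial>pat_esd L a n) = (\<Sum>k<n. ((1 / sqrt (real n)) * d k) ^ h) / real n"
    unfolding scaled_triangular_patterned by (rule esd_integral[OF eigenbasis_scale[OF e] n]) simp
  also have "(\<Sum>k<n. ((1 / sqrt (real n)) * d k) ^ h) = (\<Sum>k<n. d k ^ h) / sqrt (real n) ^ h"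
    by (simp add: power_mult_distrib power_divide sum_divide_distrib)
  finally show "(\<integral>x. x ^ h \<partial>pat_esd L a n) = (\<Sum>v\<in>closed_tri_walks n h. \<Prod>t\<leftarrow>steps (link0 L n) v. a t) / (real n * sqrt (real n) ^ h)"
    unfolding sum_eigenvalue_powers_tri[OF e] by (simp add: mult.commute)
  show "integrable (pat_esd L a n) (\<lambda>x. x ^ h)"
    unfolding scaled_triangular_patterned by (rule esd_integral[OF eigenbasis_scale[OF e] n]) simp
qed

lemma limit_moment_bound: "limit_moment L (2 * k) \<le> fact (2 * k) / fact k * real (8 * D) ^ k"
  using beta_even_bound[of k] by (cases "k = 0") (auto simp: limit_moment_def)

end

lemma (in patterned_input) AE_moments_squares:
  "AE \<omega> in M. \<forall>h. (\<lambda>m. \<integral>x. x ^ h \<partial>pat_esd L (\<lambda>t. z t \<omega>) ((Suc m)\<^sup>2)) \<longlonglongrightarrow> limit_moment L h"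
proof -
  have eq: "(\<integral>x. x ^ h \<partial>pat_esd L (\<lambda>t. z t \<omega>) ((Suc m)\<^sup>2)) = scaled_trace ((Suc m)\<^sup>2) h \<omega>" for h m \<omega>
    unfolding scaled_trace_def trace_sum_def word_prod_def by (rule moments_pat_esd(1)) simp
  show ?thesis unfolding eq AE_all_countable using AE_scaled_trace_squares by blast
qed

text \<open>
  One outcome at which all the moments converge is enough.
\<close>

lemma (in patterned_input) limit_distribution_exists:
  "\<exists>\<mu>. real_distribution \<mu> \<and> (\<forall>r. integrable \<mu> (\<lambda>x. x ^ r) \<and> (\<integral>x. x ^ r \<partial>\<mu>) = limit_moment L r)"
proof -
  obtain \<omega> where \<omega>: "\<And>h. (\<lambda>m. \<integral>x. x ^ h \<partial>pat_esd L (\<lambda>t. z t \<omega>) ((Suc m)\<^sup>2)) \<longlonglongrightarrow> limit_moment L h"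
    using eventually_happens[OF AE_moments_squares] ae_filter_bot by blast
  from moment_convergence[OF esd_real_distribution moments_pat_esd(2) \<omega> limit_moment_bound]
  show ?thesis by (simp del: power_Suc) blast
qed

lemma (in patterned_input) AE_weak_conv_squares:
  assumes \<mu>: "real_distribution \<mu>" "\<And>r::nat. integrable \<mu> (\<lambda>x. x ^ r)" "\<And>r. (\<integral>x. x ^ r \<partial>\<mu>) = limit_moment L r"
  shows "AE \<omega> in M. weak_conv_m (\<lambda>m. pat_esd L (\<lambda>t. z t \<omega>) ((Suc m)\<^sup>2)) \<mu>"
  using AE_moments_squares
proof eventually_elim
  case (elim \<omega>)
  then have lim: "\<And>h. (\<lambda>m. \<integral>x. x ^ h \<partial>pat_esd L (\<lambda>t. z t \<omega>) ((Suc m)\<^sup>2)) \<longlonglongrightarrow> limit_moment L h" by blast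
  have int: "\<And>m r. integrable (pat_esd L (\<lambda>t. z t \<omega>) ((Suc m)\<^sup>2)) (\<lambda>x. x ^ r)" by (rule moments_pat_esd(2)) simp
  obtain \<nu> where \<nu>: "real_distribution \<nu>" "\<And>r. integrable \<nu> (\<lambda>x. x ^ r)" "\<And>r. (\<integral>x. x ^ r \<partial>\<nu>) = limit_moment L r"
    "weak_conv_m (\<lambda>m. pat_esd L (\<lambda>t. z t \<omega>) ((Suc m)\<^sup>2)) \<nu>"
    using moment_convergence[OF esd_real_distribution int lim limit_moment_bound] by blast
  have "\<nu> = \<mu>"
    by (rule moments_determine_distribution[OF \<nu>(1) \<mu>(1) \<nu>(2) \<mu>(2), where D = "real (8 * D)"])
      (use \<nu>(3) \<mu>(3) limit_moment_bound in simp_all)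
  then show ?case using \<nu>(4) by simp
qed

lemma continuity_point_between:
  assumes \<mu>: "real_distribution \<mu>" and ab: "a < b"
  shows "\<exists>y. a < y \<and> y < b \<and> isCont (cdf \<mu>) y"
proof -
  interpret real_distribution \<mu> by fact
  have "\<not> {a<..<b} \<subseteq> {x. measure \<mu> {x} > 0}"
    using countable_atoms uncountable_open_interval[of a b] ab countable_subset by blast
  then obtain y where "y \<in> {a<..<b}" "\<not> measure \<mu> {y} > 0" by blast
  then show ?thesis using measure_nonneg[of \<mu> "{y}"] by (intro exI[of _ y]) (auto simp: isCont_cdf)
qed

text \<open>
  Weak convergence is preserved under perturbations that are small in the Levy metric. The comparison
  sequence \<open>G\<close> may depend on the precision \<open>\<eta>\<close>, which allows a truncation level that depends on \<open>\<eta>\<close>. The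
  points \<open>x \<plusminus> \<eta>\<close> may carry atoms of the limit, so continuity points slightly further out are used.
\<close>

lemma weak_conv_of_levy_close:
  fixes Fs :: "nat \<Rightarrow> real \<Rightarrow> real"
  assumes \<mu>: "real_distribution \<mu>"
    and close: "\<And>\<eta>. \<eta> > 0 \<Longrightarrow> \<exists>G. weak_conv G (cdf \<mu>) \<and> (\<forall>n. mono (G n)) \<and>
      (\<forall>x. eventually (\<lambda>n. Fs n x \<le> G n (x + \<eta>) + \<eta> \<and> G n (x - \<eta>) \<le> Fs n x + \<eta>) sequentially)"
  shows "weak_conv Fs (cdf \<mu>)"
  unfolding weak_conv_def
proof (intro allI impI)
  fix x assume x: "isCont (cdf \<mu>) x"
  show "(\<lambda>n. Fs n x) \<longlonglongrightarrow> cdf \<mu> x"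
  proof (rule LIMSEQ_I)
    fix r :: real assume r: "r > 0"
    define e where "e = r / 4"
    have e: "e > 0" using r by (simp add: e_def)
    obtain \<delta> where \<delta>: "\<delta> > 0" "\<And>y. \<bar>y - x\<bar> < \<delta> \<Longrightarrow> \<bar>cdf \<mu> y - cdf \<mu> x\<bar> < e"
      using x e unfolding continuous_at_eps_delta dist_real_def by blast
    define \<eta> where "\<eta> = min (\<delta> / 2) e"
    have \<eta>: "\<eta> > 0" "\<eta> < \<delta>" "\<eta> \<le> e" using \<delta> e by (auto simp: \<eta>_def)
    obtain G where G: "weak_conv G (cdf \<mu>)" "\<And>n. mono (G n)"
      and ev: "eventually (\<lambda>n. Fs n x \<le> G n (x + \<eta>) + \<eta> \<and> G n (x - \<eta>) \<le> Fs n x + \<eta>) sequentially"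
      using close[OF \<eta>(1)] by blast
    obtain y where y: "x + \<eta> < y" "y < x + \<delta>" "isCont (cdf \<mu>) y"
      using continuity_point_between[OF \<mu>, of "x + \<eta>" "x + \<delta>"] \<eta> by auto
    obtain y' where y': "x - \<delta> < y'" "y' < x - \<eta>" "isCont (cdf \<mu>) y'"
      using continuity_point_between[OF \<mu>, of "x - \<delta>" "x - \<eta>"] \<eta> by auto
    have "(\<lambda>n. G n y) \<longlonglongrightarrow> cdf \<mu> y" "(\<lambda>n. G n y') \<longlonglongrightarrow> cdf \<mu> y'"
      using G(1) y(3) y'(3) unfolding weak_conv_def by auto
    then have "eventually (\<lambda>n. \<bar>G n y - cdf \<mu> y\<bar> < e) sequentially" "eventually (\<lambda>n. \<bar>G n y' - cdf \<mu> y'\<bar> < e) sequentially"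
      using e unfolding tendsto_iff dist_real_def by blast+
    with ev have "eventually (\<lambda>n. norm (Fs n x - cdf \<mu> x) < r) sequentially"
    proof eventually_elim
      case (elim n)
      have 1: "G n (x + \<eta>) \<le> G n y" using G(2)[of n] y by (auto simp: mono_def)
      have 2: "G n y' \<le> G n (x - \<eta>)" using G(2)[of n] y' by (auto simp: mono_def)
      have 3: "\<bar>cdf \<mu> y - cdf \<mu> x\<bar> < e" using y \<eta> by (intro \<delta>(2)) auto
      have 4: "\<bar>cdf \<mu> y' - cdf \<mu> x\<bar> < e" using y' \<eta> by (intro \<delta>(2)) auto
      show ?case using elim 1 2 3 4 \<eta> unfolding e_def real_norm_def by linarith
    qed
    then show "\<exists>no. \<forall>n\<ge>no. norm (Fs n x - cdf \<mu> x) < r" by (simp add: eventually_sequentially)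
  qed
qed

lemma mono_cdf_pat_esd: "mono (cdf (pat_esd L a n))"
  using finite_borel_measure.cdf_nondecreasing[OF real_distribution.finite_borel_measure_M[OF esd_real_distribution]]
  by (auto simp: mono_def)

text \<open>
  The two matrices differ only where \<open>n \<le> i + j < N\<close>, which is at most \<open>N - n\<close> entries per row.
\<close>

lemma (in convergent_link) pad_square_distance:
  assumes K: "\<And>t. \<bar>a t\<bar> \<le> K" and nN: "0 < n" "n \<le> N"
  shows "(\<Sum>i<N. \<Sum>j<N. (tri_entry (link0 L N) N a i j -
      (if i < n \<and> j < n then tri_entry (link0 L n) n a i j else 0))\<^sup>2) \<le> K\<^sup>2 * real (N * (N - n))"
proof -
  let ?d = "\<lambda>i j. tri_entry (link0 L N) N a i j - (if i < n \<and> j < n then tri_entry (link0 L n) n a i j else 0)"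
  have inner: "(\<Sum>j<N. (?d i j)\<^sup>2) \<le> K\<^sup>2 * real (N - n)" if "i < N" for i
  proof -
    have "(?d i j)\<^sup>2 \<le> (if j \<in> {n - i..<N - i} then K\<^sup>2 else 0)" for j
    proof (cases "i + j < n")
      case True
      then have "?d i j = 0" using nN compat[of i n j N] by (auto simp: tri_entry_def)
      then show ?thesis using True by auto
    next
      case False
      then have "?d i j = (if i + j < N then a (link0 L N i j) else 0)" by (auto simp: tri_entry_def)
      moreover have "(a t)\<^sup>2 \<le> K\<^sup>2" for t using K[of t] abs_le_square_iff[of "a t" K] by auto
      ultimately show ?thesis using False by (auto split: if_splits)
    qed
    then have "(\<Sum>j<N. (?d i j)\<^sup>2) \<le> (\<Sum>j<N. if j \<in> {n - i..<N - i} then K\<^sup>2 else 0)" by (rule sum_mono)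
    also have "\<dots> = (\<Sum>j\<in>{..<N} \<inter> {n - i..<N - i}. K\<^sup>2)" by (simp only: sum.inter_restrict[OF finite_lessThan])
    also have "\<dots> = K\<^sup>2 * real (card ({..<N} \<inter> {n - i..<N - i}))" by (simp add: mult.commute)
    also have "\<dots> \<le> K\<^sup>2 * real (N - n)"
    proof (intro mult_left_mono of_nat_mono)
      have "card ({..<N} \<inter> {n - i..<N - i}) \<le> card {n - i..<N - i}" by (intro card_mono) auto
      also have "\<dots> \<le> N - n" by simp
      finally show "card ({..<N} \<inter> {n - i..<N - i}) \<le> N - n" .
    qed simp
    finally show ?thesis .
  qed
  have "(\<Sum>i<N. \<Sum>j<N. (?d i j)\<^sup>2) \<le> (\<Sum>i<N. K\<^sup>2 * real (N - n))" by (intro sum_mono inner) simp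
  then show ?thesis by (simp add: mult_ac)
qed

text \<open>
  The loss consists of the \<open>N - n\<close> eigenvalues \<open>0\<close> added by the padding, of the different normalizations
  \<open>sqrt n\<close> and \<open>sqrt N\<close>, and of the squared distance above; all are small if \<open>N / n\<close> is close to \<open>1\<close>.
\<close>

lemma (in convergent_link) cdf_interpolate:
  assumes K: "\<And>t. \<bar>a t\<bar> \<le> K" and nN: "0 < n" "n \<le> N" and \<eta>: "\<eta> > 0"
    and small: "\<bar>x\<bar> * (real (N - n) / real n) \<le> \<eta> / 2"
      "(1 + 4 * K\<^sup>2 / \<eta>\<^sup>2) * (real (N - n) / real n) \<le> \<eta>"
  shows "cdf (pat_esd L a n) x \<le> cdf (pat_esd L a N) (x + \<eta>) + \<eta>"
    "cdf (pat_esd L a N) (x - \<eta>) \<le> cdf (pat_esd L a n) x + \<eta>"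
proof -
  let ?A = "tri_entry (link0 L n) n a" and ?B = "tri_entry (link0 L N) N a"
  let ?P = "\<lambda>i j. if i < n \<and> j < n then ?A i j else 0"
  define \<rho> where "\<rho> = real (N - n) / real n"
  \<comment> \<open>half of \<open>\<eta>\<close> pays for the squared distance, the other half for the change of normalization\<close>
  define \<delta> where "\<delta> = \<eta> / 2 * sqrt (real N)"
  define y where "y = x * sqrt (real n)"
  have N: "N > 0" using nN by simp
  have \<delta>: "\<delta> > 0" using \<eta> N by (simp add: \<delta>_def)
  have \<rho>0: "\<rho> \<ge> 0" by (simp add: \<rho>_def)
  have N_eq: "real N = real n * (1 + \<rho>)" using nN by (simp add: \<rho>_def field_simps of_nat_diff)
  have symA: "?A i j = ?A j i" and symB: "?B i j = ?B j i" for i j using tri_entry_link_sym nN N by auto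
  have symP: "?P i j = ?P j i" for i j using symA[of i j] by auto
  have dist: "(\<Sum>i<N. \<Sum>j<N. (?B i j - ?P i j)\<^sup>2) / \<delta>\<^sup>2 \<le> 4 * K\<^sup>2 / \<eta>\<^sup>2 * real (N - n)"
  proof -
    have "(\<Sum>i<N. \<Sum>j<N. (?B i j - ?P i j)\<^sup>2) / \<delta>\<^sup>2 \<le> K\<^sup>2 * real (N * (N - n)) / \<delta>\<^sup>2"
      using pad_square_distance[OF K nN] by (intro divide_right_mono) auto
    also have "\<dots> = K\<^sup>2 * real (N * (N - n)) / (\<eta>\<^sup>2 / 4 * real N)"
      unfolding \<delta>_def by (simp add: power_mult_distrib power_divide)
    also have "\<dots> = 4 * K\<^sup>2 / \<eta>\<^sup>2 * real (N - n)"
      using N \<eta> by (simp add: field_simps)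
    finally show ?thesis .
  qed
  have dist': "(\<Sum>i<N. \<Sum>j<N. (?P i j - ?B i j)\<^sup>2) = (\<Sum>i<N. \<Sum>j<N. (?B i j - ?P i j)\<^sup>2)"
    by (simp only: power2_commute)
  have y: "\<bar>y - x * sqrt (real N)\<bar> \<le> \<eta> / 2 * sqrt (real N)"
  proof -
    have "sqrt (real n) \<le> sqrt (real N)" using nN by simp
    then have "\<bar>y - x * sqrt (real N)\<bar> = \<bar>x\<bar> * (sqrt (real N) - sqrt (real n))"
      unfolding y_def right_diff_distrib[symmetric] abs_mult by simp
    also have "\<dots> \<le> \<bar>x\<bar> * (\<rho> * sqrt (real N))"
    proof (rule mult_left_mono)
      have "sqrt (1 + \<rho>) \<ge> 1" using \<rho>0 by simp
      then have "sqrt (real n) * 1 \<le> sqrt (real n) * sqrt (1 + \<rho>)" by (intro mult_left_mono) auto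
      have "1 + \<rho> \<le> (1 + \<rho>)\<^sup>2" using \<rho>0 by (simp add: power2_eq_square)
      then have "sqrt (1 + \<rho>) \<le> 1 + \<rho>" using \<rho>0 by (intro real_le_lsqrt) auto
      then have "sqrt (real n) * sqrt (1 + \<rho>) \<le> sqrt (real n) * (1 + \<rho>)" by (intro mult_left_mono) auto
      then have "sqrt (real N) - sqrt (real n) \<le> \<rho> * sqrt (real n)"
        unfolding N_eq real_sqrt_mult by (simp add: algebra_simps)
      also have "\<dots> \<le> \<rho> * sqrt (real N)" using nN \<rho>0 by (intro mult_left_mono) auto
      finally show "sqrt (real N) - sqrt (real n) \<le> \<rho> * sqrt (real N)" .
    qed simp
    also have "\<dots> \<le> \<eta> / 2 * sqrt (real N)"
      using mult_right_mono[OF small(1), of "sqrt (real N)"] by (simp add: \<rho>_def mult.assoc)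
    finally show ?thesis .
  qed
  have y1: "y \<le> x * sqrt (real N) + \<eta> / 2 * sqrt (real N)"
    and y2: "x * sqrt (real N) - \<eta> / 2 * sqrt (real N) \<le> y"
    using y by linarith+
  have cn: "cdf (pat_esd L a n) x = real (eig_count n ?A y) / real n" unfolding y_def by (rule cdf_pat_esd[OF nN(1)])
  have cN: "cdf (pat_esd L a N) w = real (eig_count N ?B (w * sqrt (real N))) / real N" for w by (rule cdf_pat_esd[OF N])
  have le1: "cdf (pat_esd L a N) w \<le> 1" for w
    using real_distribution.cdf_bounded_prob[OF esd_real_distribution] .
  have S: "\<rho> + 4 * K\<^sup>2 / \<eta>\<^sup>2 * \<rho> \<le> \<eta>" using small(2) unfolding \<rho>_def by (simp add: algebra_simps)
  have nn: "cdf (pat_esd L a N) w \<ge> 0" for w unfolding cdf_def by simp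
  show "cdf (pat_esd L a n) x \<le> cdf (pat_esd L a N) (x + \<eta>) + \<eta>"
  proof -
    have "real (eig_count n ?A y) \<le> real (eig_count N ?P y)"
      using eig_count_pad(1)[of ?A n N y] symA nN by simp
    also have "\<dots> \<le> real (eig_count N ?B (y + \<delta>)) + (\<Sum>i<N. \<Sum>j<N. (?B i j - ?P i j)\<^sup>2) / \<delta>\<^sup>2"
      by (rule eig_count_square_perturb[OF symP symB \<delta>])
    also have "\<dots> \<le> real (eig_count N ?B ((x + \<eta>) * sqrt (real N))) + 4 * K\<^sup>2 / \<eta>\<^sup>2 * real (N - n)"
    proof (intro add_mono dist of_nat_mono eig_count_mono)
      show "y + \<delta> \<le> (x + \<eta>) * sqrt (real N)" using y1 unfolding \<delta>_def distrib_right by linarith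
    qed
    finally have "cdf (pat_esd L a n) x \<le> (real (eig_count N ?B ((x + \<eta>) * sqrt (real N))) + 4 * K\<^sup>2 / \<eta>\<^sup>2 * real (N - n)) / real n"
      unfolding cn by (intro divide_right_mono) auto
    also have "\<dots> = cdf (pat_esd L a N) (x + \<eta>) * (real N / real n) + 4 * K\<^sup>2 / \<eta>\<^sup>2 * \<rho>"
      unfolding cN \<rho>_def using N by (simp add: add_divide_distrib)
    also have "real N / real n = 1 + \<rho>" using N_eq nN by simp
    also have "cdf (pat_esd L a N) (x + \<eta>) * (1 + \<rho>) \<le> cdf (pat_esd L a N) (x + \<eta>) + \<rho>"
      using mult_right_mono[OF le1 \<rho>0, of "x + \<eta>"] by (simp add: algebra_simps)
    finally show ?thesis using S by linarith
  qed
  show "cdf (pat_esd L a N) (x - \<eta>) \<le> cdf (pat_esd L a n) x + \<eta>"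
  proof -
    have "real (eig_count N ?B ((x - \<eta>) * sqrt (real N))) \<le> real (eig_count N ?B (y - \<delta>))"
      using y2 unfolding \<delta>_def left_diff_distrib by (intro of_nat_mono eig_count_mono) linarith
    also have "\<dots> \<le> real (eig_count N ?P (y - \<delta> + \<delta>)) + (\<Sum>i<N. \<Sum>j<N. (?P i j - ?B i j)\<^sup>2) / \<delta>\<^sup>2"
      by (rule eig_count_square_perturb[OF symB symP \<delta>])
    also have "\<dots> \<le> real (eig_count n ?A y + (N - n)) + 4 * K\<^sup>2 / \<eta>\<^sup>2 * real (N - n)"
      unfolding dist' using eig_count_pad(2)[of ?A n N y] symA nN by (intro add_mono dist of_nat_mono) auto
    finally have "real (eig_count N ?B ((x - \<eta>) * sqrt (real N))) / real n
        \<le> (real (eig_count n ?A y + (N - n)) + 4 * K\<^sup>2 / \<eta>\<^sup>2 * real (N - n)) / real n"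
      by (rule divide_right_mono) simp
    also have "\<dots> = cdf (pat_esd L a n) x + (\<rho> + 4 * K\<^sup>2 / \<eta>\<^sup>2 * \<rho>)"
      unfolding cn \<rho>_def by (simp add: add_divide_distrib)
    also have "\<dots> \<le> cdf (pat_esd L a n) x + \<eta>" using S by simp
    finally have "real (eig_count N ?B ((x - \<eta>) * sqrt (real N))) / real n \<le> cdf (pat_esd L a n) x + \<eta>" .
    moreover have "cdf (pat_esd L a N) (x - \<eta>) \<le> real (eig_count N ?B ((x - \<eta>) * sqrt (real N))) / real n"
      unfolding cN using nN by (intro divide_left_mono) auto
    ultimately show ?thesis by simp
  qed
qed

text \<open>
  The square of \<open>Suc (next_root n)\<close> is the smallest positive square that is not below \<open>n\<close>.
\<close>

definition next_root :: "nat \<Rightarrow> nat" where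
  "next_root n = (LEAST s. n \<le> (Suc s)\<^sup>2)"

lemma next_root: "n \<le> (Suc (next_root n))\<^sup>2" "next_root n > 0 \<Longrightarrow> (next_root n)\<^sup>2 < n"
proof -
  have ex: "n \<le> (Suc n)\<^sup>2" by (simp add: power2_eq_square)
  show "n \<le> (Suc (next_root n))\<^sup>2" unfolding next_root_def by (rule LeastI[of "\<lambda>s. n \<le> (Suc s)\<^sup>2", OF ex])
  assume "next_root n > 0"
  then have "\<not> n \<le> (Suc (next_root n - 1))\<^sup>2" unfolding next_root_def by (intro not_less_Least) simp
  then show "(next_root n)\<^sup>2 < n" using \<open>next_root n > 0\<close> by simp
qed

lemma filterlim_next_root: "filterlim next_root at_top sequentially"
  unfolding filterlim_at_top
proof
  fix Z :: nat
  show "\<forall>\<^sub>F n in sequentially. Z \<le> next_root n"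
  proof (rule eventually_sequentiallyI[of "Suc (Z\<^sup>2)"])
    fix n assume n: "Suc (Z\<^sup>2) \<le> n"
    show "Z \<le> next_root n"
    proof (rule ccontr)
      assume "\<not> Z \<le> next_root n"
      then have "(Suc (next_root n))\<^sup>2 \<le> Z\<^sup>2" by (intro power_mono) auto
      then show False using next_root(1)[of n] n by linarith
    qed
  qed
qed

lemma next_square_ratio:
  "(\<lambda>n. real ((Suc (next_root n))\<^sup>2 - n) / real n) \<longlonglongrightarrow> 0"
proof (rule Lim_null_comparison)
  show "\<forall>\<^sub>F n in sequentially. norm (real ((Suc (next_root n))\<^sup>2 - n) / real n) \<le> 3 / real (next_root n)"
    using filterlim_next_root[unfolded filterlim_at_top, rule_format, of 1]
  proof eventually_elim
    case (elim n)
    let ?s = "next_root n"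
    have s: "?s\<^sup>2 < n" using next_root(2) elim by simp
    have "(Suc ?s)\<^sup>2 - n \<le> (Suc ?s)\<^sup>2 - ?s\<^sup>2" using s by (intro diff_le_mono2) simp
    also have "\<dots> \<le> 3 * ?s" using elim by (simp add: power2_eq_square)
    finally have "real ((Suc ?s)\<^sup>2 - n) \<le> 3 * real ?s" by linarith
    then have "real ((Suc ?s)\<^sup>2 - n) / real n \<le> 3 * real ?s / real (?s\<^sup>2)"
      using s elim by (intro frac_le) auto
    also have "\<dots> = 3 / real ?s" by (simp add: power2_eq_square)
    finally show ?case by simp
  qed
  have "filterlim (\<lambda>n. real (next_root n)) at_top sequentially"
    by (rule filterlim_compose[OF filterlim_real_sequentially filterlim_next_root])
  then show "(\<lambda>n. 3 / real (next_root n)) \<longlonglongrightarrow> 0"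
    by (intro tendsto_divide_0[OF tendsto_const] filterlim_at_top_imp_at_infinity)
qed

lemma (in convergent_link) weak_conv_of_squares:
  assumes K: "\<And>t. \<bar>a t\<bar> \<le> K" and \<mu>: "real_distribution \<mu>"
    and sq: "weak_conv_m (\<lambda>m. pat_esd L a ((Suc m)\<^sup>2)) \<mu>"
  shows "weak_conv_m (pat_esd L a) \<mu>"
  unfolding weak_conv_m_def
proof (rule weak_conv_of_levy_close[OF \<mu>], intro exI conjI allI)
  fix \<eta> :: real assume \<eta>: "\<eta> > 0"
  let ?N = "\<lambda>n. (Suc (next_root n))\<^sup>2"
  show "weak_conv (\<lambda>n. cdf (pat_esd L a (?N n))) (cdf \<mu>)"
    unfolding weak_conv_def
  proof (intro allI impI)
    fix x assume "isCont (cdf \<mu>) x"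
    then have "(\<lambda>m. cdf (pat_esd L a ((Suc m)\<^sup>2)) x) \<longlonglongrightarrow> cdf \<mu> x"
      using sq by (simp add: weak_conv_m_def weak_conv_def)
    from filterlim_compose[OF this filterlim_next_root]
    show "(\<lambda>n. cdf (pat_esd L a (?N n)) x) \<longlonglongrightarrow> cdf \<mu> x" .
  qed
  show "mono (cdf (pat_esd L a (?N n)))" for n by (rule mono_cdf_pat_esd)
  fix x
  have lim: "(\<lambda>n. \<bar>x\<bar> * (real (?N n - n) / real n)) \<longlonglongrightarrow> 0" "(\<lambda>n. (1 + 4 * K\<^sup>2 / \<eta>\<^sup>2) * (real (?N n - n) / real n)) \<longlonglongrightarrow> 0"
    by (intro tendsto_mult_right_zero next_square_ratio)+
  have "\<forall>\<^sub>F n in sequentially. \<bar>x\<bar> * (real (?N n - n) / real n) < \<eta> / 2"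
    "\<forall>\<^sub>F n in sequentially. (1 + 4 * K\<^sup>2 / \<eta>\<^sup>2) * (real (?N n - n) / real n) < \<eta>"
    using order_tendstoD(2)[OF lim(1), of "\<eta> / 2"] order_tendstoD(2)[OF lim(2), of \<eta>] \<eta> by simp_all
  with eventually_gt_at_top[of 0]
  show "\<forall>\<^sub>F n in sequentially. cdf (pat_esd L a n) x \<le> cdf (pat_esd L a (?N n)) (x + \<eta>) + \<eta> \<and>
      cdf (pat_esd L a (?N n)) (x - \<eta>) \<le> cdf (pat_esd L a n) x + \<eta>"
  proof eventually_elim
    case (elim n)
    then show ?case
      using cdf_interpolate[OF K, of n "?N n" \<eta> x] next_root(1)[of n] \<eta> by auto
  qed
qed

lemma (in patterned_input) AE_weak_conv:
  assumes \<mu>: "real_distribution \<mu>" "\<And>r::nat. integrable \<mu> (\<lambda>x. x ^ r)" "\<And>r. (\<integral>x. x ^ r \<partial>\<mu>) = limit_moment L r"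
  shows "AE \<omega> in M. weak_conv_m (pat_esd L (\<lambda>t. z t \<omega>)) \<mu>"
  using AE_weak_conv_squares[OF \<mu>] AE_space
  by eventually_elim (rule weak_conv_of_squares[OF bounded \<mu>(1)])

section \<open>Almost sure control of large inputs along powers of two\<close>

text \<open>
  The powers of two below \<open>y\<close> sum to less than twice the largest of them.
\<close>

lemma sum_geometric_dyadic_large:
  fixes y :: real
  assumes y: "0 \<le> y"
  shows "(\<Sum>m<n. if y > 2 ^ m then (2::real) ^ m else 0) \<le> 2 * y"
proof -
  have *: "(\<Sum>m<n. if y > 2 ^ m then (2::real) ^ m else 0) \<le> 2 * y \<and> (\<Sum>m<n. if y > 2 ^ m then (2::real) ^ m else 0) < 2 ^ n"
  proof (induction n)
    case (Suc n)
    let ?S = "\<Sum>m<n. if y > 2 ^ m then (2::real) ^ m else 0"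
    have S: "?S \<le> 2 * y" "?S < 2 ^ n" using Suc.IH by auto
    have p: "(0::real) < 2 ^ n" by simp
    show ?case
    proof (cases "y > 2 ^ n")
      case True
      then have "(\<Sum>m<Suc n. if y > 2 ^ m then (2::real) ^ m else 0) = ?S + 2 ^ n" by simp
      then show ?thesis using S True unfolding power_Suc by linarith
    next
      case False
      then have "(\<Sum>m<Suc n. if y > 2 ^ m then (2::real) ^ m else 0) = ?S" by simp
      then show ?thesis using S p unfolding power_Suc by linarith
    qed
  qed (use y in auto)
  then show ?thesis by blast
qed

lemma sum_geometric_dyadic_small:
  fixes y :: real
  assumes y: "0 \<le> y"
  shows "(\<Sum>m<n. if y \<le> 2 ^ m then y\<^sup>2 / 2 ^ m else 0) \<le> 2 * y"
proof -
  \<comment> \<open>once the threshold is passed the terms form a geometric progression\<close>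
  have *: "(\<Sum>m<n. if y \<le> 2 ^ m then y\<^sup>2 / 2 ^ m else 0) \<le> (if n > 0 \<and> y \<le> 2 ^ (n - 1) then 2 * y - y\<^sup>2 / 2 ^ (n - 1) else 0)"
  proof (induction n)
    case (Suc n)
    show ?case
    proof (cases "y \<le> 2 ^ n")
      case True
      have sq: "y\<^sup>2 / 2 ^ n \<le> y" using True y by (simp add: power2_eq_square pos_divide_le_eq mult_left_mono)
      show ?thesis
      proof (cases "n > 0 \<and> y \<le> 2 ^ (n - 1)")
        case True': True
        then obtain k where k: "n = Suc k" by (cases n) auto
        have "y\<^sup>2 / 2 ^ k = 2 * (y\<^sup>2 / 2 ^ n)" unfolding k by simp
        then show ?thesis using Suc.IH True True' k by simp
      next
        case False
        have "(\<Sum>m<n. if y \<le> 2 ^ m then y\<^sup>2 / 2 ^ m else 0) \<le> 0" using Suc.IH unfolding if_not_P[OF False] .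
        then show ?thesis using True sq by simp
      qed
    next
      case False
      have n: "\<not> (n > 0 \<and> y \<le> 2 ^ (n - 1))"
      proof
        assume *: "n > 0 \<and> y \<le> 2 ^ (n - 1)"
        have "(2::real) ^ (n - 1) \<le> 2 ^ n" by (intro power_increasing) auto
        then show False using * False by linarith
      qed
      have "(\<Sum>m<n. if y \<le> 2 ^ m then y\<^sup>2 / 2 ^ m else 0) \<le> 0" using Suc.IH unfolding if_not_P[OF n] .
      then show ?thesis using False by simp
    qed
  qed simp
  have "0 \<le> y\<^sup>2 / 2 ^ (n - 1)" by simp
  then have "(if n > 0 \<and> y \<le> 2 ^ (n - 1) then 2 * y - y\<^sup>2 / 2 ^ (n - 1) else 0) \<le> 2 * y" using y by simp
  with * show ?thesis by (rule order_trans)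
qed

definition tri_pairs :: "nat \<Rightarrow> (nat \<times> nat) set" where
  "tri_pairs n = {(x, y). x + y < n}"

lemma tri_pairs_subset: "tri_pairs n \<subseteq> {..<n} \<times> {..<n}"
  by (auto simp: tri_pairs_def)

lemma finite_tri_pairs: "finite (tri_pairs n)"
  using tri_pairs_subset by (rule finite_subset) simp

lemma card_tri_pairs: "card (tri_pairs n) \<le> n\<^sup>2"
  using card_mono[OF _ tri_pairs_subset[of n]] by (simp add: power2_eq_square)

text \<open>
  Each of the at most \<open>n\<^sup>2\<close> entries shares its label with at most \<open>D\<close> entries of each row.
\<close>

lemma card_equal_label_pairs:
  assumes l: "thin_link n l D"
  shows "card {(p, q) \<in> tri_pairs n \<times> tri_pairs n. case_prod l p = case_prod l q} \<le> n ^ 3 * D"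
proof -
  let ?Q = "\<lambda>p. {q \<in> tri_pairs n. case_prod l q = case_prod l p}"
  have row: "card (?Q p) \<le> n * D" for p
  proof -
    have "?Q p \<subseteq> (\<lambda>(y, x). (x, y)) ` (SIGMA y:{..<n}. {x. x + y < n \<and> l x y = case_prod l p})"
      by (auto simp: tri_pairs_def image_iff)
    moreover have fin: "finite {x. x + y < n \<and> l x y = t}" for y t
      by (rule finite_subset[of _ "{..<n}"]) auto
    ultimately have "card (?Q p) \<le> card (SIGMA y:{..<n}. {x. x + y < n \<and> l x y = case_prod l p})"
      by (intro surj_card_le) auto
    also have "\<dots> = (\<Sum>y<n. card {x. x + y < n \<and> l x y = case_prod l p})" using fin by (intro card_SigmaI) auto
    also have "\<dots> \<le> (\<Sum>y<n. D)" using l by (intro sum_mono) (auto simp: thin_link_def)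
    finally show ?thesis by simp
  qed
  have "{(p, q) \<in> tri_pairs n \<times> tri_pairs n. case_prod l p = case_prod l q} = (SIGMA p:tri_pairs n. ?Q p)" by auto
  also have "card \<dots> = (\<Sum>p\<in>tri_pairs n. card (?Q p))" using finite_tri_pairs by (intro card_SigmaI) auto
  also have "\<dots> \<le> (\<Sum>p\<in>tri_pairs n. n * D)" by (intro sum_mono row)
  also have "\<dots> = card (tri_pairs n) * (n * D)" by simp
  also have "\<dots> \<le> n\<^sup>2 * (n * D)" by (intro mult_right_mono card_tri_pairs) simp
  finally show ?thesis by (simp add: power2_eq_square power3_eq_cube mult_ac)
qed

text \<open>
  Only pairs of entries with the same label are correlated.
\<close>

lemma (in prob_space) variance_label_sum:
  fixes y :: "'t \<Rightarrow> 'a \<Rightarrow> real"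
  assumes l: "thin_link n l D" and ind: "indep_vars (\<lambda>_. borel) y UNIV"
    and int: "\<And>t. integrable M (\<lambda>\<omega>. (y t \<omega>)\<^sup>2)" and b: "\<And>t. expectation (\<lambda>\<omega>. (y t \<omega>)\<^sup>2) \<le> b"
  shows "integrable M (\<lambda>\<omega>. (\<Sum>p\<in>tri_pairs n. y (case_prod l p) \<omega> - expectation (y (case_prod l p)))\<^sup>2)"
    "expectation (\<lambda>\<omega>. (\<Sum>p\<in>tri_pairs n. y (case_prod l p) \<omega> - expectation (y (case_prod l p)))\<^sup>2) \<le> real (n ^ 3 * D) * b"
proof -
  let ?P = "tri_pairs n"
  define c where "c t \<omega> = y t \<omega> - expectation (y t)" for t \<omega>
  have rv[measurable]: "random_variable borel (y t)" for t using ind unfolding indep_vars_def by auto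
  have int1: "integrable M (y t)" for t by (rule square_integrable_imp_integrable[OF rv int])
  have intc: "integrable M (c t)" for t unfolding c_def[abs_def] using int1 by simp
  have c0: "expectation (c t) = 0" for t unfolding c_def[abs_def] using int1 by (simp add: prob_space)
  have indc: "indep_vars (\<lambda>_. borel) c UNIV"
    using indep_vars_compose2[OF ind, of "\<lambda>t x. x - expectation (y t)" "\<lambda>_. borel"] by (simp add: c_def[abs_def])
  have int_eq: "integrable M (\<lambda>\<omega>. c s \<omega> * c t \<omega>) \<and> expectation (\<lambda>\<omega>. c s \<omega> * c t \<omega>) \<le> (if s = t then b else 0)" for s t
  proof (cases "s = t")
    case True
    have "integrable M (\<lambda>\<omega>. (c t \<omega>)\<^sup>2)" unfolding c_def power2_diff using int int1 by simp
    moreover have "expectation (\<lambda>\<omega>. (c t \<omega>)\<^sup>2) \<le> b"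
    proof -
      have "expectation (\<lambda>\<omega>. (c t \<omega>)\<^sup>2) = expectation (\<lambda>\<omega>. (y t \<omega>)\<^sup>2) - (expectation (y t))\<^sup>2"
        unfolding c_def by (rule variance_eq[OF int1 int])
      then show ?thesis using b[of t] zero_le_power2[of "expectation (y t)"] by linarith
    qed
    ultimately show ?thesis using True by (simp add: power2_eq_square)
  next
    case False
    have i2: "indep_vars (\<lambda>_. borel) c {s, t}" by (rule indep_vars_subset[OF indc]) simp
    show ?thesis
      using indep_vars_integrable[OF _ i2 intc] indep_vars_lebesgue_integral[OF _ i2 intc] False c0 by simp
  qed
  have sq: "(\<Sum>p\<in>?P. c (case_prod l p) \<omega>)\<^sup>2 = (\<Sum>p\<in>?P. \<Sum>q\<in>?P. c (case_prod l p) \<omega> * c (case_prod l q) \<omega>)" for \<omega>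
    by (simp only: power2_eq_square sum_product)
  show "integrable M (\<lambda>\<omega>. (\<Sum>p\<in>tri_pairs n. y (case_prod l p) \<omega> - expectation (y (case_prod l p)))\<^sup>2)"
    unfolding c_def[symmetric] sq using int_eq by (intro Bochner_Integration.integrable_sum) blast
  have "expectation (\<lambda>\<omega>. (\<Sum>p\<in>?P. c (case_prod l p) \<omega>)\<^sup>2) = (\<Sum>p\<in>?P. \<Sum>q\<in>?P. expectation (\<lambda>\<omega>. c (case_prod l p) \<omega> * c (case_prod l q) \<omega>))"
    unfolding sq using int_eq by (simp add: Bochner_Integration.integral_sum Bochner_Integration.integrable_sum)
  also have "\<dots> \<le> (\<Sum>p\<in>?P. \<Sum>q\<in>?P. if case_prod l p = case_prod l q then b else 0)"
    using int_eq by (intro sum_mono) blast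
  also have "\<dots> = (\<Sum>pq\<in>?P \<times> ?P. if case_prod l (fst pq) = case_prod l (snd pq) then b else 0)"
    by (simp add: sum.cartesian_product case_prod_beta)
  also have "\<dots> = (\<Sum>pq\<in>{(p, q) \<in> ?P \<times> ?P. case_prod l p = case_prod l q}. b)"
    by (rule sum.mono_neutral_cong_right) (auto simp: finite_tri_pairs)
  also have "\<dots> = real (card {(p, q) \<in> ?P \<times> ?P. case_prod l p = case_prod l q}) * b" by simp
  also have "\<dots> \<le> real (n ^ 3 * D) * b"
  proof (intro mult_right_mono of_nat_mono card_equal_label_pairs l)
    have "0 \<le> expectation (\<lambda>\<omega>. (y t \<omega>)\<^sup>2)" for t by simp
    then show "0 \<le> b" using b order_trans by blast
  qed
  finally show "expectation (\<lambda>\<omega>. (\<Sum>p\<in>tri_pairs n. y (case_prod l p) \<omega> - expectation (y (case_prod l p)))\<^sup>2) \<le> real (n ^ 3 * D) * b"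
    unfolding c_def .
qed

text \<open>
  The squared difference \<open>y\<close> between an input and its bounded approximation. The bounds \<open>p\<close> and \<open>q\<close> are
  uniform in the index; they exist both for identically distributed inputs and for inputs with
  uniformly bounded moments, so that the two cases of the theorem are treated together from here on.
\<close>

locale small_tail = prob_space M for M :: "'a measure" +
  fixes y :: "'t \<Rightarrow> 'a \<Rightarrow> real" and p q :: "nat \<Rightarrow> real" and \<delta> :: real
  assumes indep_y: "indep_vars (\<lambda>_. borel) y UNIV"
    and nonneg_y: "\<And>t \<omega>. 0 \<le> y t \<omega>"
    and int_y: "\<And>t. integrable M (y t)" and mean_y: "\<And>t. expectation (y t) \<le> \<delta>"
    and tail: "\<And>t m. prob {\<omega> \<in> space M. y t \<omega> > 2 ^ m} \<le> p m" and tail_sum: "summable (\<lambda>m. 2 ^ m * p m)"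
    and trunc: "\<And>t m. expectation (\<lambda>\<omega>. if y t \<omega> \<le> 2 ^ m then (y t \<omega>)\<^sup>2 else 0) \<le> q m"
    and trunc_sum: "summable (\<lambda>m. q m / 2 ^ m)"
begin

definition big_count :: "(nat \<Rightarrow> nat \<Rightarrow> nat \<Rightarrow> 't) \<Rightarrow> nat \<Rightarrow> 'a \<Rightarrow> real" where
  "big_count l m \<omega> = (\<Sum>e\<in>tri_pairs (2 ^ m). if y (case_prod (l (2 ^ m)) e) \<omega> > 2 ^ m then 1 else 0)"

definition small_sum :: "(nat \<Rightarrow> nat \<Rightarrow> nat \<Rightarrow> 't) \<Rightarrow> nat \<Rightarrow> 'a \<Rightarrow> real" where
  "small_sum l m \<omega> = (\<Sum>e\<in>tri_pairs (2 ^ m). if y (case_prod (l (2 ^ m)) e) \<omega> \<le> 2 ^ m then y (case_prod (l (2 ^ m)) e) \<omega> else 0)"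

lemma rv_y [measurable]: "random_variable borel (y t)"
  using indep_y unfolding indep_vars_def by auto

text \<open>
  The expected number of entries with \<open>y > 2\<^sup>m\<close>, divided by the size \<open>2\<^sup>m\<close>, is at most \<open>2\<^sup>m p m\<close>.
\<close>

lemma AE_big_count: "AE \<omega> in M. (\<lambda>m. big_count l m \<omega> / 2 ^ m) \<longlonglongrightarrow> 0"
proof (rule AE_tendsto_0_of_summable_expectation)
  have ind: "integrable M (\<lambda>\<omega>. if y t \<omega> > 2 ^ m then 1 else 0 :: real)" for t m
    by (rule integrable_const_bound[of _ 1]) auto
  show "integrable M (\<lambda>\<omega>. big_count l m \<omega> / 2 ^ m)" for m
    unfolding big_count_def using ind by (intro integrable_divide Bochner_Integration.integrable_sum)
  show "0 \<le> big_count l m \<omega> / 2 ^ m" for m \<omega> unfolding big_count_def by (intro divide_nonneg_pos sum_nonneg) auto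
  show "summable (\<lambda>m. expectation (\<lambda>\<omega>. big_count l m \<omega> / 2 ^ m))"
  proof (rule summable_comparison_test'[OF tail_sum])
    fix m :: nat
    have p0: "0 \<le> p m" using order_trans[OF measure_nonneg tail[of m undefined]] .
    have e: "expectation (\<lambda>\<omega>. if y t \<omega> > 2 ^ m then 1 else 0 :: real) \<le> p m" for t
    proof -
      have "expectation (\<lambda>\<omega>. if y t \<omega> > 2 ^ m then 1 else 0 :: real) = expectation (indicator {\<omega> \<in> space M. y t \<omega> > 2 ^ m})"
        by (intro Bochner_Integration.integral_cong) (auto simp: indicator_def)
      also have "\<dots> = prob {\<omega> \<in> space M. y t \<omega> > 2 ^ m}" by simp
      finally show ?thesis using tail[of m t] by simp
    qed
    have "expectation (big_count l m) = (\<Sum>e\<in>tri_pairs (2 ^ m). expectation (\<lambda>\<omega>. if y (case_prod (l (2 ^ m)) e) \<omega> > 2 ^ m then 1 else 0))"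
      unfolding big_count_def[abs_def] using ind by (intro Bochner_Integration.integral_sum)
    also have "\<dots> \<le> (\<Sum>e\<in>tri_pairs (2 ^ m). p m)" by (intro sum_mono e)
    also have "\<dots> \<le> (2 ^ m)\<^sup>2 * p m"
      using mult_right_mono[OF of_nat_mono[OF card_tri_pairs[of "2 ^ m"]] p0] by simp
    finally have "expectation (\<lambda>\<omega>. big_count l m \<omega> / 2 ^ m) \<le> 2 ^ m * p m"
      by (simp add: pos_divide_le_eq power2_eq_square mult_ac)
    moreover have "0 \<le> expectation (\<lambda>\<omega>. big_count l m \<omega> / 2 ^ m)"
      unfolding big_count_def by (intro Bochner_Integration.integral_nonneg divide_nonneg_pos sum_nonneg) auto
    ultimately show "norm (expectation (\<lambda>\<omega>. big_count l m \<omega> / 2 ^ m)) \<le> 2 ^ m * p m" by simp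
  qed
qed

text \<open>
  The variance of the sum, divided by the fourth power of the size, is at most \<open>D q m / 2\<^sup>m\<close>.
\<close>

lemma AE_small_sum:
  assumes l: "\<And>n. n > 0 \<Longrightarrow> thin_link n (l n) D" and \<delta>: "\<delta> < \<delta>'"
  shows "AE \<omega> in M. eventually (\<lambda>m. small_sum l m \<omega> \<le> \<delta>' * (2 ^ m)\<^sup>2) sequentially"
proof -
  define c where "c m t \<omega> = (if y t \<omega> \<le> 2 ^ m then y t \<omega> else 0)" for m t \<omega>
  have sq: "(c m t \<omega>)\<^sup>2 = (if y t \<omega> \<le> 2 ^ m then (y t \<omega>)\<^sup>2 else 0)" for m t \<omega> by (simp add: c_def)
  have rvc[measurable]: "random_variable borel (c m t)" for m t unfolding c_def[abs_def] by measurable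
  have intc: "integrable M (c m t)" for m t
    by (rule Bochner_Integration.integrable_bound[OF int_y[of t] rvc]) (use nonneg_y in \<open>auto simp: c_def\<close>)
  have meanc: "expectation (c m t) \<le> \<delta>" for m t
  proof -
    have "expectation (c m t) \<le> expectation (y t)"
      using nonneg_y by (intro integral_mono intc int_y) (auto simp: c_def)
    then show ?thesis using mean_y[of t] by simp
  qed
  have int2: "integrable M (\<lambda>\<omega>. (c m t \<omega>)\<^sup>2)" for m t
    by (rule integrable_const_bound[of _ "(2 ^ m)\<^sup>2"]) (use nonneg_y in \<open>auto simp: c_def power_mono\<close>)
  have indc: "indep_vars (\<lambda>_. borel) (c m) UNIV" for m
  proof -
    have "(\<lambda>x::real. if x \<le> 2 ^ m then x else 0) \<in> borel_measurable borel" by measurable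
    then show ?thesis
      using indep_vars_compose2[OF indep_y, of "\<lambda>_ x. if x \<le> 2 ^ m then x else 0" "\<lambda>_. borel"]
      by (simp add: c_def[abs_def])
  qed
  define S where "S m \<omega> = (\<Sum>e\<in>tri_pairs (2 ^ m). c m (case_prod (l (2 ^ m)) e) \<omega> - expectation (c m (case_prod (l (2 ^ m)) e)))" for m \<omega>
  have b: "expectation (\<lambda>\<omega>. (c m t \<omega>)\<^sup>2) \<le> q m" for m t unfolding sq by (rule trunc)
  have V: "integrable M (\<lambda>\<omega>. (S m \<omega>)\<^sup>2)" "expectation (\<lambda>\<omega>. (S m \<omega>)\<^sup>2) \<le> real ((2 ^ m) ^ 3 * D) * q m" for m
    unfolding S_def
    by (rule variance_label_sum(1)[OF l indc int2 b] variance_label_sum(2)[OF l indc int2 b], simp)+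
  have "AE \<omega> in M. (\<lambda>m. (S m \<omega> / (2 ^ m)\<^sup>2)\<^sup>2) \<longlonglongrightarrow> 0"
  proof (rule AE_tendsto_0_of_summable_expectation)
    show "integrable M (\<lambda>\<omega>. (S m \<omega> / (2 ^ m)\<^sup>2)\<^sup>2)" for m unfolding power_divide using V(1) by (intro integrable_divide)
    show "summable (\<lambda>m. expectation (\<lambda>\<omega>. (S m \<omega> / (2 ^ m)\<^sup>2)\<^sup>2))"
    proof (rule summable_comparison_test'[OF summable_mult[OF trunc_sum, of "real D"]])
      fix m :: nat
      have "expectation (\<lambda>\<omega>. (S m \<omega> / (2 ^ m)\<^sup>2)\<^sup>2) = expectation (\<lambda>\<omega>. (S m \<omega>)\<^sup>2) / (2 ^ m) ^ 4"
        by (simp add: power_divide)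
      also have "\<dots> \<le> real ((2 ^ m) ^ 3 * D) * q m / (2 ^ m) ^ 4" by (intro divide_right_mono V) simp
      also have "\<dots> = real D * (q m / 2 ^ m)"
      proof -
        have "((2::real) ^ m) ^ 4 = (2 ^ m) ^ 3 * 2 ^ m" by (simp add: eval_nat_numeral)
        then show ?thesis by (simp add: field_simps)
      qed
      finally show "norm (expectation (\<lambda>\<omega>. (S m \<omega> / (2 ^ m)\<^sup>2)\<^sup>2)) \<le> real D * (q m / 2 ^ m)" by simp
    qed
  qed simp
  then show ?thesis
  proof eventually_elim
    case (elim \<omega>)
    have "(\<lambda>m. \<bar>S m \<omega> / (2 ^ m)\<^sup>2\<bar>) \<longlonglongrightarrow> 0"
      using tendsto_real_sqrt[OF elim] by simp
    then have "eventually (\<lambda>m. \<bar>S m \<omega> / (2 ^ m)\<^sup>2\<bar> < \<delta>' - \<delta>) sequentially"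
      using \<delta> by (intro order_tendstoD(2)) auto
    then show ?case
    proof eventually_elim
      case (elim m)
      have d0: "0 \<le> \<delta>" using order_trans[OF Bochner_Integration.integral_nonneg mean_y] nonneg_y by blast
      have "S m \<omega> / (2 ^ m)\<^sup>2 < \<delta>' - \<delta>" using elim abs_ge_self[of "S m \<omega> / (2 ^ m)\<^sup>2"] by linarith
      then have "S m \<omega> < (\<delta>' - \<delta>) * (2 ^ m)\<^sup>2" by (simp add: pos_divide_less_eq)
      moreover have "(\<Sum>e\<in>tri_pairs (2 ^ m). expectation (c m (case_prod (l (2 ^ m)) e))) \<le> \<delta> * (2 ^ m)\<^sup>2"
      proof -
        have "(\<Sum>e\<in>tri_pairs (2 ^ m). expectation (c m (case_prod (l (2 ^ m)) e))) \<le> real (card (tri_pairs (2 ^ m))) * \<delta>"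
          using meanc by (intro sum_bounded_above) auto
        also have "\<dots> \<le> real ((2 ^ m)\<^sup>2) * \<delta>" by (intro mult_right_mono of_nat_mono card_tri_pairs d0)
        finally show ?thesis by (simp add: mult.commute)
      qed
      moreover have "small_sum l m \<omega> = S m \<omega> + (\<Sum>e\<in>tri_pairs (2 ^ m). expectation (c m (case_prod (l (2 ^ m)) e)))"
        by (simp add: small_sum_def S_def c_def sum_subtractf)
      ultimately show ?case by (simp add: algebra_simps)
    qed
  qed
qed

end

section \<open>Comparison with bounded inputs\<close>

text \<open>
  The rows and columns that contain an entry with \<open>y > N\<close> are exchanged first, at the price of their number;
  what remains is close in Hilbert-Schmidt norm. The hypotheses are about size \<open>N\<close> and the conclusion
  about size \<open>n\<close>: the triangle of size \<open>n\<close> is part of that of size \<open>N\<close> and has the same labels.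
\<close>

lemma (in convergent_link) cdf_levy_close_of_square_close:
  fixes a b :: "int ^ 'd \<Rightarrow> real"
  defines "y \<equiv> \<lambda>t. (a t - b t)\<^sup>2"
  assumes nN: "0 < n" "n \<le> N" "N \<le> 2 * n" and \<eta>: "\<eta> > 0"
    and V: "(\<Sum>e\<in>tri_pairs N. if y (case_prod (link0 L N) e) \<le> real N then y (case_prod (link0 L N) e) else 0) \<le> \<eta> ^ 3 / 8 * (real N)\<^sup>2"
    and R: "(\<Sum>e\<in>tri_pairs N. if y (case_prod (link0 L N) e) > real N then 1 else 0) \<le> \<eta> / 4 * real N"
  shows "cdf (pat_esd L a n) x \<le> cdf (pat_esd L b n) (x + \<eta>) + \<eta>"
    "cdf (pat_esd L b n) (x - \<eta>) \<le> cdf (pat_esd L a n) x + \<eta>"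
proof -
  let ?l = "link0 L n"
  let ?A = "tri_entry ?l n a" and ?B = "tri_entry ?l n b"
  define Bad where "Bad = {(i, j) \<in> tri_pairs n. y (?l i j) > real N}"
  define S where "S = fst ` Bad"
  \<comment> \<open>the matrix of \<open>a\<close> with the bad rows and columns taken from \<open>b\<close>\<close>
  define C where "C i j = (if i \<in> S \<or> j \<in> S then ?B i j else ?A i j)" for i j
  define \<delta> where "\<delta> = \<eta> * sqrt (real n)"
  have \<delta>: "\<delta> > 0" using \<eta> nN by (simp add: \<delta>_def)
  have same: "link0 L N i j = ?l i j" if "(i, j) \<in> tri_pairs n" for i j
    using that nN by (intro compat) (auto simp: tri_pairs_def)
  have sub: "tri_pairs n \<subseteq> tri_pairs N" using nN by (auto simp: tri_pairs_def)
  have finB: "finite Bad" unfolding Bad_def by (rule finite_subset[OF _ finite_tri_pairs[of n]]) auto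
  have symA: "?A i j = ?A j i" and symB: "?B i j = ?B j i" for i j using tri_entry_link_sym nN by auto
  have symC: "C i j = C j i" for i j unfolding C_def using symA[of i j] symB[of i j] by auto
  have S_sub: "S \<subseteq> {..<n}" by (auto simp: S_def Bad_def tri_pairs_def)
  have cardS: "real (card S) \<le> \<eta> / 4 * real N"
  proof -
    have "card S \<le> card Bad" unfolding S_def using finB by (rule card_image_le)
    then have "real (card S) \<le> (\<Sum>e\<in>Bad. 1)" by simp
    also have "\<dots> \<le> (\<Sum>e\<in>tri_pairs N. if y (case_prod (link0 L N) e) > real N then 1 else 0)"
    proof -
      have "(\<Sum>e\<in>Bad. 1) = (\<Sum>e\<in>Bad. if y (case_prod (link0 L N) e) > real N then 1 else (0::real))"
        by (intro sum.cong refl) (auto simp: Bad_def same)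
      also have "\<dots> \<le> (\<Sum>e\<in>tri_pairs N. if y (case_prod (link0 L N) e) > real N then 1 else 0)"
        using sub by (intro sum_mono2 finite_tri_pairs) (auto simp: Bad_def)
      finally show ?thesis .
    qed
    finally show ?thesis using R by simp
  qed
  have HS: "(\<Sum>i<n. \<Sum>j<n. (C i j - ?B i j)\<^sup>2) \<le> \<eta> ^ 3 / 8 * (real N)\<^sup>2"
  proof -
    have "(\<Sum>i<n. \<Sum>j<n. (C i j - ?B i j)\<^sup>2) = (\<Sum>e\<in>{..<n} \<times> {..<n}. (C (fst e) (snd e) - ?B (fst e) (snd e))\<^sup>2)"
      by (simp add: sum.cartesian_product case_prod_beta)
    also have "\<dots> = (\<Sum>e\<in>tri_pairs n. (C (fst e) (snd e) - ?B (fst e) (snd e))\<^sup>2)"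
      using tri_pairs_subset by (intro sum.mono_neutral_right) (auto simp: C_def tri_entry_def tri_pairs_def)
    also have "\<dots> \<le> (\<Sum>e\<in>tri_pairs n. if y (case_prod (link0 L N) e) \<le> real N then y (case_prod (link0 L N) e) else 0)"
    proof (rule sum_mono)
      fix e assume e: "e \<in> tri_pairs n"
      obtain i j where ij: "e = (i, j)" by (cases e)
      have t: "i + j < n" using e ij by (simp add: tri_pairs_def)
      show "(C (fst e) (snd e) - ?B (fst e) (snd e))\<^sup>2 \<le> (if y (case_prod (link0 L N) e) \<le> real N then y (case_prod (link0 L N) e) else 0)"
      proof (cases "y (?l i j) \<le> real N")
        case True
        then show ?thesis using e t same[of i j] unfolding ij by (auto simp: C_def tri_entry_def y_def)
      next
        case False
        then have "i \<in> S" using e unfolding ij S_def Bad_def by force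
        then show ?thesis using False e same[of i j] unfolding ij by (simp add: C_def)
      qed
    qed
    also have "\<dots> \<le> (\<Sum>e\<in>tri_pairs N. if y (case_prod (link0 L N) e) \<le> real N then y (case_prod (link0 L N) e) else 0)"
      using sub by (intro sum_mono2 finite_tri_pairs) (auto simp: y_def)
    finally show ?thesis using V by simp
  qed
  have HS': "(\<Sum>i<n. \<Sum>j<n. (?B i j - C i j)\<^sup>2) = (\<Sum>i<n. \<Sum>j<n. (C i j - ?B i j)\<^sup>2)"
    by (simp only: power2_commute)
  have err: "(\<Sum>i<n. \<Sum>j<n. (C i j - ?B i j)\<^sup>2) / \<delta>\<^sup>2 + real (card S) \<le> \<eta> * real n"
  proof -
    have N4: "(real N)\<^sup>2 \<le> 4 * (real n)\<^sup>2" using power_mono[of "real N" "2 * real n" 2] nN by (simp add: power_mult_distrib)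
    have "(\<Sum>i<n. \<Sum>j<n. (C i j - ?B i j)\<^sup>2) / \<delta>\<^sup>2 \<le> (\<eta> ^ 3 / 8 * (4 * (real n)\<^sup>2)) / \<delta>\<^sup>2"
      using HS N4 \<eta> by (intro divide_right_mono order_trans[OF HS] mult_left_mono) auto
    also have "\<dots> = \<eta> / 2 * real n"
      using \<eta> nN unfolding \<delta>_def by (simp add: power_mult_distrib power2_eq_square power3_eq_cube)
    finally have 1: "(\<Sum>i<n. \<Sum>j<n. (C i j - ?B i j)\<^sup>2) / \<delta>\<^sup>2 \<le> \<eta> / 2 * real n" .
    have "\<eta> / 4 * real N \<le> \<eta> / 4 * (2 * real n)" using nN \<eta> by (intro mult_left_mono) auto
    then have "real (card S) \<le> \<eta> / 2 * real n" using cardS by simp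
    with 1 show ?thesis by (simp add: field_simps)
  qed
  define w where "w = x * sqrt (real n)"
  have c: "cdf (pat_esd L f n) v = real (eig_count n (tri_entry ?l n f) (v * sqrt (real n))) / real n" for f v
    by (rule cdf_pat_esd[OF nN(1)])
  have eqS: "?A i j = C i j" if "i \<notin> S" "j \<notin> S" for i j using that by (simp add: C_def)
  have n0: "real n > 0" using nN by simp
  show "cdf (pat_esd L a n) x \<le> cdf (pat_esd L b n) (x + \<eta>) + \<eta>"
  proof -
    have "eig_count n ?A w \<le> eig_count n C w + card S"
      by (rule eig_count_rank_perturb[OF symA symC S_sub]) (rule eqS)
    then have "real (eig_count n ?A w) \<le> real (eig_count n C w) + real (card S)" by linarith
    also have "real (eig_count n C w) \<le> real (eig_count n ?B (w + \<delta>)) + (\<Sum>i<n. \<Sum>j<n. (?B i j - C i j)\<^sup>2) / \<delta>\<^sup>2"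
      by (rule eig_count_square_perturb[OF symC symB \<delta>])
    finally have "real (eig_count n ?A w) \<le> real (eig_count n ?B (w + \<delta>)) + \<eta> * real n" using err unfolding HS' by linarith
    then have "real (eig_count n ?A w) / real n \<le> (real (eig_count n ?B (w + \<delta>)) + \<eta> * real n) / real n"
      using n0 by (intro divide_right_mono) auto
    then show ?thesis using n0 unfolding c w_def \<delta>_def distrib_right by (simp add: add_divide_distrib)
  qed
  show "cdf (pat_esd L b n) (x - \<eta>) \<le> cdf (pat_esd L a n) x + \<eta>"
  proof -
    have "eig_count n C w \<le> eig_count n ?A w + card S"
      by (rule eig_count_rank_perturb[OF symC symA S_sub]) (rule eqS[symmetric])
    then have 1: "real (eig_count n C w) \<le> real (eig_count n ?A w) + real (card S)" by linarith
    have "real (eig_count n ?B (w - \<delta>)) \<le> real (eig_count n C (w - \<delta> + \<delta>)) + (\<Sum>i<n. \<Sum>j<n. (C i j - ?B i j)\<^sup>2) / \<delta>\<^sup>2"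
      by (rule eig_count_square_perturb[OF symB symC \<delta>])
    then have "real (eig_count n ?B (w - \<delta>)) \<le> real (eig_count n ?A w) + \<eta> * real n" using err 1 by simp
    then have "real (eig_count n ?B (w - \<delta>)) / real n \<le> (real (eig_count n ?A w) + \<eta> * real n) / real n"
      using n0 by (intro divide_right_mono) auto
    then show ?thesis using n0 unfolding c w_def \<delta>_def left_diff_distrib by (simp add: add_divide_distrib)
  qed
qed

definition next_dyadic :: "nat \<Rightarrow> nat" where
  "next_dyadic n = (LEAST m. n \<le> 2 ^ m)"

lemma next_dyadic: "n \<le> 2 ^ next_dyadic n" "n > 0 \<Longrightarrow> 2 ^ next_dyadic n \<le> 2 * n"
proof -
  have ex: "n \<le> 2 ^ n" by (rule less_imp_le[OF less_exp])
  show "n \<le> 2 ^ next_dyadic n" unfolding next_dyadic_def by (rule LeastI[of "\<lambda>m. n \<le> 2 ^ m", OF ex])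
  assume n: "n > 0"
  show "2 ^ next_dyadic n \<le> 2 * n"
  proof (cases "next_dyadic n")
    case (Suc m)
    then have "\<not> n \<le> 2 ^ m" using not_less_Least[of m "\<lambda>m. n \<le> 2 ^ m"] unfolding next_dyadic_def by simp
    then show ?thesis unfolding Suc by simp
  qed (use n in simp)
qed

lemma filterlim_next_dyadic: "filterlim next_dyadic at_top sequentially"
  unfolding filterlim_at_top
proof
  fix Z :: nat
  show "\<forall>\<^sub>F n in sequentially. Z \<le> next_dyadic n"
  proof (rule eventually_sequentiallyI[of "Suc (2 ^ Z)"])
    fix n assume n: "Suc (2 ^ Z) \<le> n"
    show "Z \<le> next_dyadic n"
    proof (rule ccontr)
      assume "\<not> Z \<le> next_dyadic n"
      then have "(2::nat) ^ next_dyadic n \<le> 2 ^ Z" by (intro power_increasing) auto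
      then show False using next_dyadic(1)[of n] n by linarith
    qed
  qed
qed

text \<open>
  The precision \<open>\<eta>\<close> dictates how good the approximation \<open>z c\<close> has to be; for each \<open>c\<close> the error bounds hold at
  all large powers of two, and a matrix size is compared with the next power of two.
\<close>

lemma (in convergent_link) weak_conv_of_approximations:
  fixes x :: "int ^ 'd \<Rightarrow> real" and z :: "nat \<Rightarrow> int ^ 'd \<Rightarrow> real"
  assumes \<mu>: "real_distribution \<mu>" and zw: "\<And>c. weak_conv_m (pat_esd L (z c)) \<mu>"
    and V: "\<And>c. eventually (\<lambda>m. (\<Sum>e\<in>tri_pairs (2 ^ m). if (x (case_prod (link0 L (2 ^ m)) e) - z c (case_prod (link0 L (2 ^ m)) e))\<^sup>2 \<le> 2 ^ m
        then (x (case_prod (link0 L (2 ^ m)) e) - z c (case_prod (link0 L (2 ^ m)) e))\<^sup>2 else 0) \<le> 1 / real (Suc c) * (2 ^ m)\<^sup>2) sequentially"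
    and R: "\<And>c. (\<lambda>m. (\<Sum>e\<in>tri_pairs (2 ^ m). if (x (case_prod (link0 L (2 ^ m)) e) - z c (case_prod (link0 L (2 ^ m)) e))\<^sup>2 > 2 ^ m
        then 1 else 0) / 2 ^ m :: real) \<longlonglongrightarrow> 0"
  shows "weak_conv_m (pat_esd L x) \<mu>"
  unfolding weak_conv_m_def
proof (rule weak_conv_of_levy_close[OF \<mu>])
  fix \<eta> :: real assume \<eta>: "\<eta> > 0"
  obtain c where c: "1 / real (Suc c) < \<eta> ^ 3 / 8"
    using reals_Archimedean[of "\<eta> ^ 3 / 8"] \<eta> by (auto simp: inverse_eq_divide)
  have "eventually (\<lambda>m. (\<Sum>e\<in>tri_pairs (2 ^ m). if (x (case_prod (link0 L (2 ^ m)) e) - z c (case_prod (link0 L (2 ^ m)) e))\<^sup>2 > 2 ^ m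
        then 1 else 0) / 2 ^ m < \<eta> / 4) sequentially"
    using \<eta> by (intro order_tendstoD(2)[OF R]) auto
  with V[of c] have "eventually (\<lambda>m. (\<Sum>e\<in>tri_pairs (2 ^ m). if (x (case_prod (link0 L (2 ^ m)) e) - z c (case_prod (link0 L (2 ^ m)) e))\<^sup>2 \<le> real (2 ^ m)
        then (x (case_prod (link0 L (2 ^ m)) e) - z c (case_prod (link0 L (2 ^ m)) e))\<^sup>2 else 0) \<le> \<eta> ^ 3 / 8 * (real (2 ^ m))\<^sup>2 \<and>
      (\<Sum>e\<in>tri_pairs (2 ^ m). if (x (case_prod (link0 L (2 ^ m)) e) - z c (case_prod (link0 L (2 ^ m)) e))\<^sup>2 > real (2 ^ m)
        then 1 else 0) \<le> \<eta> / 4 * real (2 ^ m)) sequentially"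
  proof eventually_elim
    case (elim m)
    have "1 / real (Suc c) * ((2::real) ^ m)\<^sup>2 \<le> \<eta> ^ 3 / 8 * (2 ^ m)\<^sup>2" using c by (intro mult_right_mono) auto
    then have "\<And>u. u \<le> 1 / real (Suc c) * ((2::real) ^ m)\<^sup>2 \<Longrightarrow> u \<le> \<eta> ^ 3 / 8 * (2 ^ m)\<^sup>2" by (rule order_trans[rotated])
    moreover have "\<And>u. u / 2 ^ m < \<eta> / 4 \<Longrightarrow> u \<le> \<eta> / 4 * (2::real) ^ m" by (simp add: pos_divide_less_eq)
    ultimately show ?case using elim unfolding of_nat_power of_nat_numeral by blast
  qed
  from eventually_compose_filterlim[OF this filterlim_next_dyadic] eventually_gt_at_top[of 0]
  have "eventually (\<lambda>n. \<forall>v. cdf (pat_esd L x n) v \<le> cdf (pat_esd L (z c) n) (v + \<eta>) + \<eta> \<and>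
       cdf (pat_esd L (z c) n) (v - \<eta>) \<le> cdf (pat_esd L x n) v + \<eta>) sequentially"
  proof eventually_elim
    case (elim n)
    show ?case
    proof
      fix v
      show "cdf (pat_esd L x n) v \<le> cdf (pat_esd L (z c) n) (v + \<eta>) + \<eta> \<and>
         cdf (pat_esd L (z c) n) (v - \<eta>) \<le> cdf (pat_esd L x n) v + \<eta>"
        using cdf_levy_close_of_square_close[of n "2 ^ next_dyadic n" \<eta> x "z c" v] elim next_dyadic[of n] \<eta> by blast
    qed
  qed
  then have "\<forall>v. eventually (\<lambda>n. cdf (pat_esd L x n) v \<le> cdf (pat_esd L (z c) n) (v + \<eta>) + \<eta> \<and>
       cdf (pat_esd L (z c) n) (v - \<eta>) \<le> cdf (pat_esd L x n) v + \<eta>) sequentially"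
    by (auto elim: eventually_mono)
  then show "\<exists>G. weak_conv G (cdf \<mu>) \<and> (\<forall>n. mono (G n)) \<and>
      (\<forall>v. eventually (\<lambda>n. cdf (pat_esd L x n) v \<le> G n (v + \<eta>) + \<eta> \<and> G n (v - \<eta>) \<le> cdf (pat_esd L x n) v + \<eta>) sequentially)"
    using zw[of c] mono_cdf_pat_esd unfolding weak_conv_m_def by (intro exI[of _ "\<lambda>n. cdf (pat_esd L (z c) n)"]) auto
qed

text \<open>
  The limit law has to exist even if the sample space at hand carries no admissible input. It is therefore
  obtained from independent random signs on a product space.
\<close>

lemma (in convergent_link) limit_law_exists:
  "\<exists>\<mu>. real_distribution \<mu> \<and> (\<forall>r. integrable \<mu> (\<lambda>x. x ^ r) \<and> (\<integral>x. x ^ r \<partial>\<mu>) = limit_moment L r)"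
proof -
  define B where "B = measure_pmf (bernoulli_pmf (1 / 2))"
  define P where "P = PiM (UNIV :: (int ^ 'd) set) (\<lambda>_. B)"
  define s :: "bool \<Rightarrow> real" where "s b = (if b then 1 else - 1)" for b
  interpret B: prob_space B unfolding B_def by (rule prob_space_measure_pmf)
  interpret PB: product_prob_space "\<lambda>_. B" "UNIV :: (int ^ 'd) set" by unfold_locales
  interpret P: prob_space P unfolding P_def by unfold_locales
  have comp: "distr P B (\<lambda>\<omega>. \<omega> t) = B" for t unfolding P_def by (rule PB.PiM_component) simp
  have meas[measurable]: "(\<lambda>\<omega>. \<omega> t) \<in> measurable P B" for t unfolding P_def by (rule measurable_component_singleton) simp
  have "P.indep_vars (\<lambda>_. B) (\<lambda>t \<omega>. \<omega> t) UNIV"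
  proof (subst P.indep_vars_iff_distr_eq_PiM)
    have "distr P (PiM UNIV (\<lambda>_. B)) (\<lambda>\<omega>. restrict (\<lambda>t. \<omega> t) UNIV) = distr P P (\<lambda>\<omega>. \<omega>)"
      by (simp add: P_def restrict_def)
    also have "\<dots> = P" by (rule distr_id2) simp
    finally show "distr P (PiM UNIV (\<lambda>_. B)) (\<lambda>\<omega>. restrict (\<lambda>t. \<omega> t) UNIV) = PiM UNIV (\<lambda>t. distr P B (\<lambda>\<omega>. \<omega> t))"
      unfolding comp by (simp add: P_def)
  qed auto
  from P.indep_vars_compose2[OF this, of "\<lambda>_. s" "\<lambda>_. borel"]
  have ind: "P.indep_vars (\<lambda>_. borel) (\<lambda>t \<omega>. s (\<omega> t)) UNIV" by (simp add: B_def)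
  have E: "P.expectation (\<lambda>\<omega>. f (\<omega> t)) = (f True + f False) / 2" for f :: "bool \<Rightarrow> real" and t
  proof -
    have "P.expectation (\<lambda>\<omega>. f (\<omega> t)) = integral\<^sup>L (distr P B (\<lambda>\<omega>. \<omega> t)) f"
      by (rule integral_distr[OF meas, symmetric]) (simp add: B_def)
    also have "\<dots> = (f True + f False) / 2" unfolding comp by (simp add: B_def field_simps)
    finally show ?thesis .
  qed
  interpret patterned_input L D P "\<lambda>t \<omega>. s (\<omega> t)" 1
  proof
    show "P.indep_vars (\<lambda>_. borel) (\<lambda>t \<omega>. s (\<omega> t)) UNIV" by (rule ind)
    show "\<bar>s (\<omega> t)\<bar> \<le> 1" for t \<omega> by (simp add: s_def)
    show "P.expectation (\<lambda>\<omega>. s (\<omega> t)) = 0" for t using E[of s t] by (simp add: s_def)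
    show "P.expectation (\<lambda>\<omega>. (s (\<omega> t))\<^sup>2) = 1" for t using E[of "\<lambda>b. (s b)\<^sup>2" t] by (simp add: s_def)
  qed
  show ?thesis by (rule limit_distribution_exists)
qed

definition cut :: "real \<Rightarrow> real \<Rightarrow> real" where
  "cut C u = (if \<bar>u\<bar> \<le> C then u else 0)"

lemma cut_measurable [measurable]: "cut C \<in> borel_measurable borel"
  unfolding cut_def[abs_def] by measurable

context prob_space
begin

text \<open>
  The mean of the truncated variable is at most \<open>e\<close> in absolute value and its variance is at least \<open>1 - 2e\<close>,
  so standardizing it again moves it by \<open>O(e)\<close> in mean square.
\<close>

lemma standardized_cut:
  fixes X :: "'a \<Rightarrow> real"
  assumes rv[measurable]: "random_variable borel X" and int2: "integrable M (\<lambda>\<omega>. (X \<omega>)\<^sup>2)"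
    and mean: "expectation X = 0" and second: "expectation (\<lambda>\<omega>. (X \<omega>)\<^sup>2) = 1"
    and C: "C \<ge> 1" and tail: "expectation (\<lambda>\<omega>. if \<bar>X \<omega>\<bar> > C then (X \<omega>)\<^sup>2 else 0) \<le> e" and e: "e \<le> 1 / 8"
  defines "m \<equiv> expectation (\<lambda>\<omega>. cut C (X \<omega>))"
  defines "s \<equiv> sqrt (expectation (\<lambda>\<omega>. (cut C (X \<omega>))\<^sup>2) - m\<^sup>2)"
  defines "Z \<equiv> \<lambda>\<omega>. (cut C (X \<omega>) - m) / s"
  shows "\<bar>Z \<omega>\<bar> \<le> 4 * C" "expectation Z = 0" "expectation (\<lambda>\<omega>. (Z \<omega>)\<^sup>2) = 1"
    "integrable M (\<lambda>\<omega>. (X \<omega> - Z \<omega>)\<^sup>2)" "expectation (\<lambda>\<omega>. (X \<omega> - Z \<omega>)\<^sup>2) \<le> 6 * e"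
proof -
  let ?T = "\<lambda>\<omega>. cut C (X \<omega>)" and ?B = "\<lambda>\<omega>. if \<bar>X \<omega>\<bar> > C then (X \<omega>)\<^sup>2 else 0"
  have int1: "integrable M X" by (rule square_integrable_imp_integrable[OF rv int2])
  have T_le: "\<bar>?T \<omega>\<bar> \<le> C" for \<omega> using C by (simp add: cut_def)
  have intT: "integrable M ?T" by (rule integrable_const_bound[of _ C]) (use T_le in auto)
  have intT2: "integrable M (\<lambda>\<omega>. (?T \<omega>)\<^sup>2)"
    by (rule integrable_const_bound[of _ "C\<^sup>2"]) (use T_le C in \<open>auto simp: abs_le_square_iff[symmetric]\<close>)
  have intB: "integrable M ?B"
    by (rule Bochner_Integration.integrable_bound[OF int2]) auto
  define b where "b = expectation ?B"
  have b: "0 \<le> b" "b \<le> e" using tail unfolding b_def by (auto intro: Bochner_Integration.integral_nonneg)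
  have T2: "expectation (\<lambda>\<omega>. (?T \<omega>)\<^sup>2) = 1 - b"
  proof -
    have "expectation (\<lambda>\<omega>. (X \<omega>)\<^sup>2) = expectation (\<lambda>\<omega>. (?T \<omega>)\<^sup>2 + ?B \<omega>)"
      by (intro Bochner_Integration.integral_cong) (auto simp: cut_def)
    also have "\<dots> = expectation (\<lambda>\<omega>. (?T \<omega>)\<^sup>2) + b" unfolding b_def by (rule Bochner_Integration.integral_add[OF intT2 intB])
    finally show ?thesis using second by simp
  qed
  have m: "\<bar>m\<bar> \<le> b"
  proof -
    have "m = expectation (\<lambda>\<omega>. ?T \<omega> - X \<omega>)" unfolding m_def using intT int1 mean by simp
    then have "\<bar>m\<bar> \<le> expectation (\<lambda>\<omega>. \<bar>?T \<omega> - X \<omega>\<bar>)" by (simp only: integral_abs_bound)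
    also have "\<dots> \<le> b" unfolding b_def
    proof (intro integral_mono integrable_abs Bochner_Integration.integrable_diff intT int1 intB)
      fix \<omega>
      have "\<bar>X \<omega>\<bar> * 1 \<le> \<bar>X \<omega>\<bar> * \<bar>X \<omega>\<bar>" if "\<bar>X \<omega>\<bar> > C" using that C by (intro mult_left_mono) auto
      then show "\<bar>?T \<omega> - X \<omega>\<bar> \<le> ?B \<omega>" by (auto simp: cut_def power2_eq_square)
    qed
    finally show ?thesis .
  qed
  have bsq: "b\<^sup>2 \<le> b" using b e by (simp add: power2_eq_square mult_left_le)
  have m2: "m\<^sup>2 \<le> b"
  proof -
    have "m\<^sup>2 \<le> b\<^sup>2" using m b by (simp add: abs_le_square_iff[symmetric])
    then show ?thesis using bsq by simp
  qed
  have v: "3 / 4 \<le> 1 - b - m\<^sup>2" "1 - b - m\<^sup>2 \<le> 1"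
    using m2 b e zero_le_power2[of m] by linarith+
  have s2: "s\<^sup>2 = 1 - b - m\<^sup>2" unfolding s_def T2 using v by simp
  have s0: "s \<ge> 1 / 2" unfolding s_def T2 using v by (intro real_le_rsqrt) (simp add: power_divide)
  have s1: "s \<le> 1" unfolding s_def T2 using v by simp
  have Zs: "?T \<omega> = s * Z \<omega> + m" for \<omega> unfolding Z_def using s0 by simp
  show "\<bar>Z \<omega>\<bar> \<le> 4 * C"
  proof -
    have "\<bar>?T \<omega> - m\<bar> \<le> 2 * C" using T_le[of \<omega>] m b e C by linarith
    also have "\<dots> \<le> 4 * C * s" using mult_left_mono[OF s0, of "4 * C"] C by simp
    finally show ?thesis unfolding Z_def using s0 by (simp add: abs_divide pos_divide_le_eq)
  qed
  have intZ: "integrable M Z" unfolding Z_def using intT by simp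
  have intZ2: "integrable M (\<lambda>\<omega>. (Z \<omega>)\<^sup>2)"
    unfolding Z_def power_divide power2_diff using intT intT2 by simp
  show EZ: "expectation Z = 0" unfolding Z_def using intT by (simp add: m_def prob_space)
  show EZ2: "expectation (\<lambda>\<omega>. (Z \<omega>)\<^sup>2) = 1"
  proof -
    have "expectation (\<lambda>\<omega>. (Z \<omega>)\<^sup>2) = expectation (\<lambda>\<omega>. (?T \<omega> - m)\<^sup>2) / s\<^sup>2" unfolding Z_def power_divide by simp
    also have "expectation (\<lambda>\<omega>. (?T \<omega> - m)\<^sup>2) = s\<^sup>2"
      using variance_eq[OF intT intT2] unfolding s2 T2 m_def[symmetric] by simp
    finally show ?thesis using s0 by simp
  qed
  have intD: "integrable M (\<lambda>\<omega>. (m - (1 - s) * Z \<omega>)\<^sup>2)"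
    unfolding power2_diff power_mult_distrib using intZ intZ2 by simp
  have D: "expectation (\<lambda>\<omega>. (m - (1 - s) * Z \<omega>)\<^sup>2) = m\<^sup>2 + (1 - s)\<^sup>2"
    unfolding power2_diff[of m] power_mult_distrib using intZ intZ2 EZ EZ2 by (simp add: prob_space)
  have pw: "(X \<omega> - Z \<omega>)\<^sup>2 \<le> 2 * ?B \<omega> + 2 * (m - (1 - s) * Z \<omega>)\<^sup>2" for \<omega>
  proof -
    have *: "(u + v)\<^sup>2 \<le> 2 * u\<^sup>2 + 2 * v\<^sup>2" for u v :: real
      using zero_le_power2[of "u - v"] by (simp add: power2_sum power2_diff)
    have "X \<omega> - Z \<omega> = (X \<omega> - ?T \<omega>) + (m - (1 - s) * Z \<omega>)" unfolding Zs by (simp add: algebra_simps)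
    then have "(X \<omega> - Z \<omega>)\<^sup>2 \<le> 2 * (X \<omega> - ?T \<omega>)\<^sup>2 + 2 * (m - (1 - s) * Z \<omega>)\<^sup>2" using * by metis
    moreover have "(X \<omega> - ?T \<omega>)\<^sup>2 = ?B \<omega>" by (simp add: cut_def)
    ultimately show ?thesis by simp
  qed
  have intbound: "integrable M (\<lambda>\<omega>. 2 * ?B \<omega> + 2 * (m - (1 - s) * Z \<omega>)\<^sup>2)" using intB intD by simp
  have [measurable]: "random_variable borel Z" using intZ by simp
  show intXZ: "integrable M (\<lambda>\<omega>. (X \<omega> - Z \<omega>)\<^sup>2)"
    by (rule Bochner_Integration.integrable_bound[OF intbound]) (use pw in \<open>auto intro: order_trans[OF _ abs_ge_self]\<close>)
  have "expectation (\<lambda>\<omega>. (X \<omega> - Z \<omega>)\<^sup>2) \<le> expectation (\<lambda>\<omega>. 2 * ?B \<omega> + 2 * (m - (1 - s) * Z \<omega>)\<^sup>2)"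
    by (rule integral_mono[OF intXZ intbound pw])
  also have "\<dots> = 2 * b + 2 * (m\<^sup>2 + (1 - s)\<^sup>2)" using intB intD D by (simp add: b_def)
  also have "\<dots> \<le> 6 * e"
  proof -
    have "s\<^sup>2 \<le> s" using s0 s1 by (simp add: power2_eq_square mult_left_le)
    then have "1 - s \<le> 2 * b" using s2 m2 by linarith
    then have "(1 - s)\<^sup>2 \<le> (2 * b)\<^sup>2" using s1 by (intro power_mono) auto
    also have "\<dots> \<le> b"
    proof -
      have "4 * b * b \<le> 1 * b" using b e by (intro mult_right_mono) auto
      then show ?thesis by (simp add: power2_eq_square)
    qed
    finally have "m\<^sup>2 + (1 - s)\<^sup>2 \<le> b + b" using m2 by (intro add_mono)
    moreover have "2 * b + 2 * u \<le> 6 * e" if "u \<le> b + b" for u using that b by linarith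
    ultimately show ?thesis by blast
  qed
  finally show "expectation (\<lambda>\<omega>. (X \<omega> - Z \<omega>)\<^sup>2) \<le> 6 * e" .
qed

lemma dyadic_tail_summable:
  fixes Y :: "'a \<Rightarrow> real"
  assumes int: "integrable M Y" and nn: "\<And>\<omega>. 0 \<le> Y \<omega>"
  shows "summable (\<lambda>m. 2 ^ m * prob {\<omega> \<in> space M. Y \<omega> > 2 ^ m})"
    "summable (\<lambda>m. expectation (\<lambda>\<omega>. if Y \<omega> \<le> 2 ^ m then (Y \<omega>)\<^sup>2 else 0) / 2 ^ m)"
proof -
  have [measurable]: "random_variable borel Y" using int by simp
  have e: "2 ^ m * prob {\<omega> \<in> space M. Y \<omega> > 2 ^ m} = expectation (\<lambda>\<omega>. if Y \<omega> > 2 ^ m then (2::real) ^ m else 0)" for m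
  proof -
    have "expectation (\<lambda>\<omega>. if Y \<omega> > 2 ^ m then (2::real) ^ m else 0) = expectation (\<lambda>\<omega>. 2 ^ m * indicator {\<omega> \<in> space M. Y \<omega> > 2 ^ m} \<omega>)"
      by (intro Bochner_Integration.integral_cong) (auto simp: indicator_def)
    then show ?thesis by simp
  qed
  have i1: "integrable M (\<lambda>\<omega>. if Y \<omega> > 2 ^ m then (2::real) ^ m else 0)" for m
    by (rule integrable_const_bound[of _ "2 ^ m"]) auto
  have i2: "integrable M (\<lambda>\<omega>. if Y \<omega> \<le> 2 ^ m then (Y \<omega>)\<^sup>2 else 0)" for m
    by (rule integrable_const_bound[of _ "(2 ^ m)\<^sup>2"]) (use nn in \<open>auto intro!: power_mono\<close>)
  show "summable (\<lambda>m. 2 ^ m * prob {\<omega> \<in> space M. Y \<omega> > 2 ^ m})"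
  proof (rule summableI_nonneg_bounded[of _ "expectation (\<lambda>\<omega>. 2 * Y \<omega>)"])
    fix n
    have "(\<Sum>m<n. 2 ^ m * prob {\<omega> \<in> space M. Y \<omega> > 2 ^ m}) = expectation (\<lambda>\<omega>. \<Sum>m<n. if Y \<omega> > 2 ^ m then 2 ^ m else 0)"
      unfolding e by (rule Bochner_Integration.integral_sum[symmetric]) (rule i1)
    also have "\<dots> \<le> expectation (\<lambda>\<omega>. 2 * Y \<omega>)"
      by (intro integral_mono Bochner_Integration.integrable_sum i1 sum_geometric_dyadic_large nn) (use int in simp)
    finally show "(\<Sum>m<n. 2 ^ m * prob {\<omega> \<in> space M. Y \<omega> > 2 ^ m}) \<le> expectation (\<lambda>\<omega>. 2 * Y \<omega>)" .
  qed simp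
  show "summable (\<lambda>m. expectation (\<lambda>\<omega>. if Y \<omega> \<le> 2 ^ m then (Y \<omega>)\<^sup>2 else 0) / 2 ^ m)"
  proof (rule summableI_nonneg_bounded[of _ "expectation (\<lambda>\<omega>. 2 * Y \<omega>)"])
    fix n
    have d: "(if Y \<omega> \<le> 2 ^ m then (Y \<omega>)\<^sup>2 else 0) / 2 ^ m = (if Y \<omega> \<le> 2 ^ m then (Y \<omega>)\<^sup>2 / 2 ^ m else 0)" for \<omega> m by simp
    have "(\<Sum>m<n. expectation (\<lambda>\<omega>. if Y \<omega> \<le> 2 ^ m then (Y \<omega>)\<^sup>2 else 0) / 2 ^ m)
       = (\<Sum>m<n. expectation (\<lambda>\<omega>. (if Y \<omega> \<le> 2 ^ m then (Y \<omega>)\<^sup>2 else 0) / 2 ^ m))" by simp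
    also have "\<dots> = expectation (\<lambda>\<omega>. \<Sum>m<n. (if Y \<omega> \<le> 2 ^ m then (Y \<omega>)\<^sup>2 else 0) / 2 ^ m)"
      by (rule Bochner_Integration.integral_sum[symmetric]) (intro integrable_divide i2)
    also have "\<dots> \<le> expectation (\<lambda>\<omega>. 2 * Y \<omega>)"
    proof (intro integral_mono Bochner_Integration.integrable_sum integrable_divide i2)
      show "(\<Sum>m<n. (if Y \<omega> \<le> 2 ^ m then (Y \<omega>)\<^sup>2 else 0) / 2 ^ m) \<le> 2 * Y \<omega>" for \<omega>
        unfolding d by (rule sum_geometric_dyadic_small[OF nn])
    qed (use int in simp)
    finally show "(\<Sum>m<n. expectation (\<lambda>\<omega>. if Y \<omega> \<le> 2 ^ m then (Y \<omega>)\<^sup>2 else 0) / 2 ^ m) \<le> expectation (\<lambda>\<omega>. 2 * Y \<omega>)" .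
  qed (intro divide_nonneg_pos Bochner_Integration.integral_nonneg, auto)
qed

lemma identically_distributed_expectation:
  fixes x :: "'i \<Rightarrow> 'a \<Rightarrow> real" and f :: "real \<Rightarrow> real"
  assumes id: "identically_distributed M x" and rv: "\<And>t. random_variable borel (x t)" and f: "f \<in> borel_measurable borel"
  shows "expectation (\<lambda>\<omega>. f (x s \<omega>)) = expectation (\<lambda>\<omega>. f (x t \<omega>))"
proof -
  have "distr M borel (x s) = distr M borel (x t)" using id unfolding identically_distributed_def by blast
  then show ?thesis using integral_distr[OF rv f, of s] integral_distr[OF rv f, of t] by simp
qed

lemma identically_distributed_prob:
  fixes x :: "'i \<Rightarrow> 'a \<Rightarrow> real" and f :: "real \<Rightarrow> real"
  assumes id: "identically_distributed M x" and rv: "\<And>t. random_variable borel (x t)" and f[measurable]: "f \<in> borel_measurable borel"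
  shows "prob {\<omega> \<in> space M. f (x s \<omega>) > c} = prob {\<omega> \<in> space M. f (x t \<omega>) > c}"
proof -
  have "prob {\<omega> \<in> space M. f (x t \<omega>) > c} = measure (distr M borel (x t)) {u. f u > c}" for t
    by (subst measure_distr[OF rv]) (auto intro!: arg_cong[where f = prob])
  moreover have "distr M borel (x s) = distr M borel (x t)" using id unfolding identically_distributed_def by blast
  ultimately show ?thesis by simp
qed

text \<open>
  With bounded moments the third one gives the rate \<open>1/C\<close>; for identically distributed inputs it is dominated
  convergence for one of them.
\<close>

lemma uniform_square_tail:
  fixes x :: "'i \<Rightarrow> 'a \<Rightarrow> real"
  assumes rv[measurable]: "\<And>t. random_variable borel (x t)" and int2: "\<And>t. integrable M (\<lambda>\<omega>. (x t \<omega>)\<^sup>2)"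
    and alt: "uniformly_bounded_moments M x \<or> identically_distributed M x" and e: "e > 0"
  shows "\<exists>C\<ge>1. \<forall>t. expectation (\<lambda>\<omega>. if \<bar>x t \<omega>\<bar> > C then (x t \<omega>)\<^sup>2 else 0) \<le> e"
  using alt
proof
  assume "uniformly_bounded_moments M x"
  then obtain B where B: "\<And>t. integrable M (\<lambda>\<omega>. \<bar>x t \<omega>\<bar> ^ 3)" "\<And>t. expectation (\<lambda>\<omega>. \<bar>x t \<omega>\<bar> ^ 3) \<le> B"
    unfolding uniformly_bounded_moments_def by blast
  define C where "C = max 1 (B / e)"
  have C: "C \<ge> 1" "B \<le> e * C" using e by (auto simp: C_def pos_divide_le_eq[symmetric] mult.commute[of e])
  have "expectation (\<lambda>\<omega>. if \<bar>x t \<omega>\<bar> > C then (x t \<omega>)\<^sup>2 else 0) \<le> e" for t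
  proof -
    have "expectation (\<lambda>\<omega>. if \<bar>x t \<omega>\<bar> > C then (x t \<omega>)\<^sup>2 else 0) \<le> expectation (\<lambda>\<omega>. \<bar>x t \<omega>\<bar> ^ 3 / C)"
    proof (rule integral_mono)
      show "integrable M (\<lambda>\<omega>. if \<bar>x t \<omega>\<bar> > C then (x t \<omega>)\<^sup>2 else 0)"
        by (rule Bochner_Integration.integrable_bound[OF int2[of t]]) auto
      show "integrable M (\<lambda>\<omega>. \<bar>x t \<omega>\<bar> ^ 3 / C)" using B(1) by simp
      fix \<omega>
      have "(x t \<omega>)\<^sup>2 * C \<le> (x t \<omega>)\<^sup>2 * \<bar>x t \<omega>\<bar>" if "\<bar>x t \<omega>\<bar> > C" using that by (intro mult_left_mono) auto
      then have "(x t \<omega>)\<^sup>2 \<le> \<bar>x t \<omega>\<bar> ^ 3 / C" if "\<bar>x t \<omega>\<bar> > C"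
        using that C by (simp add: pos_le_divide_eq power3_eq_cube power2_eq_square)
      then show "(if \<bar>x t \<omega>\<bar> > C then (x t \<omega>)\<^sup>2 else 0) \<le> \<bar>x t \<omega>\<bar> ^ 3 / C" using C by auto
    qed
    also have "\<dots> \<le> e" using B(2)[of t] C by (simp add: pos_divide_le_eq)
    finally show ?thesis .
  qed
  then show ?thesis using C by blast
next
  assume id: "identically_distributed M x"
  \<comment> \<open>all indices are alike, so an arbitrary one is chosen\<close>
  let ?f = "\<lambda>n \<omega>. if \<bar>x undefined \<omega>\<bar> > real n then (x undefined \<omega>)\<^sup>2 else 0"
  have "(\<lambda>n. expectation (?f n)) \<longlonglongrightarrow> expectation (\<lambda>\<omega>. 0)"
  proof (rule integral_dominated_convergence[OF _ _ int2])
    show "AE \<omega> in M. (\<lambda>n. ?f n \<omega>) \<longlonglongrightarrow> 0"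
    proof (intro AE_I2 tendsto_eventually)
      fix \<omega>
      obtain N where "\<bar>x undefined \<omega>\<bar> \<le> real N" using real_arch_simple by blast
      then show "\<forall>\<^sub>F n in sequentially. ?f n \<omega> = 0" by (intro eventually_sequentiallyI[of N]) auto
    qed
  qed auto
  then have "\<forall>\<^sub>F n in sequentially. expectation (?f n) < e" using e by (intro order_tendstoD(2)) auto
  with eventually_ge_at_top[of 1] have "\<forall>\<^sub>F n in sequentially. 1 \<le> n \<and> expectation (?f n) < e" by eventually_elim simp
  then obtain n where n: "1 \<le> n" "expectation (?f n) < e" unfolding eventually_sequentially by blast
  have "(\<lambda>u. if \<bar>u\<bar> > real n then u\<^sup>2 else 0 :: real) \<in> borel_measurable borel" by measurable
  then have "expectation (\<lambda>\<omega>. if \<bar>x t \<omega>\<bar> > real n then (x t \<omega>)\<^sup>2 else 0) \<le> e" for t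
    using identically_distributed_expectation[OF id rv, of "\<lambda>u. if \<bar>u\<bar> > real n then u\<^sup>2 else 0" t undefined] n by linarith
  then show ?thesis using n by (intro exI[of _ "real n"]) auto
qed

text \<open>
  With bounded moments \<open>y\<close> has uniformly bounded second moments, and the tail bounds follow from Markov's
  inequality. For identically distributed inputs the \<open>y t\<close> are identically distributed and integrable,
  which is enough by \<open>dyadic_tail_summable\<close>.
\<close>

lemma bounded_approximation:
  fixes x :: "'i \<Rightarrow> 'a \<Rightarrow> real"
  assumes std: "standard_input M x" and e: "e > 0"
  shows "\<exists>z K p q. bounded_input M z K \<and> small_tail M (\<lambda>t \<omega>. (x t \<omega> - z t \<omega>)\<^sup>2) p q e"
proof -
  have ind: "indep_vars (\<lambda>_. borel) x UNIV"
    and int2: "\<And>t. integrable M (\<lambda>\<omega>. (x t \<omega>)\<^sup>2)" and mean: "\<And>t. expectation (x t) = 0"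
    and var: "\<And>t. variance (x t) = 1"
    and alt: "uniformly_bounded_moments M x \<or> identically_distributed M x"
    using std unfolding standard_input_def by blast+
  have rv[measurable]: "random_variable borel (x t)" for t using ind unfolding indep_vars_def by auto
  have second: "expectation (\<lambda>\<omega>. (x t \<omega>)\<^sup>2) = 1" for t using var[of t] by (simp add: mean)
  \<comment> \<open>\<open>standardized_cut\<close> requires a tail of at most \<open>1/8\<close> and loses a factor \<open>6\<close>\<close>
  define d where "d = min (1 / 8) (e / 6)"
  have d: "d > 0" "d \<le> 1 / 8" "6 * d \<le> e" using e by (auto simp: d_def)
  obtain C where C: "C \<ge> 1" "\<And>t. expectation (\<lambda>\<omega>. if \<bar>x t \<omega>\<bar> > C then (x t \<omega>)\<^sup>2 else 0) \<le> d"
    using uniform_square_tail[of x d] rv int2 alt d(1) by blast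
  define m where "m t = expectation (\<lambda>\<omega>. cut C (x t \<omega>))" for t
  define s where "s t = sqrt (expectation (\<lambda>\<omega>. (cut C (x t \<omega>))\<^sup>2) - (m t)\<^sup>2)" for t
  define z where "z t \<omega> = (cut C (x t \<omega>) - m t) / s t" for t \<omega>
  note sc = standardized_cut[OF rv int2 mean second C(1) C(2) d(2), folded m_def, folded s_def, folded z_def]
  have ind_z: "indep_vars (\<lambda>_. borel) z UNIV"
    using indep_vars_compose2[OF ind, of "\<lambda>t u. (cut C u - m t) / s t" "\<lambda>_. borel"] by (simp add: z_def[abs_def])
  have rvz[measurable]: "random_variable borel (z t)" for t using ind_z unfolding indep_vars_def by auto
  have b: "bounded_input M z (4 * C)"
    by unfold_locales (use ind_z sc in auto)
  let ?y = "\<lambda>t \<omega>. (x t \<omega> - z t \<omega>)\<^sup>2"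
  define g where "g t u = (u - (cut C u - m t) / s t)\<^sup>2" for t u
  have g[measurable]: "g t \<in> borel_measurable borel" for t unfolding g_def[abs_def] by measurable
  have yg: "?y t \<omega> = g t (x t \<omega>)" for t \<omega> by (simp add: g_def z_def)
  have ind_y: "indep_vars (\<lambda>_. borel) ?y UNIV"
    unfolding yg using indep_vars_compose2[OF ind, of g "\<lambda>_. borel"] by simp
  have rvy[measurable]: "random_variable borel (?y t)" for t using ind_y unfolding indep_vars_def by auto
  have "\<exists>p q. (\<forall>t m. prob {\<omega> \<in> space M. ?y t \<omega> > 2 ^ m} \<le> p m) \<and> summable (\<lambda>m. 2 ^ m * p m) \<and>
     (\<forall>t m. expectation (\<lambda>\<omega>. if ?y t \<omega> \<le> 2 ^ m then (?y t \<omega>)\<^sup>2 else 0) \<le> q m) \<and> summable (\<lambda>m. q m / 2 ^ m)"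
    using alt
  proof
    assume "uniformly_bounded_moments M x"
    then obtain B where B: "\<And>t. integrable M (\<lambda>\<omega>. \<bar>x t \<omega>\<bar> ^ 4)" "\<And>t. expectation (\<lambda>\<omega>. \<bar>x t \<omega>\<bar> ^ 4) \<le> B"
      unfolding uniformly_bounded_moments_def by blast
    define Q where "Q = 8 * B + 8 * (4 * C) ^ 4"
    have pw: "(?y t \<omega>)\<^sup>2 \<le> 8 * \<bar>x t \<omega>\<bar> ^ 4 + 8 * (4 * C) ^ 4" for t \<omega>
    proof -
      have *: "(u - v)\<^sup>2 \<le> 2 * (u\<^sup>2 + v\<^sup>2)" "(u + v)\<^sup>2 \<le> 2 * (u\<^sup>2 + v\<^sup>2)" for u v :: real
        using zero_le_power2[of "u - v"] zero_le_power2[of "u + v"] by (simp_all add: power2_sum power2_diff)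
      have "(?y t \<omega>)\<^sup>2 \<le> (2 * ((x t \<omega>)\<^sup>2 + (z t \<omega>)\<^sup>2))\<^sup>2" by (intro power_mono *) simp
      also have "\<dots> = 4 * ((x t \<omega>)\<^sup>2 + (z t \<omega>)\<^sup>2)\<^sup>2" by (simp only: power_mult_distrib) simp
      also have "\<dots> \<le> 4 * (2 * (((x t \<omega>)\<^sup>2)\<^sup>2 + ((z t \<omega>)\<^sup>2)\<^sup>2))" by (intro mult_left_mono *) simp
      also have "\<dots> = 8 * \<bar>x t \<omega>\<bar> ^ 4 + 8 * \<bar>z t \<omega>\<bar> ^ 4" by (simp add: power_mult[symmetric])
      also have "\<dots> \<le> 8 * \<bar>x t \<omega>\<bar> ^ 4 + 8 * (4 * C) ^ 4" by (intro add_left_mono mult_left_mono power_mono sc(1)) auto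
      finally show ?thesis .
    qed
    have iB: "integrable M (\<lambda>\<omega>. 8 * \<bar>x t \<omega>\<bar> ^ 4 + 8 * (4 * C) ^ 4)" for t using B(1) by simp
    have iy2: "integrable M (\<lambda>\<omega>. (?y t \<omega>)\<^sup>2)" for t
      by (rule Bochner_Integration.integrable_bound[OF iB[of t]]) (use pw in \<open>auto intro: order_trans[OF _ abs_ge_self]\<close>)
    have EQ: "expectation (\<lambda>\<omega>. (?y t \<omega>)\<^sup>2) \<le> Q" for t
    proof -
      have "expectation (\<lambda>\<omega>. (?y t \<omega>)\<^sup>2) \<le> expectation (\<lambda>\<omega>. 8 * \<bar>x t \<omega>\<bar> ^ 4 + 8 * (4 * C) ^ 4)"
        by (rule integral_mono[OF iy2 iB pw])
      also have "\<dots> \<le> Q" using B[of t] by (simp add: Q_def prob_space)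
      finally show ?thesis .
    qed
    have geo: "summable (\<lambda>m. Q / 2 ^ m)"
    proof -
      have "summable (\<lambda>m. Q * (1 / 2) ^ m)" by (intro summable_mult summable_geometric) simp
      then show ?thesis by (simp add: power_divide)
    qed
    show ?thesis
    proof (rule exI[of _ "\<lambda>m. Q / 4 ^ m"], rule exI[of _ "\<lambda>m. Q"], intro conjI allI)
      fix t and m :: nat
      have "{\<omega> \<in> space M. ?y t \<omega> > 2 ^ m} \<subseteq> {\<omega> \<in> space M. (?y t \<omega>)\<^sup>2 \<ge> 4 ^ m}"
      proof safe
        fix \<omega> assume "2 ^ m < ?y t \<omega>"
        then have "((2::real) ^ m)\<^sup>2 \<le> (?y t \<omega>)\<^sup>2" by (intro power_mono) auto
        then show "4 ^ m \<le> (?y t \<omega>)\<^sup>2" by (simp add: power_mult[symmetric] mult.commute[of m] power_mult)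
      qed
      then have "prob {\<omega> \<in> space M. ?y t \<omega> > 2 ^ m} \<le> prob {\<omega> \<in> space M. (?y t \<omega>)\<^sup>2 \<ge> 4 ^ m}"
        by (rule finite_measure_mono) measurable
      also have "\<dots> \<le> expectation (\<lambda>\<omega>. (?y t \<omega>)\<^sup>2) / 4 ^ m"
        by (rule integral_Markov_inequality_measure[OF iy2, of "space M"]) auto
      also have "\<dots> \<le> Q / 4 ^ m" by (intro divide_right_mono EQ) simp
      finally show "prob {\<omega> \<in> space M. ?y t \<omega> > 2 ^ m} \<le> Q / 4 ^ m" .
      have "expectation (\<lambda>\<omega>. if ?y t \<omega> \<le> 2 ^ m then (?y t \<omega>)\<^sup>2 else 0) \<le> expectation (\<lambda>\<omega>. (?y t \<omega>)\<^sup>2)"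
      proof (rule integral_mono[OF _ iy2])
        show "integrable M (\<lambda>\<omega>. if ?y t \<omega> \<le> 2 ^ m then (?y t \<omega>)\<^sup>2 else 0)"
          by (rule Bochner_Integration.integrable_bound[OF iy2[of t]]) auto
      qed auto
      then show "expectation (\<lambda>\<omega>. if ?y t \<omega> \<le> 2 ^ m then (?y t \<omega>)\<^sup>2 else 0) \<le> Q" using EQ[of t] by simp
    next
      have "2 ^ m * (Q / 4 ^ m) = Q / 2 ^ m" for m :: nat
      proof -
        have "(4::real) ^ m = 2 ^ m * 2 ^ m" by (simp add: power_mult_distrib[symmetric])
        then show ?thesis by simp
      qed
      then show "summable (\<lambda>m. 2 ^ m * (Q / 4 ^ m))" using geo by simp
      show "summable (\<lambda>m. Q / 2 ^ m)" by (rule geo)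
    qed
  next
    assume id: "identically_distributed M x"
    have m_eq: "m t = m undefined" for t
      unfolding m_def by (rule identically_distributed_expectation[OF id rv]) measurable
    have s_eq: "s t = s undefined" for t
      unfolding s_def m_eq[of t]
      using identically_distributed_expectation[OF id rv, of "\<lambda>u. (cut C u)\<^sup>2" t undefined] by simp
    have g_eq: "g t = g undefined" for t unfolding g_def[abs_def] m_eq[of t] s_eq[of t] ..
    have y_eq: "?y t \<omega> = g undefined (x t \<omega>)" for t \<omega> unfolding yg g_eq[of t] ..
    show ?thesis
    proof (intro exI conjI allI)
      fix t and m :: nat
      show "prob {\<omega> \<in> space M. ?y t \<omega> > 2 ^ m} \<le> prob {\<omega> \<in> space M. ?y undefined \<omega> > 2 ^ m}"
        unfolding y_eq by (rule eq_refl, rule identically_distributed_prob[OF id rv g])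
      have "(\<lambda>u. if g undefined u \<le> 2 ^ m then (g undefined u)\<^sup>2 else 0) \<in> borel_measurable borel" by measurable
      from identically_distributed_expectation[OF id rv this, of t undefined]
      show "expectation (\<lambda>\<omega>. if ?y t \<omega> \<le> 2 ^ m then (?y t \<omega>)\<^sup>2 else 0) \<le> expectation (\<lambda>\<omega>. if ?y undefined \<omega> \<le> 2 ^ m then (?y undefined \<omega>)\<^sup>2 else 0)"
        unfolding y_eq by simp
    next
      show "summable (\<lambda>m. 2 ^ m * prob {\<omega> \<in> space M. ?y undefined \<omega> > 2 ^ m})"
        "summable (\<lambda>m. expectation (\<lambda>\<omega>. if ?y undefined \<omega> \<le> 2 ^ m then (?y undefined \<omega>)\<^sup>2 else 0) / 2 ^ m)"
        by (rule dyadic_tail_summable; use sc(4) in simp)+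
    qed
  qed
  then obtain p q where pq: "\<forall>t m. prob {\<omega> \<in> space M. ?y t \<omega> > 2 ^ m} \<le> p m" "summable (\<lambda>m. 2 ^ m * p m)"
     "\<forall>t m. expectation (\<lambda>\<omega>. if ?y t \<omega> \<le> 2 ^ m then (?y t \<omega>)\<^sup>2 else 0) \<le> q m" "summable (\<lambda>m. q m / 2 ^ m)"
    by blast
  have "small_tail M ?y p q e"
  proof
    show "expectation (?y t) \<le> e" for t using sc(5)[of t] d(3) by linarith
  qed (use ind_y sc(4) pq in auto)
  with b show ?thesis by blast
qed

end

section \<open>The limiting spectral distribution\<close>

lemma thin_link_of_Delta:
  fixes L :: "nat \<Rightarrow> nat \<Rightarrow> nat \<Rightarrow> int ^ 'd"
  assumes sym: "symmetric_link L" and D: "link_Delta L < \<infinity>"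
  shows "\<exists>D. \<forall>n>0. thin_link n (link0 L n) D"
proof -
  obtain D where D: "link_Delta L = enat D" using D by (cases "link_Delta L") auto
  have "thin_link n (link0 L n) D" if n: "n > 0" for n
    unfolding thin_link_def
  proof (intro conjI allI impI)
    fix x y assume "x + y < n"
    then show "link0 L n x y = link0 L n y x" using sym n unfolding symmetric_link_def by auto
  next
    fix y t assume y: "y < n"
    let ?A = "{l. 1 \<le> l \<and> l \<le> n \<and> Suc y + l \<le> n + 1 \<and> L n (Suc y) l = t}"
    have "Suc ` {x. x + y < n \<and> link0 L n x y = t} \<subseteq> ?A"
    proof safe
      fix x assume x: "x + y < n" 
      then have "L n (Suc x) (Suc y) = L n (Suc y) (Suc x)" using sym n unfolding symmetric_link_def by auto
      then show "L n (Suc y) (Suc x) = L n (Suc x) (Suc y)" by simp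
    qed auto
    moreover have "finite ?A" by (rule finite_subset[of _ "{..n}"]) auto
    ultimately have "card {x. x + y < n \<and> link0 L n x y = t} \<le> card ?A"
      by (intro card_inj_on_le[of Suc]) auto
    also have "enat (card ?A) \<le> link_Delta L"
      unfolding link_Delta_def using n y
      by (intro SUP_upper2[of n] SUP_upper2[of t] SUP_upper2[of "Suc y"]) auto
    then have "card ?A \<le> D" unfolding D by simp
    finally show "card {x. x + y < n \<and> link0 L n x y = t} \<le> D" .
  qed
  then show ?thesis by blast
qed

lemma link_function_compat:
  assumes L: "link_function L" and xy: "x < n" "y < n" and N: "n \<le> N"
  shows "link0 L N x y = link0 L n x y"
  using N
proof (induction N rule: dec_induct)
  case (step N)
  have "L (Suc N) (Suc x) (Suc y) = L N (Suc x) (Suc y)"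
    using L xy step.hyps unfolding link_function_def by auto
  then show ?case using step.IH by simp
qed simp

text \<open>
  One null set serves countably many approximations, with mean square errors tending to \<open>0\<close>.
\<close>

lemma (in convergent_link) AE_weak_conv_standard_input:
  fixes M :: "'a measure" and x :: "int ^ 'd \<Rightarrow> 'a \<Rightarrow> real"
  assumes \<mu>: "real_distribution \<mu>" "\<And>r::nat. integrable \<mu> (\<lambda>x. x ^ r)" "\<And>r. (\<integral>x. x ^ r \<partial>\<mu>) = limit_moment L r"
    and std: "standard_input M x"
  shows "AE \<omega> in M. weak_conv_m (pat_esd L (\<lambda>t. x t \<omega>)) \<mu>"
proof -
  interpret prob_space M using std unfolding standard_input_def by blast
  define approx where "approx c z \<longleftrightarrow> (\<exists>K p q. bounded_input M z K \<and>
      small_tail M (\<lambda>t \<omega>. (x t \<omega> - z t \<omega>)\<^sup>2) p q (1 / (2 * real (Suc c))))" for c :: nat and z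
  have "\<forall>c. \<exists>z. approx c z"
  proof
    fix c :: nat
    have "0 < 1 / (2 * real (Suc c))" by simp
    from bounded_approximation[OF std this] show "\<exists>z. approx c z" unfolding approx_def by blast
  qed
  then obtain z where "\<forall>c. approx c (z c)" using choice[of approx] by blast
  then have bi: "\<exists>K. bounded_input M (z c) K"
    and st: "\<exists>p q. small_tail M (\<lambda>t \<omega>. (x t \<omega> - z c t \<omega>)\<^sup>2) p q (1 / (2 * real (Suc c)))" for c
    unfolding approx_def by blast+
  have W: "AE \<omega> in M. \<forall>c. weak_conv_m (pat_esd L (\<lambda>t. z c t \<omega>)) \<mu>"
    unfolding AE_all_countable
  proof
    fix c
    obtain K where "bounded_input M (z c) K" using bi by blast
    then interpret bounded_input M "z c" K .
    interpret patterned_input L D M "z c" K by unfold_locales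
    show "AE \<omega> in M. weak_conv_m (pat_esd L (\<lambda>t. z c t \<omega>)) \<mu>" by (rule AE_weak_conv[OF \<mu>])
  qed
  let ?y = "\<lambda>c m \<omega> e. (x (case_prod (link0 L (2 ^ m)) e) \<omega> - z c (case_prod (link0 L (2 ^ m)) e) \<omega>)\<^sup>2"
  have R: "AE \<omega> in M. \<forall>c. (\<lambda>m. (\<Sum>e\<in>tri_pairs (2 ^ m). if ?y c m \<omega> e > 2 ^ m then 1 else 0) / 2 ^ m :: real) \<longlonglongrightarrow> 0"
    unfolding AE_all_countable
  proof
    fix c
    obtain p q where s: "small_tail M (\<lambda>t \<omega>. (x t \<omega> - z c t \<omega>)\<^sup>2) p q (1 / (2 * real (Suc c)))" using st by blast
    show "AE \<omega> in M. (\<lambda>m. (\<Sum>e\<in>tri_pairs (2 ^ m). if ?y c m \<omega> e > 2 ^ m then 1 else 0) / 2 ^ m :: real) \<longlonglongrightarrow> 0"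
      using small_tail.AE_big_count[OF s, of "link0 L"] unfolding small_tail.big_count_def[OF s] .
  qed
  have V: "AE \<omega> in M. \<forall>c. eventually (\<lambda>m. (\<Sum>e\<in>tri_pairs (2 ^ m). if ?y c m \<omega> e \<le> 2 ^ m then ?y c m \<omega> e else 0)
      \<le> 1 / real (Suc c) * (2 ^ m)\<^sup>2) sequentially"
    unfolding AE_all_countable
  proof
    fix c
    obtain p q where s: "small_tail M (\<lambda>t \<omega>. (x t \<omega> - z c t \<omega>)\<^sup>2) p q (1 / (2 * real (Suc c)))" using st by blast
    have "1 / (2 * real (Suc c)) < 1 / real (Suc c)" by (simp add: field_simps)
    from small_tail.AE_small_sum[OF s thin this]
    show "AE \<omega> in M. eventually (\<lambda>m. (\<Sum>e\<in>tri_pairs (2 ^ m). if ?y c m \<omega> e \<le> 2 ^ m then ?y c m \<omega> e else 0)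
      \<le> 1 / real (Suc c) * (2 ^ m)\<^sup>2) sequentially"
      unfolding small_tail.small_sum_def[OF s] .
  qed
  from W R V show ?thesis
  proof eventually_elim
    case (elim \<omega>)
    show ?case
      by (rule weak_conv_of_approximations[OF \<mu>(1), of "\<lambda>c t. z c t \<omega>"]) (use elim in blast)+
  qed
qed

lemma (in convergent_link) even_moments_limit_moment:
  assumes \<mu>: "real_distribution \<mu>"
  shows "has_even_moments \<mu> (beta_even L) \<longleftrightarrow> (\<forall>r. integrable \<mu> (\<lambda>x. x ^ r) \<and> (\<integral>x. x ^ r \<partial>\<mu>) = limit_moment L r)"
proof -
  interpret real_distribution \<mu> by fact
  have 0: "(\<integral>x. x ^ 0 \<partial>\<mu>) = 1" using prob_space by simp
  show ?thesis
  proof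
    assume h: "has_even_moments \<mu> (beta_even L)"
    show "\<forall>r. integrable \<mu> (\<lambda>x. x ^ r) \<and> (\<integral>x. x ^ r \<partial>\<mu>) = limit_moment L r"
    proof (intro allI conjI)
      fix r
      show "integrable \<mu> (\<lambda>x. x ^ r)" using h unfolding has_even_moments_def by blast
      show "(\<integral>x. x ^ r \<partial>\<mu>) = limit_moment L r"
      proof (cases "odd r \<or> r = 0")
        case True
        then show ?thesis using h 0 unfolding has_even_moments_def by (auto simp: limit_moment_def)
      next
        case False
        then obtain k where "r = 2 * k" "k \<ge> 1" by (auto elim!: evenE)
        then show ?thesis using h unfolding has_even_moments_def by (auto simp: limit_moment_def)
      qed
    qed
  next
    assume "\<forall>r. integrable \<mu> (\<lambda>x. x ^ r) \<and> (\<integral>x. x ^ r \<partial>\<mu>) = limit_moment L r"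
    then show "has_even_moments \<mu> (beta_even L)" unfolding has_even_moments_def by (auto simp: limit_moment_def)
  qed
qed

theorem theorem2p1:
  fixes L :: "nat \<Rightarrow> nat \<Rightarrow> nat \<Rightarrow> int ^ 'd"
  assumes "CARD('d) \<in> {1, 2}"
    and "link_function L"
    and "symmetric_link L"
    and "link_Delta L < \<infinity>"
    and "\<forall>k\<ge>1. \<forall>w\<in>pair_matched_words (2 * k). convergent (pu_ratio L w)"
  shows "\<exists>\<mu> :: real measure.
           real_distribution \<mu> \<and>
           symmetric_distribution \<mu> \<and>
           has_even_moments \<mu> (beta_even L) \<and>
           (\<forall>\<nu>. real_distribution \<nu> \<and> has_even_moments \<nu> (beta_even L) \<longrightarrow> \<nu> = \<mu>) \<and>
           (\<forall>(M :: 'a measure) (x :: int ^ 'd \<Rightarrow> 'a \<Rightarrow> real). standard_input M x \<longrightarrow>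
              (AE \<omega> in M. has_LSD
                 (\<lambda>n. (1 / sqrt (real n)) \<cdot>\<^sub>m triangular_patterned L (\<lambda>t. x t \<omega>) n) \<mu>))"
proof -
  obtain D where D: "\<forall>n>0. thin_link n (link0 L n) D" using thin_link_of_Delta[OF assms(3,4)] by blast
  interpret convergent_link L D
  proof
    show "thin_link n (link0 L n) D" if "n > 0" for n using D that by blast
    show "link0 L N x y = link0 L n x y" if "x < n" "y < n" "n \<le> N" for n N x y
      using that by (rule link_function_compat[OF assms(2)])
    show "convergent (pu_ratio L w)" if "k \<ge> 1" "w \<in> pair_matched_words (2 * k)" for k w
      using assms(5) that by blast
  qed
  obtain \<mu> where \<mu>: "real_distribution \<mu>" "\<And>r::nat. integrable \<mu> (\<lambda>x. x ^ r)" "\<And>r. (\<integral>x. x ^ r \<partial>\<mu>) = limit_moment L r"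
    using limit_law_exists by blast
  interpret \<mu>: real_distribution \<mu> by (rule \<mu>(1))
  have unique: "\<nu> = \<mu>" if "real_distribution \<nu>" "has_even_moments \<nu> (beta_even L)" for \<nu>
  proof -
    have \<nu>: "\<And>r::nat. integrable \<nu> (\<lambda>x. x ^ r)" "\<And>r. (\<integral>x. x ^ r \<partial>\<nu>) = limit_moment L r"
      using that even_moments_limit_moment by blast+
    show ?thesis
      by (rule moments_determine_distribution[OF that(1) \<mu>(1) \<nu>(1) \<mu>(2), where D = "real (8 * D)"])
        (use \<nu>(2) \<mu>(3) limit_moment_bound in simp_all)
  qed
  have even: "has_even_moments \<mu> (beta_even L)" using even_moments_limit_moment[OF \<mu>(1)] \<mu> by blast
  have "symmetric_distribution \<mu>"
    unfolding symmetric_distribution_def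
  proof (rule unique)
    show rd: "real_distribution (distr \<mu> borel uminus)" by (rule \<mu>.real_distribution_distr) simp
    have "integrable (distr \<mu> borel uminus) (\<lambda>x. x ^ r) \<and> (\<integral>x. x ^ r \<partial>distr \<mu> borel uminus) = limit_moment L r" for r
    proof -
      have p: "(- x) ^ r = (- 1) ^ r * x ^ r" for x :: real by (rule power_minus)
      have "integrable \<mu> (\<lambda>x. (- x) ^ r)" by (subst p) (simp add: \<mu>(2))
      then have "integrable (distr \<mu> borel uminus) (\<lambda>x. x ^ r)" by (subst integrable_distr_eq) simp_all
      moreover have "(\<integral>x. (- x) ^ r \<partial>\<mu>) = (- 1) ^ r * limit_moment L r" by (subst p) (simp add: \<mu>(3))
      then have "(\<integral>x. x ^ r \<partial>distr \<mu> borel uminus) = (- 1) ^ r * limit_moment L r" by (subst integral_distr) simp_all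
      moreover have "(- 1) ^ r * limit_moment L r = limit_moment L r" by (cases "odd r") (simp_all add: limit_moment_def)
      ultimately show ?thesis by simp
    qed
    then show "has_even_moments (distr \<mu> borel uminus) (beta_even L)" using even_moments_limit_moment[OF rd] by blast
  qed
  moreover have "AE \<omega> in M. has_LSD (\<lambda>n. (1 / sqrt (real n)) \<cdot>\<^sub>m triangular_patterned L (\<lambda>t. x t \<omega>) n) \<mu>"
    if "standard_input M x" for M :: "'a measure" and x
    unfolding has_LSD_def using AE_weak_conv_standard_input[OF \<mu> that] \<mu>(1) by simp
  ultimately show ?thesis using \<mu>(1) even unique by blast
qed

end
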